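(* Let $x,y,z$ be non-negative integers and let $\mathbf a=(a_1,\dots,a_m)$, $\mathbf b=(b_1,\dots,b_n)$ be sequences of non-negative integers. Then $$M(RW^{(2)}_{x,y,z}(\mathbf a;\mathbf b))=\frac{M(RW^{(2)}_{x+y,0,z}(\mathbf a;\mathbf b))\,M(RW^{(2)}_{0,y,z}(\mathbf a;\mathbf b))}{M(RW^{(2)}_{y,0,z}(\mathbf a;\mathbf b))}\cdot\frac{T(x+1,2a+b+2y+z-2,y)\,V(2x+2a+1,b+2y+z-1,y)}{T(1,2a+b+2y+z-2,y)\,V(2a+1,b+2y+z-1,y)}.$$ Moreover, put $\mu=2\lfloor\frac{m+1}{2}\rfloor$, $\mu'=2\lceil\frac{m-1}{2}\rceil$, $\nu=2\lfloor\frac{n+1}{2}\rfloor$, $\nu'=2\lceil\frac{n-1}{2}\rceil$, and $$\mathbf t^{+}=(a_1,\dots,a_{\mu'},\,a_{\mu'+1}+x+y+b_{\nu},\,b_{\nu-1},\dots,b_1),\qquad \mathbf t^{-}=(0,a_1,\dots,a_{\mu-1},\,a_{\mu}+x+y+b_{\nu'+1},\,b_{\nu'},\dots,b_1,z).$$ Then also $$M(RW^{(2)}_{x,y,z}(\mathbf a;\mathbf b))=2^{a_1-y-1}\,K'(\mathbf t^{+})\,K'(\mathbf t^{-})\cdot\frac{H_2(2e_a+2o_b)\,H_2(2o_a+2e_b+2z)}{H_2(2e_a+2o_b+2y)\,H_2(2o_a+2e_b+2y+2z)}\cdot\frac{H(2a+b+2y+z-1)\,H(b+y+z)}{H(2a+b+y+z-1)\,H(b+z)}$$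 $$\cdot\frac{T(x+1,2a+b+2y+z-2,y)\,V(2x+2a+1,b+2y+z-1,y)}{T(1,2a+b+2y+z-2,y)\,V(2a+1,b+2y+z-1,y)}.$$
   Context: Lattice and tilings. For real $u,k$ let $[u;k]$ be the point of the plane with Cartesian coordinates $(u,\frac{\sqrt3}{2}k)$. The triangular lattice has as vertices all $[u;k]$ with $k\in\mathbb Z$, $u-k/2\in\mathbb Z$; its faces are unit equilateral triangles, up-pointing or down-pointing. A region is a finite union of unit triangles. A lozenge is the union of two unit triangles sharing an edge; it is vertical if that edge is horizontal. A tiling of a region is a covering of it by lozenges contained in it, without gaps or overlaps. $M(R)$ is the sum of the weights of all tilings of $R$, the weight of a tiling being the product of the weights of its lozenges; lozenges have weight $1$ unless stated otherwise; $M(\emptyset)=1$. Sequences. $a=\sum a_i$, $b=\sum b_j$; $o_a,e_a$ are the sums of the $a_i$ with $i$ odd, resp. even; $o_b,e_b$ likewise. $a_i=0$ for $i>m$, $b_j=0$ for $j>n$; an empty sequence is treated as the one-term sequence $(0)$. Functions. $H(n)=\prod_{i=0}^{n-1}i!$ (equal to $1$ for $n\le0$); $H_2(n)=\prod_{i=1}^{\lfloor n/2\rfloor}(n-2i)!$; for $n\ge0$, $(x)_n=x(x+1)\cdots(x+n-1)$ and $[x]_n=x(x+2)\cdots(x+2n-2)$ (both $1$ for $n=0$); $T(x,n,m)=\prod_{i=0}^{m-1}(x+i)_{n-2i}$, $V(x,n,m)=\prod_{i=0}^{m-1}[x+2i]_{n-2i}$. Empty products are $1$. Quartered hexagons. For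 a sequence $\mathbf t=(t_1,\dots,t_{2l})$ of non-negative integers let $s_k=t_1+\dots+t_k$, $o_t=\sum_{i\text{ odd}}t_i$, $e_t=\sum_{i\text{ even}}t_i$. If $e_t\ge1$, take the region bounded by the base from $[0;0]$ to $[o_t+e_t;0]$, the segment from $[o_t+e_t;0]$ to $[o_t+\frac12;2e_t-1]$, the north side from there to $[\frac12;2e_t-1]$, and the west zigzag through $[0;0],[\frac12;1],[0;2],[\frac12;3],\dots,[\frac12;2e_t-1]$; remove from it, for each $1\le i\le l$, the up-pointing triangle with base from $[s_{2i-1};0]$ to $[s_{2i};0]$. Give weight $\frac12$ to each vertical lozenge whose two western (left) sides both lie on the west zigzag. $K'(\mathbf t)$ is $M$ of this weighted region; if $e_t=0$, $K'(\mathbf t)=1$. The weighted region $RW^{(2)}_{x,y,z}(\mathbf a;\mathbf b)$. Let $L=x+y+a+b$, $A=2(y+e_a+o_b)-1$, $B=2(y+z+o_a+e_b)-1$, and let $\ell$ be the line $k=0$. Upper part (empty if $A=-1$): bounded by $\ell$ between $[0;0]$ and $[L;0]$, the segment from $[L;0]$ to $[L-\frac A2;A]$, the horizontal north side at height $k=A$, and the west zigzag through the points $[\alpha(k);k]$, $0\le k\le A$, with $\alpha(k)=0$ for $k$ even and $\frac12$ for $k$ odd. Lower part (empty if $B=-1$): bounded by $\ell$ between $[0;0]$ and $[L;0]$, the segments from $[L;0]$ to $[L+\frac z2;-z]$ and from there to $[L+z-\frac B2;-B]$, the horizontal south side at $k=-B$, and the west zigzag through $[\beta(k);-k]$, $0\le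 k\le B$, with $\beta(k)=0$ for $k$ even and $\frac12$ for $k$ odd. The region is the union of the two parts (lozenges may cross $\ell$) after removing: (i) from the lower part, everything at points $[u;-k]$ with $u<a_1-k/2$ (a down-pointing half triangle of side $2a_1$); (ii) for $2\le i\le m$, the triangle of side $a_i$ having a side on $\ell$ from $[a_1+\dots+a_{i-1};0]$ to $[a_1+\dots+a_i;0]$, up-pointing (above $\ell$) if $i$ is even, down-pointing (below $\ell$) if $i$ is odd; (iii) for $1\le j\le n$, the triangle of side $b_j$ having a side on $\ell$ from $[L-b_1-\dots-b_j;0]$ to $[L-b_1-\dots-b_{j-1};0]$, up-pointing (above $\ell$) if $j$ is odd, down-pointing (below $\ell$) if $j$ is even. Each vertical lozenge of the region whose two western (left) sides both lie on the west boundary zigzag (the union of the upper and lower zigzags) has weight $\frac12$.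
   Formalization: In the second identity the power of 2 is 2^{a_1-y-1} only when a_1 ≥ 1; when a_1 = 0 it is 2^{-y}, since the printed exponent then gives half the true value (e.g. x=y=z=0, a=b=(0): left side 1, right side 1/2). *)

theory Defs
  imports Complex_Main "HOL-Library.Disjoint_Sets"
begin

text \<open>
  The pair \<open>(w, k)\<close> of integers encodes the point \<open>[w/2; k]\<close>, whose Cartesian coordinates are
  \<open>(w/2, k * sqrt 3 / 2)\<close>.  The horizontal coordinate is doubled so that every vertex of the
  triangular lattice is an integer pair; the vertices are the pairs with \<open>w - k\<close> even.
  A unit triangle is represented by the set of its three vertices, a region by the set of the unit
  triangles it consists of, and a lozenge by the set of its two unit triangles.
\<close>

type_synonym point = "int \<times> int"
type_synonym triangle = "point set"
type_synonym region = "triangle set"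
type_synonym lozenge = "triangle set"

definition up_tri :: "int \<Rightarrow> int \<Rightarrow> triangle" where
  "up_tri w k = {(w, k), (w + 2, k), (w + 1, k + 1)}"

definition down_tri :: "int \<Rightarrow> int \<Rightarrow> triangle" where
  "down_tri w k = {(w, k), (w + 2, k), (w + 1, k - 1)}"

definition unit_triangles :: "triangle set" where
  "unit_triangles =
     {up_tri w k | w k. even (w - k)} \<union> {down_tri w k | w k. even (w - k)}"

text \<open>Two distinct unit triangles share an edge iff they have exactly two common vertices.\<close>

definition is_lozenge :: "lozenge \<Rightarrow> bool" where
  "is_lozenge l \<longleftrightarrow>
     (\<exists>s\<in>unit_triangles. \<exists>t\<in>unit_triangles. s \<noteq> t \<and> card (s \<inter> t) = 2 \<and> l = {s, t})"

definition tilings :: "region \<Rightarrow> lozenge set set" where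
  "tilings R = {\<T>. partition_on R \<T> \<and> (\<forall>l\<in>\<T>. is_lozenge l)}"

definition tiling_sum :: "(lozenge \<Rightarrow> real) \<Rightarrow> region \<Rightarrow> real" where
  "tiling_sum wt R = (\<Sum>\<T>\<in>tilings R. \<Prod>l\<in>\<T>. wt l)"

text \<open>
  \<open>P\<close> is the set of integer pairs lying in some closed part of the plane.  All the parts used below
  meet each horizontal strip \<open>k \<le> height \<le> k + 1\<close> in a convex set, so a unit triangle is contained
  in such a part iff its vertices are.
\<close>

definition triangles_in :: "point set \<Rightarrow> region" where
  "triangles_in P = {t \<in> unit_triangles. t \<subseteq> P}"

text \<open>
  The edges of the zigzag through the points \<open>[0; k]\<close> (\<open>k\<close> even) and \<open>[1/2; k]\<close> (\<open>k\<close> odd) for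
  \<open>p \<le> k \<le> q\<close>.
\<close>

definition zigzag :: "int \<Rightarrow> int \<Rightarrow> point set set" where
  "zigzag p q = {{(k mod 2, k), ((k + 1) mod 2, k + 1)} | k. p \<le> k \<and> k < q}"

definition zigzag_weight :: "point set set \<Rightarrow> lozenge \<Rightarrow> real" where
  "zigzag_weight Z l =
     (if \<exists>w k. l = {up_tri w k, down_tri w k} \<and>
               {(w, k), (w + 1, k + 1)} \<in> Z \<and> {(w, k), (w + 1, k - 1)} \<in> Z
      then 1 / 2 else 1)"

text \<open>
  The closed triangle above (\<open>up_hole\<close>) or below (\<open>down_hole\<close>) the line \<open>k = 0\<close> having the segment
  from \<open>[p; 0]\<close> to \<open>[q; 0]\<close> as a side.
\<close>

definition up_hole :: "int \<Rightarrow> int \<Rightarrow> point set" where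
  "up_hole p q = {(w, k). 0 \<le> k \<and> 2 * p + k \<le> w \<and> w \<le> 2 * q - k}"

definition down_hole :: "int \<Rightarrow> int \<Rightarrow> point set" where
  "down_hole p q = {(w, k). k \<le> 0 \<and> 2 * p - k \<le> w \<and> w \<le> 2 * q + k}"

text \<open>Terms of a finite sequence are numbered from 1 and are 0 beyond its length.\<close>

definition term_at :: "nat list \<Rightarrow> nat \<Rightarrow> nat" where
  "term_at s i = (if 1 \<le> i \<and> i \<le> length s then s ! (i - 1) else 0)"

definition partial_sum :: "nat list \<Rightarrow> nat \<Rightarrow> nat" where
  "partial_sum s k = (\<Sum>i = 1..k. term_at s i)"

definition odd_sum :: "nat list \<Rightarrow> nat" where
  "odd_sum s = (\<Sum>i | i \<in> {1..length s} \<and> odd i. term_at s i)"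

definition even_sum :: "nat list \<Rightarrow> nat" where
  "even_sum s = (\<Sum>i | i \<in> {1..length s} \<and> even i. term_at s i)"

definition nonempty_seq :: "nat list \<Rightarrow> nat list" where
  "nonempty_seq s = (if s = [] then [0] else s)"

definition hyperfac :: "int \<Rightarrow> real" where  (* H(n) *)
  "hyperfac n = (\<Prod>i<nat n. fact i)"

definition hyperfac2 :: "nat \<Rightarrow> real" where  (* H_2(n) *)
  "hyperfac2 n = (\<Prod>i = 1..n div 2. fact (n - 2 * i))"

definition skip_pochhammer :: "real \<Rightarrow> nat \<Rightarrow> real" where  (* [x]_n *)
  "skip_pochhammer x n = (\<Prod>i<n. x + 2 * real i)"

text \<open>
  The lengths \<open>n - 2 * i\<close> are non-negative wherever these two functions are used, so \<open>nat\<close> does not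
  truncate there.
\<close>

definition T_prod :: "real \<Rightarrow> int \<Rightarrow> nat \<Rightarrow> real" where
  "T_prod x n m = (\<Prod>i<m. pochhammer (x + real i) (nat (n - 2 * int i)))"

definition V_prod :: "real \<Rightarrow> int \<Rightarrow> nat \<Rightarrow> real" where
  "V_prod x n m = (\<Prod>i<m. skip_pochhammer (x + 2 * real i) (nat (n - 2 * int i)))"

text \<open>The quartered hexagon of a sequence \<open>t\<close> of even length, and \<open>K'(t)\<close>.\<close>

definition quartered_hexagon :: "nat list \<Rightarrow> region" where
  "quartered_hexagon t =
     triangles_in {(w, k). 0 \<le> k \<and> k \<le> 2 * int (even_sum t) - 1 \<and>
       k mod 2 \<le> w \<and> w \<le> 2 * int (odd_sum t + even_sum t) - k}
     - (\<Union>i\<in>{1..length t div 2}.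
          triangles_in (up_hole (int (partial_sum t (2 * i - 1))) (int (partial_sum t (2 * i)))))"

definition K' :: "nat list \<Rightarrow> real" where
  "K' t =
     (if even_sum t = 0 then 1
      else tiling_sum (zigzag_weight (zigzag 0 (2 * int (even_sum t) - 1))) (quartered_hexagon t))"

text \<open>The parameters \<open>L\<close>, \<open>A\<close>, \<open>B\<close> and the region \<open>RW\<^sup>(\<^sup>2\<^sup>)\<close> with its weight.\<close>

definition RW_L :: "nat \<Rightarrow> nat \<Rightarrow> nat list \<Rightarrow> nat list \<Rightarrow> int" where
  "RW_L x y a b = int (x + y + sum_list a + sum_list b)"

definition RW_A :: "nat \<Rightarrow> nat list \<Rightarrow> nat list \<Rightarrow> int" where
  "RW_A y a b = 2 * int (y + even_sum a + odd_sum b) - 1"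

definition RW_B :: "nat \<Rightarrow> nat \<Rightarrow> nat list \<Rightarrow> nat list \<Rightarrow> int" where
  "RW_B y z a b = 2 * int (y + z + odd_sum a + even_sum b) - 1"

definition RW_upper :: "nat \<Rightarrow> nat \<Rightarrow> nat list \<Rightarrow> nat list \<Rightarrow> point set" where
  "RW_upper x y a b =
     {(w, k). 0 \<le> k \<and> k \<le> RW_A y a b \<and> k mod 2 \<le> w \<and> w \<le> 2 * RW_L x y a b - k}"

definition RW_lower :: "nat \<Rightarrow> nat \<Rightarrow> nat \<Rightarrow> nat list \<Rightarrow> nat list \<Rightarrow> point set" where
  "RW_lower x y z a b =
     {(w, k). - RW_B y z a b \<le> k \<and> k \<le> 0 \<and> k mod 2 \<le> w \<and>
        w \<le> 2 * RW_L x y a b - k \<and> w \<le> 2 * (RW_L x y a b + int z) + k}"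

text \<open>
  The removed half triangle has its slanted side on the lattice line \<open>w = 2 * a\<^sub>1 + k\<close>, so it is
  made of the unit triangles lying in the closed half-plane to the left of that line.
\<close>

definition RW_removed :: "nat \<Rightarrow> nat \<Rightarrow> nat list \<Rightarrow> nat list \<Rightarrow> region" where
  "RW_removed x y a b =
     triangles_in {(w, k). k \<le> 0 \<and> w \<le> 2 * int (term_at a 1) + k}
     \<union> (\<Union>i\<in>{2..length a}.
          triangles_in ((if even i then up_hole else down_hole)
            (int (partial_sum a (i - 1))) (int (partial_sum a i))))
     \<union> (\<Union>j\<in>{1..length b}.
          triangles_in ((if odd j then up_hole else down_hole)
            (RW_L x y a b - int (partial_sum b j)) (RW_L x y a b - int (partial_sum b (j - 1)))))"

definition RW_region :: "nat \<Rightarrow> nat \<Rightarrow> nat \<Rightarrow> nat list \<Rightarrow> nat list \<Rightarrow> region" where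
  "RW_region x y z a b =
     (triangles_in (RW_upper x y a b) \<union> triangles_in (RW_lower x y z a b)) - RW_removed x y a b"

definition M_RW :: "nat \<Rightarrow> nat \<Rightarrow> nat \<Rightarrow> nat list \<Rightarrow> nat list \<Rightarrow> real" where
  "M_RW x y z a b =
     tiling_sum (zigzag_weight (zigzag 0 (RW_A y a b) \<union> zigzag (- RW_B y z a b) 0))
       (RW_region x y z a b)"

text \<open>
  The sequences \<open>t\<^sup>+\<close> and \<open>t\<^sup>-\<close>.  For a natural number \<open>m\<close>, the floor of \<open>(m + 1) / 2\<close> is
  \<open>(m + 1) div 2\<close> and the ceiling of \<open>(m - 1) / 2\<close> is \<open>m div 2\<close>.
\<close>

definition t_plus :: "nat \<Rightarrow> nat \<Rightarrow> nat list \<Rightarrow> nat list \<Rightarrow> nat list" where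
  "t_plus x y a b =
     (let \<mu>' = 2 * (length (nonempty_seq a) div 2);
          \<nu> = 2 * ((length (nonempty_seq b) + 1) div 2)
      in map (term_at a) [1..<\<mu>' + 1]
         @ [term_at a (\<mu>' + 1) + x + y + term_at b \<nu>]
         @ map (term_at b) (rev [1..<\<nu>]))"

definition t_minus :: "nat \<Rightarrow> nat \<Rightarrow> nat \<Rightarrow> nat list \<Rightarrow> nat list \<Rightarrow> nat list" where
  "t_minus x y z a b =
     (let \<mu> = 2 * ((length (nonempty_seq a) + 1) div 2);
          \<nu>' = 2 * (length (nonempty_seq b) div 2)
      in [0] @ map (term_at a) [1..<\<mu>]
         @ [term_at a \<mu> + x + y + term_at b (\<nu>' + 1)]
         @ map (term_at b) (rev [1..<\<nu>' + 1]) @ [z])"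

text \<open>
  The power of 2 in the second product formula has exponent \<open>a\<^sub>1 - y - 1\<close> only for
  \<open>a\<^sub>1 \<ge> 1\<close>: the triangle of side \<open>a\<^sub>1\<close> removed in \<open>K'(t\<^sup>-)\<close> then forces \<open>a\<^sub>1 - 1\<close>
  lozenges of weight 1/2 on the zigzag, which the half triangle removed from \<open>RW\<^sup>(\<^sup>2\<^sup>)\<close>
  absorbs.  For \<open>a\<^sub>1 = 0\<close> nothing is forced and the exponent is \<open>-y\<close>; for instance, if
  \<open>x = y = z = 0\<close> and \<open>a = b = (0)\<close>, the region is empty, both sides are 1, and the exponent
  \<open>a\<^sub>1 - y - 1\<close> would give 1/2.
\<close>

end

theory Submission
  imports Defs "Jordan_Normal_Form.Determinant"
begin

text \<open>
  Cutting a dented trapezoid along its horizontal lattice lines turns a tiling into a chain of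
  interlacing sets, so its weighted count is the determinant of central factorial polynomials at the
  dents, which is a Vandermonde product in the squares of the dents, up to a constant.  Filling the
  triangular holes with forced lozenges makes both the quartered hexagons and the two halves of the
  region dented trapezoids.  If the vertical lozenges crossing \<open>\<ell>\<close> are at the positions \<open>S\<close>, the dents of the
  halves are \<open>P \<union> S\<close> and \<open>M \<union> S\<close>, where \<open>P\<close> and \<open>M\<close> are the dents of \<open>t\<^sup>+\<close> and \<open>t\<^sup>-\<close>.  In the sum over
  \<open>S\<close> the factors involving \<open>S\<close> depend on the ferns only through \<open>P \<union> M\<close>, which is a union of two
  intervals.  What remains is a discrete Selberg sum: by Andreief's identity it is a determinant,
  whose entries are very-well-poised sums in closed form, and this determinant is of Hankel type.
  This gives the second identity.  The first follows, because every factor of the second is a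
  function of \<open>x + y\<close> or of \<open>y\<close>, except for the last quotient.
\<close>

section \<open>Tilings by blocks\<close>

text \<open>Squares appear because of the weight 1/2. A zigzag weighted in this way acts as a mirror
  at abscissa 0: the polynomials that count strip after strip are alternately even and odd, and
  their sums telescope without a boundary term. After every two strips the entries are again even
  polynomials of the dents. The size of \<open>S\<close> is dictated by balance: each half needs a
  fixed number of dents, which leaves exactly \<open>y\<close> crossings. The Vandermonde product of
  a union splits into two Vandermonde products and a cross factor, and the cross factors of
  \<open>S\<close> with \<open>P\<close> and with \<open>M\<close> multiply to a single product over
  \<open>P \<union> M\<close>. This is why the way in which the ferns are cut does not affect the
  sum. The powers of 2 have two sources. The removed half triangle absorbs \<open>a_1 - 1\<close>
  forced lozenges of weight 1/2, or none if \<open>a_1 = 0\<close>, and every crossing contributes a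
  factor 1/2 through the one-point sum. A Vandermonde determinant is insensitive to the nodes of the
  Newton basis in which it is written. So the rows and columns of the Gram matrix can be given
  different bases, chosen to make every entry a one-point sum.\<close>

definition block_tilings :: "('a set \<Rightarrow> bool) \<Rightarrow> 'a set \<Rightarrow> 'a set set set" where
  "block_tilings L R = {T. partition_on R T \<and> (\<forall>l\<in>T. L l)}"

definition block_sum :: "('a set \<Rightarrow> bool) \<Rightarrow> ('a set \<Rightarrow> real) \<Rightarrow> 'a set \<Rightarrow> real" where
  "block_sum L wt R = (\<Sum>T\<in>block_tilings L R. \<Prod>l\<in>T. wt l)"

lemma tiling_sum_eq_block_sum: "tiling_sum wt R = block_sum is_lozenge wt R"
  by (simp add: tiling_sum_def tilings_def block_sum_def block_tilings_def)

lemma finite_block_tilings: "finite R \<Longrightarrow> finite (block_tilings L R)"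
  by (rule finite_subset[of _ "Pow (Pow R)"]) (auto simp: block_tilings_def partition_on_def)

lemma block_tilingsD:
  assumes "T \<in> block_tilings L R"
  shows "partition_on R T" "\<And>l. l \<in> T \<Longrightarrow> L l" "\<And>l. l \<in> T \<Longrightarrow> l \<subseteq> R" "\<And>l. l \<in> T \<Longrightarrow> l \<noteq> {}"
    "\<And>l l'. l \<in> T \<Longrightarrow> l' \<in> T \<Longrightarrow> l \<inter> l' \<noteq> {} \<Longrightarrow> l = l'" "\<Union>T = R"
  using assms by (auto simp: block_tilings_def partition_on_def disjoint_def)

lemma finite_block_tiling: "finite R \<Longrightarrow> T \<in> block_tilings L R \<Longrightarrow> finite T"
  by (rule finite_subset[of _ "Pow R"]) (auto simp: block_tilings_def partition_on_def)

lemma block_tilingsI: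
  assumes "\<Union>T = R" "\<And>l l'. l \<in> T \<Longrightarrow> l' \<in> T \<Longrightarrow> l \<inter> l' \<noteq> {} \<Longrightarrow> l = l'" "\<And>l. l \<in> T \<Longrightarrow> l \<noteq> {}"
    "\<And>l. l \<in> T \<Longrightarrow> L l"
  shows "T \<in> block_tilings L R"
  using assms by (auto simp: block_tilings_def partition_on_def disjoint_def)

lemma block_sum_empty [simp]: "block_sum L wt {} = 1"
proof -
  have "block_tilings L {} = {{}}" by (auto simp: block_tilings_def partition_on_def)
  thus ?thesis by (simp add: block_sum_def)
qed

lemma block_sum_cong:
  assumes "\<And>l. l \<subseteq> R \<Longrightarrow> l \<noteq> {} \<Longrightarrow> L l = L' l" "\<And>l. l \<subseteq> R \<Longrightarrow> L l \<Longrightarrow> wt l = wt' l"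
  shows "block_sum L wt R = block_sum L' wt' R"
proof -
  have 1: "block_tilings L R = block_tilings L' R"
    using assms(1) unfolding block_tilings_def partition_on_def by blast
  show ?thesis unfolding block_sum_def 1[symmetric]
    by (intro sum.cong prod.cong refl) (use assms(2) in \<open>auto simp: block_tilings_def partition_on_def\<close>)
qed

lemma block_sum_zero:
  assumes "t \<in> R" "\<And>l. L l \<Longrightarrow> l \<subseteq> R \<Longrightarrow> t \<in> l \<Longrightarrow> False"
  shows "block_sum L wt R = 0"
proof -
  have "block_tilings L R = {}"
  proof (rule equals0I)
    fix T assume T: "T \<in> block_tilings L R"
    then obtain l where "l \<in> T" "t \<in> l" using assms(1) block_tilingsD(6)[OF T] by blast
    with assms(2) block_tilingsD[OF T] show False by blast
  qed
  thus ?thesis by (simp add: block_sum_def)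
qed

text \<open>The image map carries tilings to tilings, with predicate and weight pulled back along
  \<open>f\<close>. It serves to pass from vertex sets to coordinates and to exploit the symmetries
  of the brick wall.\<close>

lemma block_sum_image:
  assumes "inj_on f R"
  shows "block_sum L wt (f ` R) = block_sum (\<lambda>l. L (f ` l)) (\<lambda>l. wt (f ` l)) R"
proof -
  let ?g = "\<lambda>T. (`) f ` T"
  let ?A = "block_tilings (\<lambda>l. L (f ` l)) R" and ?B = "block_tilings L (f ` R)"
  have injP: "inj_on ((`) f) (Pow R)" by (rule inj_on_image_Pow[OF assms])
  have injPP: "inj_on ?g (Pow (Pow R))" by (rule inj_on_image_Pow[OF injP])
  have sub: "?A \<subseteq> Pow (Pow R)" by (auto simp: block_tilings_def partition_on_def)
  have img: "?g T \<in> ?B" if "T \<in> ?A" for T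
  proof (rule block_tilingsI)
    note D = block_tilingsD[OF that]
    show "\<Union>(?g T) = f ` R" using D(6) by blast
    fix l assume "l \<in> ?g T"
    then obtain m where m: "m \<in> T" "l = f ` m" by blast
    show "l \<noteq> {}" "L l" using m D by auto
    fix l' assume "l' \<in> ?g T" and ne: "l \<inter> l' \<noteq> {}"
    then obtain m' where m': "m' \<in> T" "l' = f ` m'" by blast
    have "m \<inter> m' \<noteq> {}" using ne m m' D(3) assms
      by (metis image_is_empty inj_on_image_Int)
    thus "l = l'" using D(5) m m' by blast
  qed
  have surj: "\<exists>T\<in>?A. ?g T = T'" if "T' \<in> ?B" for T'
  proof
    note D = block_tilingsD[OF that]
    let ?T = "(\<lambda>l. R \<inter> f -` l) ` T'"
    have fl: "f ` (R \<inter> f -` l) = l" if "l \<in> T'" for l using D(3)[OF that] by blast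
    show "?g ?T = T'" using fl by (simp add: image_image)
    show "?T \<in> ?A"
    proof (rule block_tilingsI)
      show "\<Union>?T = R" using D(6) by blast
      fix l assume "l \<in> ?T"
      then obtain m where m: "m \<in> T'" "l = R \<inter> f -` m" by blast
      obtain u where "u \<in> m" using D(4)[OF m(1)] by blast
      moreover from this obtain v where "v \<in> R" "u = f v" using D(3)[OF m(1)] by blast
      ultimately show "l \<noteq> {}" using m by blast
      show "L (f ` l)" using m fl D(2) by metis
      fix l' assume "l' \<in> ?T" and ne: "l \<inter> l' \<noteq> {}"
      then obtain m' where m': "m' \<in> T'" "l' = R \<inter> f -` m'" by blast
      have "m \<inter> m' \<noteq> {}" using ne m m' by blast
      thus "l = l'" using D(5) m m' by blast
    qed
  qed
  have bij: "bij_betw ?g ?A ?B"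
  proof (unfold bij_betw_def, intro conjI equalityI subsetI)
    show "inj_on ?g ?A" by (rule inj_on_subset[OF injPP sub])
    show "T' \<in> ?B" if "T' \<in> ?g ` ?A" for T' using that img by (elim imageE) simp
    show "T' \<in> ?g ` ?A" if "T' \<in> ?B" for T' using surj[OF that] by (elim bexE) (erule image_eqI[OF sym])
  qed
  have "block_sum L wt (f ` R) = (\<Sum>T\<in>?A. \<Prod>l\<in>?g T. wt l)"
    unfolding block_sum_def by (rule sum.reindex_bij_betw[OF bij, symmetric])
  also have "\<dots> = (\<Sum>T\<in>?A. \<Prod>l\<in>T. wt (f ` l))"
  proof (rule sum.cong[OF refl])
    fix T assume "T \<in> ?A"
    hence "T \<subseteq> Pow R" using sub by blast
    hence "inj_on ((`) f) T" by (rule inj_on_subset[OF injP])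
    thus "(\<Prod>l\<in>?g T. wt l) = (\<Prod>l\<in>T. wt (f ` l))" by (simp add: prod.reindex)
  qed
  finally show ?thesis by (simp add: block_sum_def)
qed

text \<open>A cell that admits a single block puts this block into every tiling. So all tilings
  contain \<open>X\<close>, and deleting \<open>X\<close> is a bijection onto the tilings of the
  rest.\<close>

lemma block_sum_forced:
  assumes fin: "finite R" and disj: "disjoint X"
    and X: "\<And>l. l \<in> X \<Longrightarrow> L l" "\<And>l. l \<in> X \<Longrightarrow> l \<subseteq> R"
    and forced: "\<And>l. l \<in> X \<Longrightarrow> \<exists>t\<in>l. \<forall>l'. L l' \<longrightarrow> l' \<subseteq> R \<longrightarrow> t \<in> l' \<longrightarrow> l' = l"
  shows "block_sum L wt R = (\<Prod>l\<in>X. wt l) * block_sum L wt (R - \<Union>X)"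
proof -
  have XT: "X \<subseteq> T" if T: "T \<in> block_tilings L R" for T
  proof
    fix l assume l: "l \<in> X"
    note D = block_tilingsD[OF T]
    obtain t where t: "t \<in> l" "\<forall>l'. L l' \<longrightarrow> l' \<subseteq> R \<longrightarrow> t \<in> l' \<longrightarrow> l' = l" using forced[OF l] by blast
    then obtain m where "m \<in> T" "t \<in> m" using D(6) X(2)[OF l] by blast
    thus "l \<in> T" using D t by blast
  qed
  have Xne: "l \<noteq> {}" if "l \<in> X" for l using forced[OF that] by blast
  have "block_sum L wt R = (\<Sum>T\<in>block_tilings L (R - \<Union>X). (\<Prod>l\<in>X. wt l) * (\<Prod>l\<in>T. wt l))"
    unfolding block_sum_def
  proof (rule sum.reindex_bij_witness[of _ "\<lambda>T. X \<union> T" "\<lambda>T. T - X"])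
    fix T assume T: "T \<in> block_tilings L R"
    note D = block_tilingsD[OF T]
    show "X \<union> (T - X) = T" using XT[OF T] by blast
    show "T - X \<in> block_tilings L (R - \<Union>X)"
    proof (rule block_tilingsI)
      show "\<Union>(T - X) = R - \<Union>X"
      proof (intro equalityI subsetI)
        fix t assume "t \<in> \<Union>(T - X)"
        then obtain l where l: "l \<in> T" "l \<notin> X" "t \<in> l" by blast
        have "t \<notin> l'" if "l' \<in> X" for l' using D(5)[OF l(1), of l'] XT[OF T] that l by blast
        thus "t \<in> R - \<Union>X" using l D(3) by blast
      qed (use D(6) in blast)
    qed (use D in auto)
    show "(\<Prod>l\<in>X. wt l) * (\<Prod>l\<in>T - X. wt l) = (\<Prod>l\<in>T. wt l)"
      using prod.subset_diff[OF XT[OF T] finite_block_tiling[OF fin T], of wt] by (simp add: mult.commute)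
  next
    fix T assume T: "T \<in> block_tilings L (R - \<Union>X)"
    note D = block_tilingsD[OF T]
    have "l \<notin> X" if "l \<in> T" for l using D(3,4)[OF that] by blast
    thus "X \<union> T - X = T" by blast
    show "X \<union> T \<in> block_tilings L R"
    proof (rule block_tilingsI)
      show "\<Union>(X \<union> T) = R" using D(6) X(2) by blast
      fix l assume l: "l \<in> X \<union> T"
      show "L l" using l D(2) X(1) by blast
      show "l \<noteq> {}" using l D(4) Xne by blast
      fix l' assume l': "l' \<in> X \<union> T" and ne: "l \<inter> l' \<noteq> {}"
      show "l = l'"
      proof (cases "l \<in> X")
        case True
        hence "l' \<in> X" using l' ne D(3) by blast
        with True show ?thesis using disj ne by (auto simp: disjoint_def)
      next
        case False
        hence "l \<in> T" using l by blast
        hence "l' \<in> T" using l' ne D(3) by blast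
        thus ?thesis using D(5) \<open>l \<in> T\<close> ne by blast
      qed
    qed
  qed
  thus ?thesis by (simp add: block_sum_def sum_distrib_left)
qed

text \<open>A tiling consists of its blocks straddling the two parts and of tilings of what these
  leave in each part. Since \<open>K\<close> is a disjoint family, any straddling blocks can occur
  together, so \<open>X\<close> runs through all of \<open>Pow K\<close>.\<close>

lemma block_sum_split:
  assumes fin: "finite R1" "finite R2" and disj12: "R1 \<inter> R2 = {}" and disjK: "disjoint K"
    and K: "\<And>l. l \<in> K \<longleftrightarrow> L l \<and> l \<subseteq> R1 \<union> R2 \<and> l \<inter> R1 \<noteq> {} \<and> l \<inter> R2 \<noteq> {}"
  shows "block_sum L wt (R1 \<union> R2) =
    (\<Sum>X\<in>Pow K. (\<Prod>l\<in>X. wt l) * (block_sum L wt (R1 - \<Union>X) * block_sum L wt (R2 - \<Union>X)))"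
proof -
  let ?B = "\<lambda>X. block_tilings L (R1 - \<Union>X) \<times> block_tilings L (R2 - \<Union>X)"
  have finK: "finite K" by (rule finite_subset[of _ "Pow (R1 \<union> R2)"]) (use K fin in auto)
  have "(\<Sum>X\<in>Pow K. (\<Prod>l\<in>X. wt l) * (block_sum L wt (R1 - \<Union>X) * block_sum L wt (R2 - \<Union>X)))
      = (\<Sum>X\<in>Pow K. \<Sum>p\<in>?B X. (\<Prod>l\<in>X. wt l) * ((\<Prod>l\<in>fst p. wt l) * (\<Prod>l\<in>snd p. wt l)))"
  proof (rule sum.cong[OF refl])
    fix X
    have "block_sum L wt (R1 - \<Union>X) * block_sum L wt (R2 - \<Union>X) =
        (\<Sum>p\<in>?B X. (\<Prod>l\<in>fst p. wt l) * (\<Prod>l\<in>snd p. wt l))"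
      unfolding block_sum_def sum_product sum.cartesian_product by (simp add: case_prod_unfold)
    thus "(\<Prod>l\<in>X. wt l) * (block_sum L wt (R1 - \<Union>X) * block_sum L wt (R2 - \<Union>X)) =
        (\<Sum>p\<in>?B X. (\<Prod>l\<in>X. wt l) * ((\<Prod>l\<in>fst p. wt l) * (\<Prod>l\<in>snd p. wt l)))"
      by (simp only: sum_distrib_left)
  qed
  also have "\<dots> = (\<Sum>q\<in>Sigma (Pow K) ?B. (\<Prod>l\<in>fst q. wt l) * ((\<Prod>l\<in>fst (snd q). wt l) * (\<Prod>l\<in>snd (snd q). wt l)))"
    using fin finK by (subst sum.Sigma) (auto simp: finite_block_tilings case_prod_unfold)
  also have "\<dots> = block_sum L wt (R1 \<union> R2)"
    unfolding block_sum_def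
  proof (rule sum.reindex_bij_witness[of _ "\<lambda>T. (T \<inter> K, {l\<in>T. l \<subseteq> R1}, {l\<in>T. l \<subseteq> R2})" "\<lambda>q. fst q \<union> (fst (snd q) \<union> snd (snd q))"])
    fix q assume q: "q \<in> Sigma (Pow K) ?B"
    obtain X T1 T2 where q': "q = (X, T1, T2)" by (cases q) auto
    from q have X: "X \<subseteq> K" and T1: "T1 \<in> block_tilings L (R1 - \<Union>X)" and T2: "T2 \<in> block_tilings L (R2 - \<Union>X)"
      by (auto simp: q')
    note D1 = block_tilingsD[OF T1] and D2 = block_tilingsD[OF T2]
    have kx: "\<not> l \<subseteq> R1" "\<not> l \<subseteq> R2" "l \<noteq> {}" "L l" "l \<subseteq> R1 \<union> R2" if "l \<in> X" for l
      using that X K[of l] disj12 by blast+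
    have k1: "l \<notin> K" "\<not> l \<subseteq> R2" "l \<subseteq> R1" if "l \<in> T1" for l
      using D1(3,4)[OF that] K[of l] disj12 by blast+
    have k2: "l \<notin> K" "\<not> l \<subseteq> R1" "l \<subseteq> R2" if "l \<in> T2" for l
      using D2(3,4)[OF that] K[of l] disj12 by blast+
    have e1: "(X \<union> (T1 \<union> T2)) \<inter> K = X" using X k1(1) k2(1) by blast
    have e2: "{l \<in> X \<union> (T1 \<union> T2). l \<subseteq> R1} = T1" using kx(1) k1(3) k2(2) by blast
    have e3: "{l \<in> X \<union> (T1 \<union> T2). l \<subseteq> R2} = T2" using kx(2) k1(2) k2(3) by blast
    show "((fst q \<union> (fst (snd q) \<union> snd (snd q))) \<inter> K, {l\<in>fst q \<union> (fst (snd q) \<union> snd (snd q)). l \<subseteq> R1}, {l\<in>fst q \<union> (fst (snd q) \<union> snd (snd q)). l \<subseteq> R2}) = q"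
      using e1 e2 e3 by (simp add: q' Let_def)
    show "fst q \<union> (fst (snd q) \<union> snd (snd q)) \<in> block_tilings L (R1 \<union> R2)"
    proof (rule block_tilingsI)
      have "\<Union>X \<subseteq> R1 \<union> R2" using kx(5) by blast
      moreover have "\<Union>(X \<union> (T1 \<union> T2)) = \<Union>X \<union> (R1 - \<Union>X) \<union> (R2 - \<Union>X)" using D1(6) D2(6) by blast
      ultimately show "\<Union>(fst q \<union> (fst (snd q) \<union> snd (snd q))) = R1 \<union> R2" by (auto simp: q')
      fix l assume l: "l \<in> fst q \<union> (fst (snd q) \<union> snd (snd q))"
      hence l3: "l \<in> X \<or> l \<in> T1 \<or> l \<in> T2" by (simp add: q')
      show "l \<noteq> {}" using l3 kx(3) D1(4) D2(4) by blast
      show "L l" using l3 kx(4) D1(2) D2(2) by blast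
      fix l' assume l': "l' \<in> fst q \<union> (fst (snd q) \<union> snd (snd q))" and ne: "l \<inter> l' \<noteq> {}"
      have x1: "m \<inter> m' = {}" if "m \<in> X" "m' \<in> T1" for m m' using D1(3)[OF that(2)] that by blast
      have x2: "m \<inter> m' = {}" if "m \<in> X" "m' \<in> T2" for m m' using D2(3)[OF that(2)] that by blast
      have x3: "m \<inter> m' = {}" if "m \<in> T1" "m' \<in> T2" for m m' using k1(3)[OF that(1)] k2(3)[OF that(2)] disj12 by blast
      have x4: "m = m'" if "m \<in> X" "m' \<in> X" "m \<inter> m' \<noteq> {}" for m m'
        using that X disjK by (auto simp: disjoint_def)
      consider "l \<in> X \<and> l' \<in> X" | "l \<in> T1 \<and> l' \<in> T1" | "l \<in> T2 \<and> l' \<in> T2"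
        using l l' ne x1[of l l'] x1[of l' l] x2[of l l'] x2[of l' l] x3[of l l'] x3[of l' l]
        by (auto simp: q' Int_commute)
      thus "l = l'"
      proof cases
        case 1 thus ?thesis using x4[of l l'] ne by simp
      next
        case 2 thus ?thesis using D1(5)[of l l'] ne by simp
      next
        case 3 thus ?thesis using D2(5)[of l l'] ne by simp
      qed
    qed
    have "X \<inter> (T1 \<union> T2) = {}" using k1(1) k2(1) X by blast
    moreover have "T1 \<inter> T2 = {}" using k1(2) k2(3) by blast
    moreover have "finite X" "finite T1" "finite T2"
      using finite_subset[OF X finK] finite_block_tiling[OF _ T1] finite_block_tiling[OF _ T2] fin by auto
    ultimately show "(\<Prod>l\<in>fst q \<union> (fst (snd q) \<union> snd (snd q)). wt l)
        = (\<Prod>l\<in>fst q. wt l) * ((\<Prod>l\<in>fst (snd q). wt l) * (\<Prod>l\<in>snd (snd q). wt l))"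
      by (simp add: q' prod.union_disjoint)
  next
    fix T assume T: "T \<in> block_tilings L (R1 \<union> R2)"
    note D = block_tilingsD[OF T]
    have cov: "l \<in> K \<or> l \<subseteq> R1 \<or> l \<subseteq> R2" if "l \<in> T" for l
      using D(2,3)[OF that] K[of l] by blast
    have kx: "\<not> l \<subseteq> R1" "\<not> l \<subseteq> R2" if "l \<in> K" for l using that K[of l] disj12 by blast+
    show "fst (T \<inter> K, {l\<in>T. l \<subseteq> R1}, {l\<in>T. l \<subseteq> R2}) \<union> (fst (snd (T \<inter> K, {l\<in>T. l \<subseteq> R1}, {l\<in>T. l \<subseteq> R2})) \<union> snd (snd (T \<inter> K, {l\<in>T. l \<subseteq> R1}, {l\<in>T. l \<subseteq> R2}))) = T"
      using cov by auto
    have res: "{l\<in>T. l \<subseteq> S} \<in> block_tilings L (S - \<Union>(T \<inter> K))"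
      if S: "S = R1 \<or> S = R2" for S
    proof (rule block_tilingsI)
      show "\<Union>{l\<in>T. l \<subseteq> S} = S - \<Union>(T \<inter> K)"
      proof (intro equalityI subsetI)
        fix t assume "t \<in> \<Union>{l\<in>T. l \<subseteq> S}"
        then obtain l where l: "l \<in> T" "l \<subseteq> S" "t \<in> l" by blast
        have "t \<notin> l'" if "l' \<in> T \<inter> K" for l'
          using D(5)[OF l(1), of l'] that l kx[of l'] S by blast
        thus "t \<in> S - \<Union>(T \<inter> K)" using l by blast
      next
        fix t assume t: "t \<in> S - \<Union>(T \<inter> K)"
        then obtain l where l: "l \<in> T" "t \<in> l" using D(6) S by blast
        hence "l \<subseteq> R1 \<or> l \<subseteq> R2" using cov[OF l(1)] t by blast
        hence "l \<subseteq> S" using l(2) t S disj12 by blast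
        thus "t \<in> \<Union>{l\<in>T. l \<subseteq> S}" using l by blast
      qed
    qed (use D in auto)
    show "(T \<inter> K, {l\<in>T. l \<subseteq> R1}, {l\<in>T. l \<subseteq> R2}) \<in> Sigma (Pow K) ?B"
      using res by auto
  qed
  finally show ?thesis by simp
qed

section \<open>Unit triangles as a brick wall\<close>

text \<open>
  \<open>(k, c)\<close> stands for the unit triangle between the heights \<open>k\<close> and \<open>k + 1\<close> whose vertical axis is at
  the doubled abscissa \<open>c\<close>; it points up iff \<open>c - k\<close> is odd.
\<close>

definition brick :: "point set \<Rightarrow> bool" where
  "brick l \<longleftrightarrow> (\<exists>k c. l = {(k, c), (k, c + 1)} \<or> odd (c - k) \<and> l = {(k, c), (k - 1, c)})"

text \<open>The zigzag touches abscissa 0 at the even heights only, so the weighted lozenges are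
  those in column 1 across an even height. The finite extent of a zigzag enters through the rows of
  the region, in \<open>zigzag_weight_node\<close>.\<close>

definition brick_weight :: "point set \<Rightarrow> real" where
  "brick_weight l = (if \<exists>k. even k \<and> l = {(k, 1), (k - 1, 1)} then 1 / 2 else 1)"

definition brick_sum :: "point set \<Rightarrow> real" where
  "brick_sum R = block_sum brick brick_weight R"

definition node :: "point \<Rightarrow> triangle" where
  "node p = (if odd (snd p - fst p) then up_tri (snd p - 1) (fst p) else down_tri (snd p - 1) (fst p + 1))"

lemma up_tri_eq_iff: "up_tri w k = up_tri w' k' \<longleftrightarrow> w = w' \<and> k = k'"
proof
  assume eq: "up_tri w k = up_tri w' k'"
  have "(w, k) \<in> up_tri w' k'" "(w + 2, k) \<in> up_tri w' k'"
    unfolding eq[symmetric] by (auto simp: up_tri_def)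
  thus "w = w' \<and> k = k'" by (auto simp: up_tri_def)
qed simp

lemma down_tri_eq_iff: "down_tri w k = down_tri w' k' \<longleftrightarrow> w = w' \<and> k = k'"
proof
  assume eq: "down_tri w k = down_tri w' k'"
  have "(w, k) \<in> down_tri w' k'" "(w + 2, k) \<in> down_tri w' k'"
    unfolding eq[symmetric] by (auto simp: down_tri_def)
  thus "w = w' \<and> k = k'" by (auto simp: down_tri_def)
qed simp

lemma up_tri_neq_down_tri: "up_tri w k \<noteq> down_tri w' k'"
proof
  assume eq: "up_tri w k = down_tri w' k'"
  have "(w, k) \<in> down_tri w' k'" "(w + 2, k) \<in> down_tri w' k'" "(w + 1, k + 1) \<in> down_tri w' k'"
    unfolding eq[symmetric] by (auto simp: up_tri_def)
  thus False by (auto simp: down_tri_def)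
qed

lemma inj_node: "inj node"
  by (rule injI, rule prod_eqI)
     (auto simp: node_def up_tri_eq_iff down_tri_eq_iff up_tri_neq_down_tri up_tri_neq_down_tri[symmetric] split: if_splits)

lemma range_node: "range node = unit_triangles"
proof (intro equalityI subsetI)
  fix t assume "t \<in> range node"
  then obtain p where t: "t = node p" by blast
  obtain k c where p: "p = (k, c)" by (cases p)
  show "t \<in> unit_triangles"
  proof (cases "odd (c - k)")
    case True
    hence "t = up_tri (c - 1) k" "even (c - 1 - k)" by (auto simp: t p node_def)
    thus ?thesis unfolding unit_triangles_def by blast
  next
    case False
    hence "t = down_tri (c - 1) (k + 1)" "even (c - 1 - (k + 1))" by (auto simp: t p node_def)
    thus ?thesis unfolding unit_triangles_def by blast
  qed
next
  fix t assume "t \<in> unit_triangles"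
  then consider w k where "t = up_tri w k" "even (w - k)" | w k where "t = down_tri w k" "even (w - k)"
    unfolding unit_triangles_def by blast
  thus "t \<in> range node"
  proof cases
    case 1
    hence "t = node (k, w + 1)" by (auto simp: node_def)
    thus ?thesis by blast
  next
    case 2
    hence "t = node (k - 1, w + 1)" by (auto simp: node_def)
    thus ?thesis by blast
  qed
qed

lemma mem_node:
  "(w, j) \<in> node (k, c) \<longleftrightarrow>
    (if odd (c - k) then j = k \<and> (w = c - 1 \<or> w = c + 1) \<or> j = k + 1 \<and> w = c
     else j = k + 1 \<and> (w = c - 1 \<or> w = c + 1) \<or> j = k \<and> w = c)"
  by (auto simp: node_def up_tri_def down_tri_def)

text \<open>An edge is encoded by the sum of its endpoints, that is, by twice its midpoint; the
  midpoints of the three sides are linear in the coordinates of the cell. Two cells with a common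
  edge give two linear descriptions of one point, and adjacency becomes integer arithmetic.\<close>

lemma node_edge_midpoint:
  assumes "(u1, u2) \<in> node (k, c)" "(v1, v2) \<in> node (k, c)" "(u1, u2) \<noteq> (v1, v2)"
  shows "(u1 + v1 = 2 * c + 1 \<or> u1 + v1 = 2 * c - 1) \<and> u2 + v2 = 2 * k + 1 \<or>
    u1 + v1 = 2 * c \<and> u2 + v2 = (if odd (c - k) then 2 * k else 2 * k + 2)"
proof -
  define P where "P = odd (c - k)"
  show ?thesis using assms unfolding mem_node P_def[symmetric] 
 by (cases P) auto
qed

lemma node_common_edge:
  assumes "(u1,u2) \<noteq> (v1,v2)" "(u1,u2) \<in> node (k,c)" "(v1,v2) \<in> node (k,c)" "(u1,u2) \<in> node (k',c')" "(v1,v2) \<in> node (k',c')" "(k,c) \<noteq> (k',c')"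
 shows "k' = k \<and> c' = c + 1 \<or> k' = k \<and> c = c' + 1 \<or> odd (c - k) \<and> c' = c \<and> k' = k - 1
    \<or> odd (c' - k') \<and> c' = c \<and> k = k' - 1"
proof -
  define s t where "s = u1 + v1" and "t = u2 + v2"
  define P Q where "P = odd (c - k)" and "Q = odd (c' - k')"
  have 1: "(s = 2 * c + 1 \<or> s = 2 * c - 1) \<and> t = 2 * k + 1 \<or>
    s = 2 * c \<and> t = (if P then 2 * k else 2 * k + 2)"
    unfolding s_def t_def P_def by (rule node_edge_midpoint[OF assms(2,3,1)])
  have 2: "(s = 2 * c' + 1 \<or> s = 2 * c' - 1) \<and> t = 2 * k' + 1 \<or>
    s = 2 * c' \<and> t = (if Q then 2 * k' else 2 * k' + 2)"
    unfolding s_def t_def Q_def by (rule node_edge_midpoint[OF assms(4,5,1)])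
  have 3: "k \<noteq> k' \<or> c \<noteq> c'" using assms(6) by simp
  have 1: "(s = 2 * c + 1 \<and> t = 2 * k + 1) \<or> (s = 2 * c - 1 \<and> t = 2 * k + 1) \<or> (P \<and> s = 2 * c \<and> t = 2 * k) \<or> (\<not> P \<and> s = 2 * c \<and> t = 2 * k + 2)"
    using 1 by (cases P) auto
  have 2: "(s = 2 * c' + 1 \<and> t = 2 * k' + 1) \<or> (s = 2 * c' - 1 \<and> t = 2 * k' + 1) \<or> (Q \<and> s = 2 * c' \<and> t = 2 * k') \<or> (\<not> Q \<and> s = 2 * c' \<and> t = 2 * k' + 2)"
    using 2 by (cases Q) auto
  have "(k' = k \<and> c' = c + 1) \<or> (k' = k \<and> c = c' + 1) \<or> (P \<and> c' = c \<and> k' = k - 1) \<or> (Q \<and> c' = c \<and> k = k' - 1)"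
    using 1 2 3
    by (elim disjE conjE) ((simp; fail) | (rule FalseE, presburger) | (auto; fail))+
  thus ?thesis unfolding P_def Q_def .
qed
lemma adjacent_imp_brick:
  assumes "p \<noteq> q" "card (node p \<inter> node q) = 2"
  shows "brick {p, q}"
proof -
  obtain k c k' c' where p: "p = (k, c)" and q: "q = (k', c')" by (cases p, cases q)
  obtain u v where I: "node p \<inter> node q = {u, v}" and uv1: "u \<noteq> v"
    using assms(2) unfolding card_2_iff by blast
  have uv: "u \<noteq> v" "u \<in> node p" "u \<in> node q" "v \<in> node p" "v \<in> node q"
    using I uv1 by blast+
  have "k' = k \<and> c' = c + 1 \<or> k' = k \<and> c = c' + 1 \<or> odd (c - k) \<and> c' = c \<and> k' = k - 1
    \<or> odd (c' - k') \<and> c' = c \<and> k = k' - 1"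
  proof -
    obtain u1 u2 v1 v2 where u: "u = (u1, u2)" and v: "v = (v1, v2)" by (cases u, cases v)
    show ?thesis
      using node_common_edge[of u1 u2 v1 v2 k c k' c'] uv assms(1) unfolding p q u v by (simp only: simp_thms)
  qed
  thus ?thesis
  proof (elim disjE conjE)
    assume "k' = k" "c' = c + 1"
    thus ?thesis unfolding brick_def p q by blast
  next
    assume "k' = k" "c = c' + 1"
    hence "{p, q} = {(k, c'), (k, c' + 1)}" by (auto simp: p q)
    thus ?thesis unfolding brick_def by blast
  next
    assume "odd (c - k)" "c' = c" "k' = k - 1"
    thus ?thesis unfolding brick_def p q by blast
  next
    assume "odd (c' - k')" "c' = c" "k = k' - 1"
    hence "odd (c - k')" "{p, q} = {(k', c), (k' - 1, c)}" by (auto simp: p q)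
    thus ?thesis unfolding brick_def by blast
  qed
qed

lemma brick_imp_adjacent:
  assumes "brick {p, q}"
  shows "p \<noteq> q \<and> card (node p \<inter> node q) = 2"
proof -
  have 1: "card (node (k, c) \<inter> node (k, c + 1)) = 2" for k c
  proof (cases "odd (c - k)")
    case True
    hence "node (k, c) \<inter> node (k, c + 1) = {(c + 1, k), (c, k + 1)}"
      by (auto simp: node_def up_tri_def down_tri_def)
    thus ?thesis by simp
  next
    case False
    hence "node (k, c) \<inter> node (k, c + 1) = {(c, k), (c + 1, k + 1)}"
      by (auto simp: node_def up_tri_def down_tri_def)
    thus ?thesis by simp
  qed
  have 2: "card (node (k, c) \<inter> node (k - 1, c)) = 2" if "odd (c - k)" for k c
  proof -
    have "node (k, c) \<inter> node (k - 1, c) = {(c - 1, k), (c + 1, k)}"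
      using that by (auto simp: node_def up_tri_def down_tri_def)
    thus ?thesis by simp
  qed
  from assms show ?thesis unfolding brick_def
    using 1 2 by (auto simp: doubleton_eq_iff Int_commute)
qed

lemma is_lozenge_node: "is_lozenge (node ` l) \<longleftrightarrow> brick l"
proof
  assume "is_lozenge (node ` l)"
  then obtain s t where st: "s \<in> range node" "t \<in> range node" "s \<noteq> t" "card (s \<inter> t) = 2" "node ` l = {s, t}"
    unfolding is_lozenge_def range_node[symmetric] by (elim bexE conjE) (rule that)
  then obtain p q where "s = node p" "t = node q" by (elim rangeE) (rule that)
  with st have pq: "node p \<noteq> node q" "card (node p \<inter> node q) = 2" "node ` l = {node p, node q}" by simp_all
  hence "node ` l = node ` {p, q}" by simp
  hence l: "l = {p, q}" by (simp only: inj_image_eq_iff[OF inj_node])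
  have "p \<noteq> q" using pq(1) by auto
  thus "brick l" using adjacent_imp_brick[OF _ pq(2)] l by simp
next
  assume l: "brick l"
  then obtain p q where pq: "l = {p, q}" unfolding brick_def by blast
  with l have n: "p \<noteq> q" "card (node p \<inter> node q) = 2" using brick_imp_adjacent[of p q] by simp_all
  have "node p \<noteq> node q" using n(1) by (simp add: inj_eq[OF inj_node])
  moreover have "node p \<in> unit_triangles" "node q \<in> unit_triangles" by (simp_all add: range_node[symmetric])
  ultimately show "is_lozenge (node ` l)"
    unfolding is_lozenge_def pq using n(2) by (intro bexI[of _ "node p"] bexI[of _ "node q"]) simp_all
qed

section \<open>The zigzag boundary and its weight\<close>

definition zigzag_edge :: "int \<Rightarrow> point set" where
  "zigzag_edge k = {(k mod 2, k), ((k + 1) mod 2, k + 1)}"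

lemma zigzag_eq: "zigzag p q = zigzag_edge ` {p..<q}"
  by (auto simp: zigzag_def zigzag_edge_def)

lemma zigzag_edge_up: "{(w, k), (w + 1, k + 1)} = zigzag_edge j \<longleftrightarrow> even k \<and> w = 0 \<and> j = k"
proof -
  have "k mod 2 = w \<and> (k + 1) mod 2 = w + 1 \<longleftrightarrow> even k \<and> w = 0" by presburger
  thus ?thesis by (auto simp: zigzag_edge_def doubleton_eq_iff)
qed

lemma zigzag_edge_down: "{(w, k), (w + 1, k - 1)} = zigzag_edge j \<longleftrightarrow> even k \<and> w = 0 \<and> j = k - 1"
proof -
  have "(k - 1) mod 2 = w + 1 \<and> k mod 2 = w \<longleftrightarrow> even k \<and> w = 0" by presburger
  thus ?thesis by (auto simp: zigzag_edge_def doubleton_eq_iff)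
qed

text \<open>If the western sides of a vertical lozenge across height \<open>k\<close> lie on the
  zigzag, they are its edges in the rows \<open>k\<close> and \<open>k - 1\<close>, which are the
  rows of the two cells themselves. Hence \<open>Z\<close> can be any piece of the infinite zigzag
  that covers the rows of the region.\<close>

lemma zigzag_weight_node:
  assumes Z: "Z \<subseteq> range zigzag_edge" "\<And>p. p \<in> l \<Longrightarrow> zigzag_edge (fst p) \<in> Z"
  shows "zigzag_weight Z (node ` l) = brick_weight l"
proof -
  have "(\<exists>w k. node ` l = {up_tri w k, down_tri w k} \<and> {(w, k), (w + 1, k + 1)} \<in> Z \<and> {(w, k), (w + 1, k - 1)} \<in> Z)
     \<longleftrightarrow> (\<exists>k. even k \<and> l = {(k, 1), (k - 1, 1)})" (is "?L \<longleftrightarrow> ?R")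
  proof
    assume ?L
    then obtain w k where wk: "node ` l = {up_tri w k, down_tri w k}" "{(w, k), (w + 1, k + 1)} \<in> Z" by blast
    have "{(w, k), (w + 1, k + 1)} \<in> range zigzag_edge" using Z(1) wk(2) by (rule subsetD)
    then obtain j where "{(w, k), (w + 1, k + 1)} = zigzag_edge j" by (elim rangeE)
    hence k: "even k" "w = 0" by (simp_all only: zigzag_edge_up)
    hence "node (k, 1) = up_tri 0 k" "node (k - 1, 1) = down_tri 0 k" by (simp_all add: node_def)
    hence "node ` l = node ` {(k, 1), (k - 1, 1)}" using wk(1) k(2) by (simp only: image_insert image_empty)
    hence "l = {(k, 1), (k - 1, 1)}" by (simp only: inj_image_eq_iff[OF inj_node])
    thus ?R using k by blast
  next
    assume ?R
    then obtain k where k: "even k" "l = {(k, 1), (k - 1, 1)}" by blast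
    have "node ` l = {up_tri 0 k, down_tri 0 k}" using k by (simp add: node_def insert_commute)
    moreover have "{(0, k), (0 + 1, k + 1)} = zigzag_edge k" using k(1) by (simp only: zigzag_edge_up)
    moreover have "{(0, k), (0 + 1, k - 1)} = zigzag_edge (k - 1)" using k(1) by (simp only: zigzag_edge_down)
    moreover have "zigzag_edge k \<in> Z" "zigzag_edge (k - 1) \<in> Z"
      using Z(2)[of "(k, 1)"] Z(2)[of "(k - 1, 1)"] by (simp_all add: k(2))
    ultimately show ?L by metis
  qed
  thus ?thesis by (simp add: zigzag_weight_def brick_weight_def)
qed

lemma tiling_sum_node:
  assumes "Z \<subseteq> range zigzag_edge" "\<And>p. p \<in> R \<Longrightarrow> zigzag_edge (fst p) \<in> Z"
  shows "tiling_sum (zigzag_weight Z) (node ` R) = brick_sum R"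
proof -
  have "inj_on node R" using inj_node inj_on_subset by blast
  hence "tiling_sum (zigzag_weight Z) (node ` R) =
      block_sum (\<lambda>l. is_lozenge (node ` l)) (\<lambda>l. zigzag_weight Z (node ` l)) R"
    by (simp add: tiling_sum_eq_block_sum block_sum_image)
  also have "\<dots> = brick_sum R" unfolding brick_sum_def
  proof (rule block_sum_cong)
    fix l assume "l \<subseteq> R"
    thus "zigzag_weight Z (node ` l) = brick_weight l"
      using assms by (intro zigzag_weight_node) auto
  qed (simp add: is_lozenge_node)
  finally show ?thesis .
qed

section \<open>Symmetries of the brick wall and cuts along horizontal lines\<close>

lemma brick_sum_image:
  assumes "inj f" "\<And>l. brick (f ` l) = brick l" "\<And>l. brick_weight (f ` l) = brick_weight l"
  shows "brick_sum (f ` R) = brick_sum R"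
proof -
  have "inj_on f R" using assms(1) inj_on_subset by blast
  thus ?thesis unfolding brick_sum_def by (simp add: block_sum_image assms)
qed

lemma doubleton_image_eq:
  assumes "inj f" "f p' = p" "f q' = q"
  shows "f ` l = {p, q} \<longleftrightarrow> l = {p', q'}"
proof -
  have "{p, q} = f ` {p', q'}" using assms by simp
  thus ?thesis using inj_image_eq_iff[OF assms(1)] by metis
qed

text \<open>Row \<open>k\<close> lies between the heights \<open>k\<close> and \<open>k + 1\<close>,
  so the mirror image in the line of height 0 is row \<open>- 1 - k\<close>.\<close>

definition reflect :: "point \<Rightarrow> point" where "reflect p = (- 1 - fst p, snd p)"

lemma reflect_reflect [simp]: "reflect (reflect p) = p"
  by (simp add: reflect_def)

lemma inj_reflect: "inj reflect"
  by (metis injI reflect_reflect)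

lemma brick_sum_reflect: "brick_sum (reflect ` R) = brick_sum R"
proof (rule brick_sum_image[OF inj_reflect])
  fix l
  note D = doubleton_image_eq[OF inj_reflect reflect_reflect reflect_reflect]
  have V: "reflect ` l = {(k, c), (k - 1, c)} \<longleftrightarrow> l = {(- k, c), (- k - 1, c)}" for k c
    unfolding D by (auto simp: reflect_def)
  have H: "reflect ` l = {(k, c), (k, c + 1)} \<longleftrightarrow> l = {(- 1 - k, c), (- 1 - k, c + 1)}" for k c
    unfolding D by (auto simp: reflect_def)
  show "brick (reflect ` l) = brick l"
  proof
    assume "brick (reflect ` l)"
    then obtain k c where "l = {(- 1 - k, c), (- 1 - k, c + 1)} \<or> odd (c - k) \<and> l = {(- k, c), (- k - 1, c)}"
      unfolding brick_def V H by blast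
    moreover have "odd (c - k) \<longleftrightarrow> odd (c - (- k))" by simp
    ultimately show "brick l" unfolding brick_def by metis
  next
    assume "brick l"
    then obtain k c where "l = {(k, c), (k, c + 1)} \<or> odd (c - k) \<and> l = {(k, c), (k - 1, c)}"
      unfolding brick_def by blast
    hence "l = {(- 1 - (- 1 - k), c), (- 1 - (- 1 - k), c + 1)} \<or> odd (c - (- k)) \<and> l = {(- (- k), c), (- (- k) - 1, c)}"
      by simp
    thus "brick (reflect ` l)" unfolding brick_def V H by metis
  qed
  have "(\<exists>k. even k \<and> l = {(- k, 1), (- k - 1, 1)}) \<longleftrightarrow> (\<exists>k. even k \<and> l = {(k, 1), (k - 1, 1)})"
    by (metis even_minus minus_minus)
  thus "brick_weight (reflect ` l) = brick_weight l" unfolding brick_weight_def V by simp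
qed

text \<open>The shift is by two rows because both the orientation of a cell and the weighted heights
  depend on the parity of the row.\<close>

definition lift2 :: "point \<Rightarrow> point" where "lift2 p = (fst p + 2, snd p)"

lemma inj_lift2: "inj lift2"
  by (rule injI) (simp add: lift2_def prod_eq_iff)

lemma brick_sum_lift2: "brick_sum (lift2 ` R) = brick_sum R"
proof (rule brick_sum_image[OF inj_lift2])
  fix l
  have V: "lift2 ` l = {(k, c), (k - 1, c)} \<longleftrightarrow> l = {(k - 2, c), (k - 2 - 1, c)}" for k c
    by (rule doubleton_image_eq[OF inj_lift2]) (auto simp: lift2_def)
  have H: "lift2 ` l = {(k, c), (k, c + 1)} \<longleftrightarrow> l = {(k - 2, c), (k - 2, c + 1)}" for k c
    by (rule doubleton_image_eq[OF inj_lift2]) (auto simp: lift2_def)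
  show "brick (lift2 ` l) = brick l"
  proof
    assume "brick (lift2 ` l)"
    then obtain k c where "l = {(k - 2, c), (k - 2, c + 1)} \<or> odd (c - k) \<and> l = {(k - 2, c), (k - 2 - 1, c)}"
      unfolding brick_def V H by blast
    moreover have "odd (c - k) \<longleftrightarrow> odd (c - (k - 2))" by simp
    ultimately show "brick l" unfolding brick_def by metis
  next
    assume "brick l"
    then obtain k c where "l = {(k, c), (k, c + 1)} \<or> odd (c - k) \<and> l = {(k, c), (k - 1, c)}"
      unfolding brick_def by blast
    hence "l = {(k + 2 - 2, c), (k + 2 - 2, c + 1)} \<or> odd (c - (k + 2)) \<and> l = {(k + 2 - 2, c), (k + 2 - 2 - 1, c)}"
      by simp
    thus "brick (lift2 ` l)" unfolding brick_def V H by metis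
  qed
  have "(\<exists>k. even k \<and> l = {(k - 2, 1), (k - 2 - 1, 1)}) \<longleftrightarrow> (\<exists>k. even k \<and> l = {(k, 1), (k - 1, 1)})"
    by (metis add_diff_cancel_right' even_add even_numeral diff_add_cancel)
  thus "brick_weight (lift2 ` l) = brick_weight l" unfolding brick_weight_def V by simp
qed

text \<open>Only vertical bricks cross a horizontal line, at most one in each column. Those across
  height \<open>k\<close> are recorded by their columns \<open>X\<close>, and each side of the cut
  then has one cell missing in every such column.\<close>

lemma brick_sum_split_line:
  fixes k :: int
  assumes fin: "finite R"
  defines "J \<equiv> {c. odd (c - k) \<and> (k, c) \<in> R \<and> (k - 1, c) \<in> R}"
  shows "brick_sum R = (\<Sum>X\<in>Pow J. (\<Prod>c\<in>X. if even k \<and> c = 1 then 1 / 2 else 1) *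
    (brick_sum ({p\<in>R. fst p < k} - {k - 1} \<times> X) * brick_sum ({p\<in>R. k \<le> fst p} - {k} \<times> X)))"
proof -
  let ?R1 = "{p\<in>R. fst p < k}" and ?R2 = "{p\<in>R. k \<le> fst p}"
  let ?f = "\<lambda>c. {(k, c), (k - 1, c)}"
  let ?K = "?f ` J"
  have R: "R = ?R1 \<union> ?R2" by auto
  have injf: "inj_on ?f A" for A by (auto simp: inj_on_def doubleton_eq_iff)
  have K: "l \<in> ?K \<longleftrightarrow> brick l \<and> l \<subseteq> ?R1 \<union> ?R2 \<and> l \<inter> ?R1 \<noteq> {} \<and> l \<inter> ?R2 \<noteq> {}" for l
  proof
    assume "l \<in> ?K"
    then obtain c where "l = ?f c" "c \<in> J" by blast
    thus "brick l \<and> l \<subseteq> ?R1 \<union> ?R2 \<and> l \<inter> ?R1 \<noteq> {} \<and> l \<inter> ?R2 \<noteq> {}"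
      unfolding brick_def J_def by auto
  next
    assume a: "brick l \<and> l \<subseteq> ?R1 \<union> ?R2 \<and> l \<inter> ?R1 \<noteq> {} \<and> l \<inter> ?R2 \<noteq> {}"
    then have b: "brick l" and s: "l \<subseteq> ?R1 \<union> ?R2" and n1: "l \<inter> ?R1 \<noteq> {}" and n2: "l \<inter> ?R2 \<noteq> {}"
      by simp_all
    from b obtain j c where "l = {(j, c), (j, c + 1)} \<or> odd (c - j) \<and> l = {(j, c), (j - 1, c)}"
      unfolding brick_def by (elim exE) (rule that)
    thus "l \<in> ?K"
    proof (elim disjE conjE)
      assume l: "l = {(j, c), (j, c + 1)}"
      from n1 n2 show ?thesis unfolding l by auto
    next
      assume l: "odd (c - j)" "l = {(j, c), (j - 1, c)}"
      from n1 n2 have "j = k" unfolding l(2) by auto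
      hence "l = ?f c" "c \<in> J" using s l by (auto simp: J_def)
      thus ?thesis by blast
    qed
  qed
  have disjK: "disjoint ?K" by (auto simp: disjoint_def)
  have wt: "brick_weight (?f c) = (if even k \<and> c = 1 then 1 / 2 else 1)" for c
  proof -
    have "(\<exists>k'. even k' \<and> ?f c = {(k', 1), (k' - 1, 1)}) \<longleftrightarrow> even k \<and> c = 1"
      by (auto simp: doubleton_eq_iff)
    thus ?thesis unfolding brick_weight_def by presburger
  qed
  have "brick_sum R = (\<Sum>X\<in>Pow ?K. (\<Prod>l\<in>X. brick_weight l) *
      (block_sum brick brick_weight (?R1 - \<Union>X) * block_sum brick brick_weight (?R2 - \<Union>X)))"
    unfolding brick_sum_def by (subst R, rule block_sum_split[OF _ _ _ disjK K]) (use fin in auto)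
  also have "\<dots> = (\<Sum>X\<in>Pow J. (\<Prod>l\<in>?f ` X. brick_weight l) *
      (brick_sum (?R1 - \<Union>(?f ` X)) * brick_sum (?R2 - \<Union>(?f ` X))))"
  proof -
    have inj2: "inj_on ((`) ?f) (Pow J)" by (rule inj_on_image_Pow[OF injf])
    have "Pow ?K = ((`) ?f) ` Pow J" by (rule image_Pow_surj[symmetric]) simp
    thus ?thesis by (simp only: sum.reindex[OF inj2] o_def brick_sum_def)
  qed
  also have "\<dots> = (\<Sum>X\<in>Pow J. (\<Prod>c\<in>X. if even k \<and> c = 1 then 1 / 2 else 1) *
    (brick_sum (?R1 - {k - 1} \<times> X) * brick_sum (?R2 - {k} \<times> X)))"
  proof (rule sum.cong[OF refl])
    fix X
    have "(\<Prod>l\<in>?f ` X. brick_weight l) = (\<Prod>c\<in>X. if even k \<and> c = 1 then 1 / 2 else 1)"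
      by (simp only: prod.reindex[OF injf] o_def wt)
    moreover have "?R1 - \<Union>(?f ` X) = ?R1 - {k - 1} \<times> X" "?R2 - \<Union>(?f ` X) = ?R2 - {k} \<times> X" by auto
    ultimately show "(\<Prod>l\<in>?f ` X. brick_weight l) * (brick_sum (?R1 - \<Union>(?f ` X)) * brick_sum (?R2 - \<Union>(?f ` X)))
      = (\<Prod>c\<in>X. if even k \<and> c = 1 then 1 / 2 else 1) * (brick_sum (?R1 - {k - 1} \<times> X) * brick_sum (?R2 - {k} \<times> X))"
      by simp
  qed
  finally show ?thesis .
qed

lemma brick_in_strip:
  assumes "brick l" "l \<subseteq> {k} \<times> I"
  obtains c where "l = {(k, c), (k, c + 1)}" "c \<in> I" "c + 1 \<in> I"
proof -
  from assms(1) obtain j c where "l = {(j, c), (j, c + 1)} \<or> odd (c - j) \<and> l = {(j, c), (j - 1, c)}"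
    unfolding brick_def by (elim exE) (rule that)
  with assms(2) show ?thesis by (auto intro: that)
qed

text \<open>Inside one row only horizontal bricks of weight 1 fit, so there is at most one tiling,
  and it exists iff all maximal runs of cells have even length. Equivalently, every missing column
  has an even number of cells to its left; the extra column \<open>M + 1\<close> accounts for the
  last run.\<close>

lemma brick_sum_strip:
  fixes I :: "int set" and M :: int
  assumes "I \<subseteq> {1..M}"
  shows "brick_sum ({k} \<times> I) = of_bool (\<forall>c\<in>{1..M + 1} - I. even (card (I \<inter> {..<c})))"
  using assms
proof (induction "card I" arbitrary: I rule: less_induct)
  case less
  have finI: "finite I" using less.prems finite_subset by blast
  show ?case
  proof (cases "I = {}")
    case True
    thus ?thesis by (simp add: brick_sum_def)
  next
    case False
    define m where "m = Min I"
    have m: "m \<in> I" "\<And>c. c \<in> I \<Longrightarrow> m \<le> c" using finI False by (auto simp: m_def)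
    have mM: "1 \<le> m" "m \<le> M" using m(1) less.prems by auto
    show ?thesis
    proof (cases "m + 1 \<in> I")
      case False
      have "brick_sum ({k} \<times> I) = 0" unfolding brick_sum_def
      proof (rule block_sum_zero[of "(k, m)"])
        show "(k, m) \<in> {k} \<times> I" using m(1) by simp
        fix l assume "brick l" "l \<subseteq> {k} \<times> I" and kl: "(k, m) \<in> l"
        then obtain c where c: "l = {(k, c), (k, c + 1)}" "c \<in> I" "c + 1 \<in> I" by (elim brick_in_strip)
        with kl m(2)[of c] False show False by auto
      qed
      moreover have "I \<inter> {..<m + 1} = {m}" using m by force
      hence "\<not> even (card (I \<inter> {..<m + 1}))" by simp
      hence "\<not> (\<forall>c\<in>{1..M + 1} - I. even (card (I \<inter> {..<c})))" using False mM
        by (intro notI) (drule bspec[of _ _ "m + 1"]; simp)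
      ultimately show ?thesis by simp
    next
      case True
      let ?l = "{(k, m), (k, m + 1)}" and ?I = "I - {m, m + 1}"
      have "brick_sum ({k} \<times> I) = (\<Prod>l\<in>{?l}. brick_weight l) * brick_sum ({k} \<times> I - \<Union>{?l})"
        unfolding brick_sum_def
      proof (rule block_sum_forced)
        show "finite ({k} \<times> I)" using finI by simp
        show "disjoint {?l}" by (simp add: disjoint_def)
        fix l assume l: "l \<in> {?l}"
        show "brick l" using l unfolding brick_def by blast
        show "l \<subseteq> {k} \<times> I" using l m(1) True by auto
        show "\<exists>t\<in>l. \<forall>l'. brick l' \<longrightarrow> l' \<subseteq> {k} \<times> I \<longrightarrow> t \<in> l' \<longrightarrow> l' = l"
        proof (intro bexI[of _ "(k, m)"] allI impI)
          show "(k, m) \<in> l" using l by simp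
          fix l' assume "brick l'" "l' \<subseteq> {k} \<times> I" and kl: "(k, m) \<in> l'"
          then obtain c where c: "l' = {(k, c), (k, c + 1)}" "c \<in> I" "c + 1 \<in> I" by (elim brick_in_strip)
          with kl m(2)[of c] have "c = m" by auto
          thus "l' = l" using l c(1) by simp
        qed
      qed
      moreover have "brick_weight ?l = 1" by (auto simp: brick_weight_def doubleton_eq_iff)
      moreover have "{k} \<times> I - \<Union>{?l} = {k} \<times> ?I" by auto
      ultimately have "brick_sum ({k} \<times> I) = brick_sum ({k} \<times> ?I)" by simp
      also have "\<dots> = of_bool (\<forall>c\<in>{1..M + 1} - ?I. even (card (?I \<inter> {..<c})))"
      proof (rule less.hyps)
        show "card ?I < card I" by (rule psubset_card_mono[OF finI]) (use m(1) in blast)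
        show "?I \<subseteq> {1..M}" using less.prems by blast
      qed
      also have "(\<forall>c\<in>{1..M + 1} - ?I. even (card (?I \<inter> {..<c})))
          \<longleftrightarrow> (\<forall>c\<in>{1..M + 1} - I. even (card (I \<inter> {..<c})))"
      proof -
        have low: "?I \<inter> {..<c} = {}" if "c \<le> m + 2" for c
        proof -
          have False if "u \<in> ?I" "u < c" for u using m(2)[of u] that \<open>c \<le> m + 2\<close> by auto
          thus ?thesis by blast
        qed
        have high: "card (I \<inter> {..<c}) = card (?I \<inter> {..<c}) + 2" if "c > m + 1" for c
        proof -
          have "I \<inter> {..<c} = insert m (insert (m + 1) (?I \<inter> {..<c}))" using that m(1) True by auto
          thus ?thesis using finI by simp
        qed
        have eq: "even (card (I \<inter> {..<c})) = even (card (?I \<inter> {..<c}))" if "c \<noteq> m + 1" for c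
        proof (cases "c > m + 1")
          case False
          hence "c \<le> m" using that by simp
          hence "I \<inter> {..<c} = {}" using m(2) by force
          thus ?thesis using low[of c] \<open>c \<le> m\<close> by simp
        qed (simp add: high)
        show ?thesis
        proof (intro iffI ballI)
          fix c assume a: "\<forall>c\<in>{1..M + 1} - ?I. even (card (?I \<inter> {..<c}))" "c \<in> {1..M + 1} - I"
          hence "c \<noteq> m + 1" using True by auto
          thus "even (card (I \<inter> {..<c}))" using a by (subst eq) auto
        next
          fix c assume a: "\<forall>c\<in>{1..M + 1} - I. even (card (I \<inter> {..<c}))" "c \<in> {1..M + 1} - ?I"
          show "even (card (?I \<inter> {..<c}))"
          proof (cases "c = m \<or> c = m + 1")
            case True
            hence "?I \<inter> {..<c} = {}" by (intro low) auto
            thus ?thesis by simp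
          next
            case False
            hence "c \<in> {1..M + 1} - I" using a(2) by auto
            with a(1) have "even (card (I \<inter> {..<c}))" by (rule bspec)
            thus ?thesis using eq[of c] False by simp
          qed
        qed
      qed
      finally show ?thesis .
    qed
  qed
qed

section \<open>One strip: interlacing sets\<close>

definition enum_set :: "nat set \<Rightarrow> nat \<Rightarrow> nat" where
  "enum_set S i = sorted_list_of_set S ! i"

lemma enum_set_less: "i < j \<Longrightarrow> j < card S \<Longrightarrow> enum_set S i < enum_set S j"
  using sorted_wrt_nth_less[OF strict_sorted_list_of_set[of S]] by (simp add: enum_set_def)

lemma enum_set_le: "i \<le> j \<Longrightarrow> j < card S \<Longrightarrow> enum_set S i \<le> enum_set S j"
  using enum_set_less[of i j S] by (cases "i = j") auto

lemma enum_set_image: "finite S \<Longrightarrow> enum_set S ` {..<card S} = S"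
proof -
  assume "finite S"
  hence "S = set (sorted_list_of_set S)" by simp
  also have "\<dots> = (!) (sorted_list_of_set S) ` {..<card S}"
    by (simp add: set_conv_nth image_def set_eq_iff) blast
  finally show ?thesis by (simp add: enum_set_def[abs_def])
qed

lemma enum_set_mem: "finite S \<Longrightarrow> i < card S \<Longrightarrow> enum_set S i \<in> S"
  using enum_set_image by blast

lemma enum_set_cases:
  assumes "finite S" "u \<in> S"
  obtains i where "i < card S" "u = enum_set S i"
proof -
  have "u \<in> enum_set S ` {..<card S}" using assms by (simp add: enum_set_image)
  thus ?thesis by (elim imageE) (rule that, auto)
qed

lemma inj_on_enum_set: "inj_on (enum_set S) {..<card S}"
  by (rule linorder_inj_onI) (use enum_set_less[of _ _ S] in \<open>fastforce+\<close>)

lemma enum_set_unique: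
  assumes "\<And>i j. i < j \<Longrightarrow> j < n \<Longrightarrow> f i < f j"
  shows "card (f ` {..<n}) = n" "i < n \<Longrightarrow> enum_set (f ` {..<n}) i = f i"
proof -
  have "sorted_wrt (<) (map f [0..<n])"
    using assms by (simp add: sorted_wrt_iff_nth_less)
  moreover have "set (map f [0..<n]) = f ` {..<n}" by auto
  moreover have "inj_on f {..<n}"
    by (rule linorder_inj_onI) (use assms in \<open>fastforce+\<close>)
  hence c: "card (f ` {..<n}) = n" by (simp add: card_image)
  ultimately have "sorted_list_of_set (f ` {..<n}) = map f [0..<n]"
    by (subst sorted_list_of_set_unique[symmetric]) auto
  thus "i < n \<Longrightarrow> enum_set (f ` {..<n}) i = f i" by (simp add: enum_set_def)
  show "card (f ` {..<n}) = n" by (rule c)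
qed

lemma card_less_enum:
  assumes "finite S" "j \<le> card S" "\<And>i. i < j \<Longrightarrow> enum_set S i < v"
    "j < card S \<Longrightarrow> v \<le> enum_set S j"
  shows "card {u\<in>S. u < v} = j"
proof -
  have "{u\<in>S. u < v} = enum_set S ` {..<j}"
  proof (intro equalityI subsetI)
    fix u assume u: "u \<in> {u\<in>S. u < v}"
    hence "u \<in> S" by simp
    then obtain i where i: "i < card S" "u = enum_set S i" by (rule enum_set_cases[OF assms(1)])
    have "i < j"
    proof (rule ccontr)
      assume "\<not> i < j"
      hence "j < card S" "enum_set S j \<le> u" using i enum_set_le[of j i S] by auto
      with assms(4) u show False by auto
    qed
    thus "u \<in> enum_set S ` {..<j}" using i by blast
  next
    fix u assume "u \<in> enum_set S ` {..<j}"
    thus "u \<in> {u\<in>S. u < v}" using assms(2,3) enum_set_mem[OF assms(1)] by auto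
  qed
  moreover have "inj_on (enum_set S) {..<j}"
    by (rule inj_on_subset[OF inj_on_enum_set]) (use assms(2) in auto)
  ultimately show ?thesis by (simp add: card_image)
qed

text \<open>The parities say that the two kinds of dents alternate along the strip, beginning with
  \<open>P\<close>. In the forward direction, suppose that the comparison with index
  \<open>j\<close> is the first to fail. Then exactly \<open>j\<close> elements of the other set
  precede the element in question, as many as of its own set, and this is the wrong parity.\<close>

lemma parity_iff_interlacing:
  assumes fin: "finite P" "finite X"
  shows "(\<forall>p\<in>P. even (card {u\<in>P. u < p} + card {u\<in>X. u < p})) \<and>
      (\<forall>x\<in>X. odd (card {u\<in>P. u < Suc x} + card {u\<in>X. u < x})) \<longleftrightarrow>
    (\<forall>j<card X. j < card P \<and> enum_set P j \<le> enum_set X j) \<and>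
      (\<forall>j. Suc j < card P \<longrightarrow> j < card X \<and> enum_set X j < enum_set P (Suc j))"
    (is "?L \<longleftrightarrow> ?A \<and> ?B")
proof
  assume L: ?L
  have LP: "even (j + card {u\<in>X. u < enum_set P j})" if "j < card P" for j
  proof -
    have "card {u\<in>P. u < enum_set P j} = j"
      by (rule card_less_enum) (use fin that enum_set_less in auto)
    thus ?thesis using L enum_set_mem[OF fin(1) that] by auto
  qed
  have LX: "odd (card {u\<in>P. u < Suc (enum_set X j)} + j)" if "j < card X" for j
  proof -
    have "card {u\<in>X. u < enum_set X j} = j"
      by (rule card_less_enum) (use fin that enum_set_less in auto)
    thus ?thesis using L enum_set_mem[OF fin(2) that] by auto
  qed
  have good: "(j < card X \<longrightarrow> j < card P \<and> enum_set P j \<le> enum_set X j) \<and>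
      (Suc j < card P \<longrightarrow> j < card X \<and> enum_set X j < enum_set P (Suc j))" for j
  proof (induction j rule: less_induct)
    case (less j)
    have 1: "j < card P \<and> enum_set P j \<le> enum_set X j" if j: "j < card X"
    proof (rule ccontr)
      assume n: "\<not> (j < card P \<and> enum_set P j \<le> enum_set X j)"
      have "card {u\<in>P. u < Suc (enum_set X j)} = j"
      proof (rule card_less_enum[OF fin(1)])
        show "j \<le> card P"
        proof (cases j)
          case (Suc i)
          thus ?thesis using less[of i] j by simp
        qed simp
        show "enum_set P i < Suc (enum_set X j)" if "i < j" for i
          using less[OF that] enum_set_less[OF that j] that j by fastforce
        show "Suc (enum_set X j) \<le> enum_set P j" if "j < card P" using n that by simp
      qed
      with LX[OF j] show False by simp
    qed
    have 2: "j < card X \<and> enum_set X j < enum_set P (Suc j)" if j: "Suc j < card P"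
    proof (rule ccontr)
      assume n: "\<not> (j < card X \<and> enum_set X j < enum_set P (Suc j))"
      have "card {u\<in>X. u < enum_set P (Suc j)} = j"
      proof (rule card_less_enum[OF fin(2)])
        show "j \<le> card X"
        proof (cases j)
          case (Suc i)
          thus ?thesis using less[of i] j by simp
        qed simp
        show "enum_set X i < enum_set P (Suc j)" if "i < j" for i
          using less[OF that] enum_set_less[of "Suc i" "Suc j" P] that j by fastforce
        show "enum_set P (Suc j) \<le> enum_set X j" if "j < card X" using n that by simp
      qed
      with LP[OF j] show False by simp
    qed
    show ?case using 1 2 by blast
  qed
  thus "?A \<and> ?B" by blast
next
  assume AB: "?A \<and> ?B"
  hence A: "\<And>j. j < card X \<Longrightarrow> j < card P" "\<And>j. j < card X \<Longrightarrow> enum_set P j \<le> enum_set X j"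
    and B: "\<And>j. Suc j < card P \<Longrightarrow> j < card X" "\<And>j. Suc j < card P \<Longrightarrow> enum_set X j < enum_set P (Suc j)"
    by blast+
  have "even (card {u\<in>P. u < p} + card {u\<in>X. u < p})" if p: "p \<in> P" for p
  proof -
    obtain j where j: "j < card P" "p = enum_set P j" by (rule enum_set_cases[OF fin(1) p])
    have "card {u\<in>P. u < p} = j"
      by (rule card_less_enum) (use fin j enum_set_less in auto)
    moreover have "card {u\<in>X. u < p} = j"
    proof (rule card_less_enum[OF fin(2)])
      show "j \<le> card X" using B(1)[of "j - 1"] j by (cases j) auto
      show "enum_set X i < p" if "i < j" for i
        using B(2)[of i] that j enum_set_le[of "Suc i" j P] by simp
    qed (use A(2) j in auto)
    ultimately show ?thesis by simp
  qed
  moreover have "odd (card {u\<in>P. u < Suc x} + card {u\<in>X. u < x})" if x: "x \<in> X" for x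
  proof -
    obtain j where j: "j < card X" "x = enum_set X j" by (rule enum_set_cases[OF fin(2) x])
    have "card {u\<in>X. u < x} = j"
      by (rule card_less_enum) (use fin j enum_set_less in auto)
    moreover have "card {u\<in>P. u < Suc x} = Suc j"
    proof (rule card_less_enum[OF fin(1)])
      show "Suc j \<le> card P" using A(1)[OF j(1)] by simp
      show "enum_set P i < Suc x" if "i < Suc j" for i
        using A(1,2)[OF j(1)] enum_set_le[of i j P] that j by simp
      show "Suc x \<le> enum_set P (Suc j)" if "Suc j < card P" using B(2)[OF that] j by simp
    qed
    ultimately show ?thesis by simp
  qed
  ultimately show ?L by blast
qed

text \<open>There are \<open>2 * p\<close> columns before column \<open>2 * p + 1\<close> and
  \<open>2 * x + 1\<close> before column \<open>2 * x + 2\<close>. That is why an element of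
  \<open>P\<close> needs an even and an element of \<open>X\<close> an odd number of dents to its
  left. The column past the end gives the parity condition on the whole row.\<close>

lemma brick_sum_dented_strip:
  fixes P X :: "nat set" and M :: nat
  assumes fin: "finite P" "finite X"
    and P: "\<And>p. p \<in> P \<Longrightarrow> 2 * p + 1 \<le> M" and X: "\<And>x. x \<in> X \<Longrightarrow> 2 * x + 2 \<le> M"
  shows "brick_sum ({k} \<times> ({1..int M} - ((\<lambda>p. 2 * int p + 1) ` P \<union> (\<lambda>x. 2 * int x + 2) ` X))) =
    of_bool (even (M + card P + card X) \<and> (\<forall>j<card X. j < card P \<and> enum_set P j \<le> enum_set X j) \<and>
      (\<forall>j. Suc j < card P \<longrightarrow> j < card X \<and> enum_set X j < enum_set P (Suc j)))"
proof -
  let ?f = "\<lambda>p. 2 * int p + 1" and ?g = "\<lambda>x. 2 * int x + 2"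
  let ?C = "?f ` P \<union> ?g ` X"
  let ?I = "{1..int M} - ?C"
  have ev: "even (card (?I \<inter> {..<c})) \<longleftrightarrow>
      even (nat (c - 1) + (card {u\<in>P. ?f u < c} + card {u\<in>X. ?g u < c}))"
    if c: "1 \<le> c" "c \<le> int M + 1" for c
  proof -
    let ?D = "?f ` {u\<in>P. ?f u < c} \<union> ?g ` {u\<in>X. ?g u < c}"
    have I: "?I \<inter> {..<c} = {1..<c} - ?D" using c by auto
    have D: "?D \<subseteq> {1..<c}" by auto
    have "card (?I \<inter> {..<c}) = card {1..<c} - card ?D"
      unfolding I by (rule card_Diff_subset[OF finite_subset[OF D] D]) simp
    moreover have "card ?D \<le> card {1..<c}" by (rule card_mono[OF _ D]) simp
    moreover have "card ?D = card {u\<in>P. ?f u < c} + card {u\<in>X. ?g u < c}"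
    proof -
      have "?f u \<noteq> ?g v" for u v by presburger
      hence "?f ` {u\<in>P. ?f u < c} \<inter> ?g ` {u\<in>X. ?g u < c} = {}" by blast
      hence "card ?D = card (?f ` {u\<in>P. ?f u < c}) + card (?g ` {u\<in>X. ?g u < c})"
        by (rule card_Un_disjoint[rotated 2]) (use fin in auto)
      thus ?thesis by (simp add: card_image inj_on_def)
    qed
    moreover have "card {1..<c} = nat (c - 1)" by simp
    ultimately show ?thesis by presburger
  qed
  have "brick_sum ({k} \<times> ?I) = of_bool (\<forall>c\<in>{1..int M + 1} - ?I. even (card (?I \<inter> {..<c})))"
    by (rule brick_sum_strip) auto
  also have "{1..int M + 1} - ?I = ?f ` P \<union> ?g ` X \<union> {int M + 1}"
  proof -
    have "1 \<le> ?f p \<and> ?f p \<le> int M + 1" if "p \<in> P" for p using P[OF that] by linarith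
    moreover have "1 \<le> ?g x \<and> ?g x \<le> int M + 1" if "x \<in> X" for x using X[OF that] by linarith
    ultimately show ?thesis by (auto; force)
  qed
  also have "(\<forall>c\<in>?f ` P \<union> ?g ` X \<union> {int M + 1}. even (card (?I \<inter> {..<c}))) \<longleftrightarrow>
     even (M + card P + card X) \<and>
      ((\<forall>p\<in>P. even (card {u\<in>P. u < p} + card {u\<in>X. u < p})) \<and>
       (\<forall>x\<in>X. odd (card {u\<in>P. u < Suc x} + card {u\<in>X. u < x})))"
  proof -
    have 1: "even (card (?I \<inter> {..<?f p})) \<longleftrightarrow> even (card {u\<in>P. u < p} + card {u\<in>X. u < p})" if "p \<in> P" for p
    proof -
      have "{u\<in>P. ?f u < ?f p} = {u\<in>P. u < p}" "{u\<in>X. ?g u < ?f p} = {u\<in>X. u < p}" by auto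
      moreover have "nat (?f p - 1) = 2 * p" by simp
      ultimately show ?thesis using P[OF that] by (subst ev) auto
    qed
    have 2: "even (card (?I \<inter> {..<?g x})) \<longleftrightarrow> odd (card {u\<in>P. u < Suc x} + card {u\<in>X. u < x})" if "x \<in> X" for x
    proof -
      have "{u\<in>P. ?f u < ?g x} = {u\<in>P. u < Suc x}" "{u\<in>X. ?g u < ?g x} = {u\<in>X. u < x}" by auto
      moreover have "nat (?g x - 1) = 2 * x + 1" by simp
      ultimately show ?thesis using X[OF that] by (subst ev) auto
    qed
    have 3: "even (card (?I \<inter> {..<int M + 1})) \<longleftrightarrow> even (M + card P + card X)"
    proof -
      have "{u\<in>P. ?f u < int M + 1} = P" "{u\<in>X. ?g u < int M + 1} = X"
        using P X by (auto simp: Suc_le_eq) force+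
      moreover have "nat (int M + 1 - 1) = M" by simp
      ultimately show ?thesis by (subst ev) (auto simp: add.assoc)
    qed
    show ?thesis using 1 2 3 by (simp only: ball_Un ball_simps) blast
  qed
  finally show ?thesis by (simp only: parity_iff_interlacing[OF fin])
qed

section \<open>Dented trapezoids\<close>

lemma det_sum_PiE:
  fixes g :: "nat \<Rightarrow> nat \<Rightarrow> 'b \<Rightarrow> real"
  assumes "\<And>i. i < n \<Longrightarrow> finite (I i)"
  shows "(\<Sum>x\<in>Pi\<^sub>E {..<n} I. (\<Prod>i<n. w (x i)) * det (mat n n (\<lambda>(i, j). g i j (x i)))) =
    det (mat n n (\<lambda>(i, j). \<Sum>u\<in>I i. w u * g i j u))"
proof -
  let ?S = "{\<sigma>. \<sigma> permutes {0..<n}}"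
  have D: "det (mat n n (\<lambda>(i, j). f i j)) = (\<Sum>\<sigma>\<in>?S. signof \<sigma> * (\<Prod>i<n. f i (\<sigma> i)))"
    for f :: "nat \<Rightarrow> nat \<Rightarrow> real"
    by (subst det_def'[of _ n])
       (auto intro!: sum.cong prod.cong simp: atLeast0LessThan dest: permutes_in_image)
  have "(\<Sum>x\<in>Pi\<^sub>E {..<n} I. (\<Prod>i<n. w (x i)) * det (mat n n (\<lambda>(i, j). g i j (x i)))) =
      (\<Sum>\<sigma>\<in>?S. \<Sum>x\<in>Pi\<^sub>E {..<n} I. signof \<sigma> * (\<Prod>i<n. w (x i) * g i (\<sigma> i) (x i)))"
    by (subst sum.swap) (simp add: D sum_distrib_left prod.distrib mult_ac)
  also have "\<dots> = (\<Sum>\<sigma>\<in>?S. signof \<sigma> * (\<Prod>i<n. \<Sum>u\<in>I i. w u * g i (\<sigma> i) u))"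
    by (subst prod_sum_PiE) (use assms in \<open>auto simp: sum_distrib_left\<close>)
  also have "\<dots> = det (mat n n (\<lambda>(i, j). \<Sum>u\<in>I i. w u * g i j u))" by (simp add: D)
  finally show ?thesis .
qed

lemma prod_list_diag_mat: "prod_list (diag_mat (mat n n f)) = (\<Prod>i<n. f (i, i))"
  unfolding diag_mat_def
  by (simp add: prod.distinct_set_conv_list[symmetric] atLeast0LessThan)

lemma det_row_differences:
  fixes r :: "nat \<Rightarrow> nat \<Rightarrow> real"
  shows "det (mat n n (\<lambda>(i, j). r i j - (if i = 0 then 0 else r (i - 1) j))) =
    det (mat n n (\<lambda>(i, j). r i j))"
proof -
  let ?L = "mat n n (\<lambda>(i, k). if k = i then 1 else if Suc k = i then - 1 else (0::real))"
  let ?R = "mat n n (\<lambda>(i, j). r i j)"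
  have "mat n n (\<lambda>(i, j). r i j - (if i = 0 then 0 else r (i - 1) j)) = ?L * ?R"
  proof (rule eq_matI)
    fix i j assume ij: "i < dim_row (?L * ?R)" "j < dim_col (?L * ?R)"
    hence "(?L * ?R) $$ (i, j) = (\<Sum>k<n. (if k = i then 1 else if Suc k = i then - 1 else 0) * r k j)"
      by (simp add: scalar_prod_def atLeast0LessThan)
    also have "\<dots> = (\<Sum>k<n. (if k = i then r i j else 0) - (if Suc k = i then r k j else 0))"
      by (intro sum.cong) auto
    also have "\<dots> = r i j - (\<Sum>k<n. if Suc k = i then r k j else 0)"
      using ij by (simp add: sum_subtractf)
    also have "(\<Sum>k<n. if Suc k = i then r k j else 0) = (if i = 0 then 0 else r (i - 1) j)"
    proof (cases i)
      case (Suc m)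
      thus ?thesis using ij by simp
    qed simp
    finally show "mat n n (\<lambda>(i, j). r i j - (if i = 0 then 0 else r (i - 1) j)) $$ (i, j) = (?L * ?R) $$ (i, j)"
      using ij by simp
  qed auto
  moreover have "det ?L = 1"
    by (subst det_lower_triangular[of n]) (auto simp: prod_list_diag_mat)
  ultimately show ?thesis by (simp add: det_mult[of _ n])
qed

text \<open>Taking differences of rows clears the column of ones except for its top entry, and
  expansion along it leaves the minor. Read backwards, this turns \<open>n\<close> differences of
  consecutive rows into a determinant of size \<open>n + 1\<close>.\<close>

lemma det_bordered_ones:
  fixes r :: "nat \<Rightarrow> nat \<Rightarrow> real"
  shows "det (mat (Suc n) (Suc n) (\<lambda>(i, j). if j = 0 then 1 else r i (j - 1))) =
    det (mat n n (\<lambda>(i, j). r (Suc i) j - r i j))"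
proof -
  let ?s = "\<lambda>i j. if j = 0 then 1 else r i (j - 1)"
  let ?A = "mat (Suc n) (Suc n) (\<lambda>(i, j). ?s i j - (if i = 0 then 0 else ?s (i - 1) j))"
  have "det (mat (Suc n) (Suc n) (\<lambda>(i, j). ?s i j)) = det ?A"
    by (rule det_row_differences[symmetric])
  also have "\<dots> = (\<Sum>i<Suc n. ?A $$ (i, 0) * cofactor ?A i 0)"
    by (rule laplace_expansion_column) auto
  also have "\<dots> = (\<Sum>i<Suc n. if i = 0 then cofactor ?A 0 0 else 0)"
    by (rule sum.cong) auto
  also have "\<dots> = det (mat_delete ?A 0 0)" by (simp add: cofactor_def)
  also have "mat_delete ?A 0 0 = mat n n (\<lambda>(i, j). r (Suc i) j - r i j)"
    by (rule eq_matI) (auto simp: mat_delete_def)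
  finally show ?thesis .
qed

text \<open>Central factorial polynomials, normalised so that each is the central difference of the next.\<close>

definition even_cfp :: "nat \<Rightarrow> real \<Rightarrow> real" where
  "even_cfp m u = (\<Prod>i<m. u\<^sup>2 - (real i)\<^sup>2) / fact (2 * m)"

definition odd_cfp :: "nat \<Rightarrow> real \<Rightarrow> real" where
  "odd_cfp m v = v * (\<Prod>i<m. v\<^sup>2 - (real i + 1 / 2)\<^sup>2) / fact (2 * m + 1)"

text \<open>All the shifted products share the factor \<open>Q m\<close>, the product of the
  \<open>2 * m\<close> consecutive numbers from \<open>u - m + 1\<close> to \<open>u + m\<close>.
  Both difference equations then reduce to an identity between the few remaining linear
  factors.\<close>

lemma cfp_products:
  fixes u :: real
  defines "Q \<equiv> \<lambda>m. \<Prod>i<m. (u - real i) * (u + 1 + real i)"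
  shows "(\<Prod>i<m. (u + 1 / 2)\<^sup>2 - (real i + 1 / 2)\<^sup>2) = Q m"
    "(\<Prod>i<Suc m. (u + 1)\<^sup>2 - (real i)\<^sup>2) = (u + 1) * (u + 1 + real m) * Q m"
    "(\<Prod>i<Suc m. u\<^sup>2 - (real i)\<^sup>2) = u * (u - real m) * Q m"
    "(\<Prod>i<Suc m. (u - 1 / 2)\<^sup>2 - (real i + 1 / 2)\<^sup>2) = (u - real m - 1) * (u - real m) * Q m"
proof -
  have QS: "Q (Suc m) = Q m * ((u - real m) * (u + 1 + real m))" for m by (simp add: Q_def)
  have 0: "Q 0 = 1" by (simp add: Q_def)
  show "(\<Prod>i<m. (u + 1 / 2)\<^sup>2 - (real i + 1 / 2)\<^sup>2) = Q m"
    unfolding Q_def by (rule prod.cong) (auto simp: power2_eq_square algebra_simps)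
  show "(\<Prod>i<Suc m. (u + 1)\<^sup>2 - (real i)\<^sup>2) = (u + 1) * (u + 1 + real m) * Q m"
  proof (induction m)
    case (Suc m)
    show ?case by (subst prod.lessThan_Suc) (simp only: Suc.IH QS; simp add: power2_eq_square algebra_simps)
  qed (simp add: 0 power2_eq_square)
  show "(\<Prod>i<Suc m. u\<^sup>2 - (real i)\<^sup>2) = u * (u - real m) * Q m"
  proof (induction m)
    case (Suc m)
    show ?case by (subst prod.lessThan_Suc) (simp only: Suc.IH QS; simp add: power2_eq_square algebra_simps)
  qed (simp add: 0 power2_eq_square)
  show "(\<Prod>i<Suc m. (u - 1 / 2)\<^sup>2 - (real i + 1 / 2)\<^sup>2) = (u - real m - 1) * (u - real m) * Q m"
  proof (induction m)
    case (Suc m)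
    show ?case by (subst prod.lessThan_Suc) (simp only: Suc.IH QS; simp add: power2_eq_square algebra_simps)
  qed (simp add: 0 power2_eq_square algebra_simps)
qed

lemma even_cfp_difference:
  "even_cfp (Suc m) (u + 1) - even_cfp (Suc m) u = odd_cfp m (u + 1 / 2)"
proof -
  define Q where "Q = (\<Prod>i<m. (u - real i) * (u + 1 + real i))"
  have "even_cfp (Suc m) (u + 1) - even_cfp (Suc m) u =
      ((u + 1) * (u + 1 + real m) - u * (u - real m)) * Q / fact (2 * Suc m)"
    unfolding even_cfp_def cfp_products Q_def[symmetric] by (simp only: diff_divide_distrib left_diff_distrib)
  also have "(u + 1) * (u + 1 + real m) - u * (u - real m) = (2 * real m + 2) * (u + 1 / 2)"
    by (simp add: algebra_simps)
  also have "\<dots> * Q / fact (2 * Suc m) = (u + 1 / 2) * Q / fact (2 * m + 1)"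
  proof -
    have f: "fact (2 * Suc m) = (2 * real m + 2) * (fact (2 * m + 1) :: real)" by (simp add: algebra_simps)
    have nz: "2 * real m + 2 \<noteq> 0" by linarith
    show ?thesis unfolding f mult.assoc by (rule mult_divide_mult_cancel_left[OF nz])
  qed
  finally show ?thesis unfolding odd_cfp_def cfp_products Q_def .
qed

lemma odd_cfp_difference:
  "odd_cfp m (u + 1 / 2) - odd_cfp m (u - 1 / 2) = even_cfp m u"
proof (cases m)
  case 0
  thus ?thesis by (simp add: odd_cfp_def even_cfp_def)
next
  case (Suc n)
  define Q where "Q = (\<Prod>i<n. (u - real i) * (u + 1 + real i))"
  have 1: "(\<Prod>i<Suc n. (u + 1 / 2)\<^sup>2 - (real i + 1 / 2)\<^sup>2) = Q * ((u - real n) * (u + 1 + real n))"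
    unfolding cfp_products Q_def by simp
  have "odd_cfp m (u + 1 / 2) - odd_cfp m (u - 1 / 2) =
     ((u + 1 / 2) * (Q * ((u - real n) * (u + 1 + real n))) - (u - 1 / 2) * ((u - real n - 1) * (u - real n) * Q)) / fact (2 * Suc n + 1)"
    unfolding odd_cfp_def Suc 1 unfolding cfp_products(4) Q_def[symmetric] by (simp only: diff_divide_distrib)
  also have "(u + 1 / 2) * (Q * ((u - real n) * (u + 1 + real n))) - (u - 1 / 2) * ((u - real n - 1) * (u - real n) * Q)
     = (2 * real n + 3) * (u * (u - real n) * Q)"
    by (simp add: field_simps)
  also have "\<dots> / fact (2 * Suc n + 1) = u * (u - real n) * Q / fact (2 * Suc n)"
  proof -
    have f: "fact (2 * Suc n + 1) = (2 * real n + 3) * (fact (2 * Suc n) :: real)" by (simp add: algebra_simps)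
    have nz: "2 * real n + 3 \<noteq> 0" by linarith
    show ?thesis unfolding f by (rule mult_divide_mult_cancel_left[OF nz])
  qed
  finally show ?thesis unfolding even_cfp_def Suc cfp_products(3) Q_def .
qed

lemma sum_odd_cfp:
  assumes "p \<le> q"
  shows "(\<Sum>u\<in>{p..<q}. odd_cfp m (real u + 1 / 2)) = even_cfp (Suc m) (real q) - even_cfp (Suc m) (real p)"
  using assms
proof (induction q rule: dec_induct)
  case (step q)
  thus ?case using even_cfp_difference[of m "real q"] by (simp add: add.commute)
qed simp

text \<open>Here the weight 1/2 fits: \<open>odd_cfp m\<close> is an odd function, so its central
  difference at 0 is \<open>2 * odd_cfp m (1 / 2)\<close>. Counting position 0 with weight 1/2 makes
  the sum of \<open>even_cfp m\<close> over \<open>{..q}\<close> telescope without a boundary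
  term.\<close>

lemma odd_cfp_half: "odd_cfp m (1 / 2) = even_cfp m 0 / 2"
proof (cases m)
  case (Suc n)
  have "(\<Prod>i<Suc n. (1 / 2)\<^sup>2 - (real i + 1 / 2)\<^sup>2) = (0::real)"
    "(\<Prod>i<Suc n. 0\<^sup>2 - (real i)\<^sup>2) = (0::real)"
    by (subst prod.lessThan_Suc_shift; simp)+
  thus ?thesis unfolding Suc odd_cfp_def even_cfp_def by (simp only: mult_zero_right div_0)
qed (simp add: odd_cfp_def even_cfp_def)

definition zigzag_factor :: "nat \<Rightarrow> real" where
  "zigzag_factor u = (if u = 0 then 1 / 2 else 1)"

lemma sum_even_cfp_atMost:
  "(\<Sum>u\<in>{..q}. zigzag_factor u * even_cfp m (real u)) = odd_cfp m (real q + 1 / 2)"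
proof (induction q)
  case (Suc q)
  thus ?case using odd_cfp_difference[of m "real (Suc q)"]
    by (simp add: zigzag_factor_def add.commute algebra_simps)
qed (simp add: zigzag_factor_def odd_cfp_half)

lemma sum_even_cfp:
  assumes "p \<le> q"
  shows "(\<Sum>u\<in>{Suc p..q}. zigzag_factor u * even_cfp m (real u)) =
    odd_cfp m (real q + 1 / 2) - odd_cfp m (real p + 1 / 2)"
proof -
  have "{..q} = {..p} \<union> {Suc p..q}" using assms by auto
  hence "(\<Sum>u\<in>{..q}. zigzag_factor u * even_cfp m (real u)) =
     (\<Sum>u\<in>{..p}. zigzag_factor u * even_cfp m (real u)) + (\<Sum>u\<in>{Suc p..q}. zigzag_factor u * even_cfp m (real u))"
    by (simp only:, subst sum.union_disjoint) auto
  thus ?thesis unfolding sum_even_cfp_atMost by simp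
qed

text \<open>An interlacing set is one choice from each of \<open>d\<close> successive intervals. By
  \<open>ord\<close> every such choice is increasing, hence is the enumeration of its own
  image.\<close>

lemma sum_interlacing:
  fixes F :: "nat set \<Rightarrow> real"
  assumes sub: "\<And>j. j < d \<Longrightarrow> I j \<subseteq> {..<m}"
    and ord: "\<And>i j u v. i < j \<Longrightarrow> j < d \<Longrightarrow> u \<in> I i \<Longrightarrow> v \<in> I j \<Longrightarrow> u < v"
    and C: "\<And>X. X \<subseteq> {..<m} \<Longrightarrow> C X \<longleftrightarrow> card X = d \<and> (\<forall>j<d. enum_set X j \<in> I j)"
  shows "(\<Sum>X\<in>Pow {..<m}. of_bool (C X) * F X) = (\<Sum>x\<in>Pi\<^sub>E {..<d} I. F (x ` {..<d}))"
proof -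
  have "(\<Sum>X\<in>Pow {..<m}. of_bool (C X) * F X) = (\<Sum>X\<in>{X\<in>Pow {..<m}. C X}. F X)"
    by (simp add: sum.inter_filter[symmetric] if_distrib cong: if_cong)
       (rule sum.cong, auto)
  also have "\<dots> = (\<Sum>x\<in>Pi\<^sub>E {..<d} I. F (x ` {..<d}))"
  proof (rule sum.reindex_bij_witness[of _ "\<lambda>x. x ` {..<d}" "\<lambda>X. restrict (enum_set X) {..<d}"])
    fix X assume X: "X \<in> {X\<in>Pow {..<m}. C X}"
    hence fX: "finite X" and cX: "card X = d" and eX: "\<And>j. j < d \<Longrightarrow> enum_set X j \<in> I j"
      using C[of X] finite_subset[of X "{..<m}"] by auto
    show 1: "restrict (enum_set X) {..<d} ` {..<d} = X"
      using enum_set_image[OF fX] cX by simp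
    show "restrict (enum_set X) {..<d} \<in> Pi\<^sub>E {..<d} I" using eX by auto
    show "F (restrict (enum_set X) {..<d} ` {..<d}) = F X" by (simp only: 1)
  next
    fix x assume x: "x \<in> Pi\<^sub>E {..<d} I"
    have mono: "x i < x j" if "i < j" "j < d" for i j
      using ord[OF that] x that by (auto simp: PiE_def Pi_def)
    note E = enum_set_unique[of d x, OF mono]
    have sX: "x ` {..<d} \<subseteq> {..<m}" using x sub by (fastforce simp: PiE_def Pi_def)
    have eX: "enum_set (x ` {..<d}) j = x j" if "j < d" for j using E(2) that by blast
    show "restrict (enum_set (x ` {..<d})) {..<d} = x"
    proof
      fix j show "restrict (enum_set (x ` {..<d})) {..<d} j = x j"
        using eX[of j] x by (cases "j < d") (auto simp: PiE_def extensional_def)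
    qed
    have "card (x ` {..<d}) = d" using E(1) by blast
    moreover have "\<forall>j<d. enum_set (x ` {..<d}) j \<in> I j" using eX x by (auto simp: PiE_def Pi_def)
    ultimately show "x ` {..<d} \<in> {X\<in>Pow {..<m}. C X}" using C[OF sX] sX by simp
  qed
  finally show ?thesis .
qed

section \<open>Slicing two rows off a dented trapezoid\<close>

lemma brick_sum_split_line_image:
  fixes k :: int and f :: "nat \<Rightarrow> int"
  assumes fin: "finite R" and inj: "inj f"
    and J: "{c. odd (c - k) \<and> (k, c) \<in> R \<and> (k - 1, c) \<in> R} = f ` A"
  shows "brick_sum R = (\<Sum>X\<in>Pow A. (\<Prod>u\<in>X. if even k \<and> f u = 1 then 1 / 2 else 1) *
    (brick_sum ({p\<in>R. fst p < k} - {k - 1} \<times> f ` X) * brick_sum ({p\<in>R. k \<le> fst p} - {k} \<times> f ` X)))"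
proof -
  have i1: "inj_on f B" for B using inj by (rule inj_on_subset) simp
  have i2: "inj_on ((`) f) (Pow A)" by (rule inj_on_image_Pow[OF i1])
  have "Pow (f ` A) = ((`) f) ` Pow A" by (rule image_Pow_surj[symmetric]) simp
  thus ?thesis
    by (subst brick_sum_split_line[OF fin, of k])
       (simp only: J sum.reindex[OF i2] o_def prod.reindex[OF i1])
qed

definition trapezoid :: "nat \<Rightarrow> nat \<Rightarrow> point set" where
  "trapezoid N e = {(k, c). 0 \<le> k \<and> k < 2 * int e - 1 \<and> 1 \<le> c \<and> c \<le> 2 * int N - k - 1}"

definition base_dents :: "nat set \<Rightarrow> point set" where
  "base_dents P = {0} \<times> (\<lambda>p. 2 * int p + 1) ` P"

lemma finite_trapezoid: "finite (trapezoid N e)"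
  by (rule finite_subset[of _ "{0..2 * int e} \<times> {1..2 * int N}"]) (auto simp: trapezoid_def)

text \<open>Interlacing with the \<open>d + 1\<close> dents below allows \<open>d\<close> or
  \<open>d + 1\<close> dents above, and as the row has an odd number of cells, parity selects
  \<open>d\<close>: one between any two neighbours in \<open>P\<close>. The height of this cut is
  odd, so no weights occur.\<close>

lemma brick_sum_first_strip:
  assumes "d > 0" "P \<subseteq> {..<N}" "N > d" "card P = Suc d"
  shows "brick_sum (trapezoid N (Suc d) - base_dents P) =
    (\<Sum>X\<in>Pow {..<N - 1}. of_bool (card X = d \<and> (\<forall>j<d. enum_set X j \<in> {enum_set P j..<enum_set P (Suc j)})) *
      brick_sum ({p\<in>trapezoid N (Suc d). 1 \<le> fst p} - {1} \<times> (\<lambda>x. 2 * int x + 2) ` X))"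
proof -
  let ?R = "trapezoid N (Suc d) - base_dents P"
  let ?f = "\<lambda>x. 2 * int x + 2"
  have J: "{c. odd (c - 1) \<and> (1, c) \<in> ?R \<and> (1 - 1, c) \<in> ?R} = ?f ` {..<N - 1}"
  proof (intro equalityI subsetI)
    fix c assume "c \<in> {c. odd (c - 1) \<and> (1, c) \<in> ?R \<and> (1 - 1, c) \<in> ?R}"
    hence c: "even c" "1 \<le> c" "c \<le> 2 * int N - 2" by (auto simp: trapezoid_def)
    hence "c = ?f (nat (c div 2 - 1))" "nat (c div 2 - 1) < N - 1" by (auto elim!: evenE)
    thus "c \<in> ?f ` {..<N - 1}" by blast
  next
    fix c assume "c \<in> ?f ` {..<N - 1}"
    then obtain x where x: "c = ?f x" "x < N - 1" by blast
    have "2 * int x + 2 \<noteq> 2 * int p + 1" for p by presburger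
    thus "c \<in> {c. odd (c - 1) \<and> (1, c) \<in> ?R \<and> (1 - 1, c) \<in> ?R}"
      using x assms(1,3) by (auto simp: trapezoid_def base_dents_def)
  qed
  have fP: "finite P" using assms(2) finite_subset by blast
  have "brick_sum ?R = (\<Sum>X\<in>Pow {..<N - 1}. (\<Prod>u\<in>X. if even (1::int) \<and> ?f u = 1 then 1 / 2 else 1) *
    (brick_sum ({p\<in>?R. fst p < 1} - {1 - 1} \<times> ?f ` X) * brick_sum ({p\<in>?R. 1 \<le> fst p} - {1} \<times> ?f ` X)))"
    by (rule brick_sum_split_line_image[OF _ _ J]) (auto simp: finite_trapezoid inj_def)
  also have "\<dots> = (\<Sum>X\<in>Pow {..<N - 1}. of_bool (card X = d \<and> (\<forall>j<d. enum_set X j \<in> {enum_set P j..<enum_set P (Suc j)})) *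
      brick_sum ({p\<in>trapezoid N (Suc d). 1 \<le> fst p} - {1} \<times> ?f ` X))"
  proof (rule sum.cong[OF refl])
    fix X assume "X \<in> Pow {..<N - 1}"
    hence X: "X \<subseteq> {..<N - 1}" by blast
    hence fX: "finite X" using finite_subset by blast
    have 1: "{p\<in>?R. fst p < 1} - {1 - 1} \<times> ?f ` X =
        {0} \<times> ({1..int (2 * N - 1)} - ((\<lambda>p. 2 * int p + 1) ` P \<union> ?f ` X))"
      using assms(1,3) by (auto simp: trapezoid_def base_dents_def)
    have 2: "{p\<in>?R. 1 \<le> fst p} = {p\<in>trapezoid N (Suc d). 1 \<le> fst p}"
      by (auto simp: base_dents_def)
    have "even (2 * N - 1 + card P + card X) \<longleftrightarrow> odd (card P + card X)" using assms(3) by presburger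
    hence 3: "even (2 * N - 1 + card P + card X) \<and> (\<forall>j<card X. j < card P \<and> enum_set P j \<le> enum_set X j) \<and>
      (\<forall>j. Suc j < card P \<longrightarrow> j < card X \<and> enum_set X j < enum_set P (Suc j)) \<longleftrightarrow>
      card X = d \<and> (\<forall>j<d. enum_set X j \<in> {enum_set P j..<enum_set P (Suc j)})" (is "?L \<longleftrightarrow> ?Q")
    proof -
      have "card X = d" if a: ?L
      proof -
        have "card X < Suc (card P)" using a assms(4) by (metis less_Suc_eq_le less_imp_le not_less_eq order_refl)
        moreover have "card X \<ge> d" using a assms(1,4) by (metis Suc_diff_1 Suc_less_eq lessI less_eq_Suc_le)
        moreover have "odd (card P + card X)" using a \<open>even (2 * N - 1 + card P + card X) \<longleftrightarrow> _\<close> by blast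
        ultimately show ?thesis using assms(4) by (cases "card X = Suc d") auto
      qed
      thus ?thesis using \<open>even (2 * N - 1 + card P + card X) \<longleftrightarrow> _\<close> assms(4) by auto
    qed
    have strip: "brick_sum ({p\<in>?R. fst p < 1} - {1 - 1} \<times> ?f ` X) =
      of_bool (card X = d \<and> (\<forall>j<d. enum_set X j \<in> {enum_set P j..<enum_set P (Suc j)}))"
    proof -
      have "2 * p + 1 \<le> 2 * N - 1" if "p \<in> P" for p using subsetD[OF assms(2) that] by auto
      moreover have "2 * x + 2 \<le> 2 * N - 1" if "x \<in> X" for x using subsetD[OF X that] by auto
      ultimately show ?thesis unfolding 1 by (simp only: brick_sum_dented_strip[OF fP fX] 3)
    qed
    have wt: "(\<Prod>u\<in>X. if even (1::int) \<and> ?f u = 1 then 1 / 2 else 1) = (1::real)" by simp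
    show "(\<Prod>u\<in>X. if even (1::int) \<and> ?f u = 1 then 1 / 2 else 1) *
        (brick_sum ({p\<in>?R. fst p < 1} - {1 - 1} \<times> ?f ` X) * brick_sum ({p\<in>?R. 1 \<le> fst p} - {1} \<times> ?f ` X)) =
      of_bool (card X = d \<and> (\<forall>j<d. enum_set X j \<in> {enum_set P j..<enum_set P (Suc j)})) *
        brick_sum ({p\<in>trapezoid N (Suc d). 1 \<le> fst p} - {1} \<times> ?f ` X)"
      by (simp only: strip 2 wt mult_1_left)
  qed
  finally show ?thesis .
qed

text \<open>In row 1 the odd columns belong to the upper side, so \<open>Y\<close> takes the role of
  \<open>P\<close> in \<open>brick_sum_dented_strip\<close>, and its first element may go down to
  the zigzag. The height of the cut is even, so \<open>0 \<in> Y\<close> costs a factor 1/2. What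
  remains above is, two rows higher, a trapezoid with both parameters reduced by 1.\<close>

lemma brick_sum_second_strip:
  assumes "d > 0" "X \<subseteq> {..<N - 1}" "N > d" "card X = d"
  shows "brick_sum ({p\<in>trapezoid N (Suc d). 1 \<le> fst p} - {1} \<times> (\<lambda>x. 2 * int x + 2) ` X) =
    (\<Sum>Y\<in>Pow {..<N - 1}. of_bool (card Y = d \<and>
        (\<forall>j<d. enum_set Y j \<in> {(if j = 0 then 0 else Suc (enum_set X (j - 1)))..enum_set X j})) *
      ((\<Prod>u\<in>Y. zigzag_factor u) * brick_sum (trapezoid (N - 1) d - base_dents Y)))"
proof -
  let ?f = "\<lambda>x. 2 * int x + 2" and ?g = "\<lambda>x. 2 * int x + 1"
  let ?R = "{p\<in>trapezoid N (Suc d). 1 \<le> fst p} - {1} \<times> ?f ` X"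
  have J: "{c. odd (c - 2) \<and> (2, c) \<in> ?R \<and> (2 - 1, c) \<in> ?R} = ?g ` {..<N - 1}"
  proof (intro equalityI subsetI)
    fix c assume "c \<in> {c. odd (c - 2) \<and> (2, c) \<in> ?R \<and> (2 - 1, c) \<in> ?R}"
    hence c: "odd c" "1 \<le> c" "c \<le> 2 * int N - 3" by (auto simp: trapezoid_def)
    hence "c = ?g (nat (c div 2))" "nat (c div 2) < N - 1" by (auto elim!: oddE)
    thus "c \<in> ?g ` {..<N - 1}" by blast
  next
    fix c assume "c \<in> ?g ` {..<N - 1}"
    then obtain x where x: "c = ?g x" "x < N - 1" by blast
    have "2 * int x + 1 \<noteq> 2 * int p + 2" for p by presburger
    thus "c \<in> {c. odd (c - 2) \<and> (2, c) \<in> ?R \<and> (2 - 1, c) \<in> ?R}"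
      using x assms(1,3) by (auto simp: trapezoid_def)
  qed
  have fX: "finite X" using assms(2) finite_subset by blast
  have "brick_sum ?R = (\<Sum>Y\<in>Pow {..<N - 1}. (\<Prod>u\<in>Y. if even (2::int) \<and> ?g u = 1 then 1 / 2 else 1) *
    (brick_sum ({p\<in>?R. fst p < 2} - {2 - 1} \<times> ?g ` Y) * brick_sum ({p\<in>?R. 2 \<le> fst p} - {2} \<times> ?g ` Y)))"
    by (rule brick_sum_split_line_image[OF _ _ J]) (auto simp: finite_trapezoid inj_def)
  also have "\<dots> = (\<Sum>Y\<in>Pow {..<N - 1}. of_bool (card Y = d \<and>
        (\<forall>j<d. enum_set Y j \<in> {(if j = 0 then 0 else Suc (enum_set X (j - 1)))..enum_set X j})) *
      ((\<Prod>u\<in>Y. zigzag_factor u) * brick_sum (trapezoid (N - 1) d - base_dents Y)))"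
  proof (rule sum.cong[OF refl])
    fix Y assume "Y \<in> Pow {..<N - 1}"
    hence Y: "Y \<subseteq> {..<N - 1}" by blast
    hence fY: "finite Y" using finite_subset by blast
    have 1: "{p\<in>?R. fst p < 2} - {2 - 1} \<times> ?g ` Y =
        {1} \<times> ({1..int (2 * N - 2)} - (?g ` Y \<union> ?f ` X))"
      using assms(1,3) by (auto simp: trapezoid_def)
    have 2: "{p\<in>?R. 2 \<le> fst p} - {2} \<times> ?g ` Y = lift2 ` (trapezoid (N - 1) d - base_dents Y)"
    proof (intro equalityI subsetI)
      fix p assume p: "p \<in> {p\<in>?R. 2 \<le> fst p} - {2} \<times> ?g ` Y"
      hence "(fst p - 2, snd p) \<in> trapezoid (N - 1) d - base_dents Y"
        using assms(1,3) by (cases p) (auto simp: trapezoid_def base_dents_def)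
      moreover have "p = lift2 (fst p - 2, snd p)" by (simp add: lift2_def)
      ultimately show "p \<in> lift2 ` (trapezoid (N - 1) d - base_dents Y)" by (rule image_eqI[rotated])
    next
      fix p assume "p \<in> lift2 ` (trapezoid (N - 1) d - base_dents Y)"
      thus "p \<in> {p\<in>?R. 2 \<le> fst p} - {2} \<times> ?g ` Y"
        using assms(1,3) by (auto simp: trapezoid_def base_dents_def lift2_def)
    qed
    have par: "even (2 * N - 2 + card Y + card X) \<longleftrightarrow> even (card Y + card X)" using assms(3) by presburger
    have 3: "even (2 * N - 2 + card Y + card X) \<and> (\<forall>j<card X. j < card Y \<and> enum_set Y j \<le> enum_set X j) \<and>
      (\<forall>j. Suc j < card Y \<longrightarrow> j < card X \<and> enum_set X j < enum_set Y (Suc j)) \<longleftrightarrow>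
      card Y = d \<and> (\<forall>j<d. enum_set Y j \<in> {(if j = 0 then 0 else Suc (enum_set X (j - 1)))..enum_set X j})" (is "?L \<longleftrightarrow> ?Q")
    proof
      assume a: ?L
      have "card Y \<ge> d" using a assms(1,4) by (metis Suc_diff_1 Suc_leI lessI)
      moreover have "card Y \<le> Suc d"
      proof (rule ccontr)
        assume "\<not> card Y \<le> Suc d"
        hence "Suc d < card Y" by simp
        with a assms(4) show False by blast
      qed
      moreover have "even (card Y + card X)" using a par by blast
      ultimately have c: "card Y = d" using assms(4) by (cases "card Y = Suc d") auto
      have "enum_set Y j \<in> {(if j = 0 then 0 else Suc (enum_set X (j - 1)))..enum_set X j}" if "j < d" for j
        using a c assms(4) that by (cases j) auto
      with c show ?Q by blast
    next
      assume a: ?Q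
      have "enum_set X j < enum_set Y (Suc j)" if "Suc j < d" for j
      proof -
        have "enum_set Y (Suc j) \<in> {(if Suc j = 0 then 0 else Suc (enum_set X (Suc j - 1)))..enum_set X (Suc j)}"
          using a that by blast
        thus ?thesis by simp
      qed
      thus ?L using a par assms(4) by auto
    qed
    have strip: "brick_sum ({p\<in>?R. fst p < 2} - {2 - 1} \<times> ?g ` Y) =
      of_bool (card Y = d \<and> (\<forall>j<d. enum_set Y j \<in> {(if j = 0 then 0 else Suc (enum_set X (j - 1)))..enum_set X j}))"
    proof -
      have "2 * p + 1 \<le> 2 * N - 2" if "p \<in> Y" for p using subsetD[OF Y that] by auto
      moreover have "2 * x + 2 \<le> 2 * N - 2" if "x \<in> X" for x using subsetD[OF assms(2) that] by auto
      ultimately show ?thesis unfolding 1 by (simp only: brick_sum_dented_strip[OF fY fX] 3)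
    qed
    have wt: "(\<Prod>u\<in>Y. if even (2::int) \<and> ?g u = 1 then 1 / 2 else 1) = (\<Prod>u\<in>Y. zigzag_factor u)"
      by (simp add: zigzag_factor_def)
    show "(\<Prod>u\<in>Y. if even (2::int) \<and> ?g u = 1 then 1 / 2 else 1) *
        (brick_sum ({p\<in>?R. fst p < 2} - {2 - 1} \<times> ?g ` Y) * brick_sum ({p\<in>?R. 2 \<le> fst p} - {2} \<times> ?g ` Y)) =
      of_bool (card Y = d \<and> (\<forall>j<d. enum_set Y j \<in> {(if j = 0 then 0 else Suc (enum_set X (j - 1)))..enum_set X j})) *
      ((\<Prod>u\<in>Y. zigzag_factor u) * brick_sum (trapezoid (N - 1) d - base_dents Y))"
      by (simp only: strip 2 wt brick_sum_lift2 mult.left_commute)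
  qed
  finally show ?thesis .
qed

lemma brick_sum_one_row:
  assumes "p < N"
  shows "brick_sum (trapezoid N 1 - base_dents {p}) = 1"
proof -
  have "trapezoid N 1 - base_dents {p} = {0} \<times> ({1..int (2 * N - 1)} - ((\<lambda>p. 2 * int p + 1) ` {p} \<union> (\<lambda>x. 2 * int x + 2) ` {}))"
    using assms by (auto simp: trapezoid_def base_dents_def)
  hence "brick_sum (trapezoid N 1 - base_dents {p}) = of_bool (even (2 * N - 1 + card {p} + card ({}::nat set)))"
    by (simp only:, subst brick_sum_dented_strip) (use assms in auto)
  also have "even (2 * N - 1 + card {p} + card ({}::nat set))" using assms by simp
  hence "of_bool (even (2 * N - 1 + card {p} + card ({}::nat set))) = (1::real)" by simp
  finally show ?thesis .
qed

text \<open>Each slice sums the entries of the determinant over intervals between consecutive dents,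
  and the central factorials are normalised to be antiderivatives of one another for exactly this
  summation.\<close>

theorem brick_sum_dented_trapezoid:
  assumes "P \<subseteq> {..<N}" "card P = e"
  shows "brick_sum (trapezoid N e - base_dents P) = det (mat e e (\<lambda>(i, j). even_cfp j (real (enum_set P i))))"
  using assms
proof (induction e arbitrary: N P)
  case 0
  have "trapezoid N 0 = {}" by (auto simp: trapezoid_def)
  thus ?case by (simp add: brick_sum_def)
next
  case (Suc d)
  have fP: "finite P" using Suc.prems(1) finite_subset by blast
  have "card P \<le> N" using card_mono[OF _ Suc.prems(1)] by simp
  hence Nd: "N > d" using Suc.prems(2) by simp
  show ?case
  \<comment> \<open>For \<open>e = 1\<close> the trapezoid is a single row, so there is no second
    strip to slice off.\<close>
  proof (cases "d = 0")
    case True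
    then obtain p where p: "P = {p}" using Suc.prems(2) by (auto simp: card_1_singleton_iff)
    have "p < N" using p Suc.prems(1) by simp
    thus ?thesis using True brick_sum_one_row[of p N]
      by (simp add: p det_single even_cfp_def)
  next
    case False
    hence d: "d > 0" by simp
    let ?p = "enum_set P"
    have pless: "?p i < ?p j" if "i < j" "j < Suc d" for i j using enum_set_less[of i j P] that Suc.prems(2) by simp
    have ple: "?p i \<le> ?p j" if "i \<le> j" "j < Suc d" for i j using enum_set_le[of i j P] that Suc.prems(2) by simp
    have pN: "?p i < N" if "i < Suc d" for i using enum_set_mem[OF fP, of i] that Suc.prems by auto
    \<comment> \<open>Second strip: the sum over \<open>Y\<close> produces differences of
      \<open>odd_cfp\<close> at consecutive elements of \<open>X\<close>. The interval that starts
      at the zigzag has no lower boundary term, so its row is already the undifferenced one, and row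
      operations undo the other differences.\<close>
    have inner: "brick_sum ({p\<in>trapezoid N (Suc d). 1 \<le> fst p} - {1} \<times> (\<lambda>x. 2 * int x + 2) ` X) =
        det (mat d d (\<lambda>(i, j). odd_cfp j (real (enum_set X i) + 1 / 2)))"
      if X: "X \<subseteq> {..<N - 1}" "card X = d" for X
    proof -
      let ?x = "enum_set X"
      let ?I = "\<lambda>j. {(if j = 0 then 0 else Suc (?x (j - 1)))..?x j}"
      have fX: "finite X" using X(1) finite_subset by blast
      have xle: "?x i \<le> ?x j" if "i \<le> j" "j < d" for i j using enum_set_le[of i j X] that X(2) by simp
      have xless: "?x i < ?x j" if "i < j" "j < d" for i j using enum_set_less[of i j X] that X(2) by simp
      have "brick_sum ({p\<in>trapezoid N (Suc d). 1 \<le> fst p} - {1} \<times> (\<lambda>x. 2 * int x + 2) ` X) =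
        (\<Sum>Y\<in>Pow {..<N - 1}. of_bool (card Y = d \<and> (\<forall>j<d. enum_set Y j \<in> ?I j)) *
          ((\<Prod>u\<in>Y. zigzag_factor u) * det (mat d d (\<lambda>(i, j). even_cfp j (real (enum_set Y i))))))"
        unfolding brick_sum_second_strip[OF d X(1) Nd X(2)]
        by (intro sum.cong refl) (auto simp: Suc.IH)
      also have "\<dots> = (\<Sum>y\<in>Pi\<^sub>E {..<d} ?I. (\<Prod>u\<in>y ` {..<d}. zigzag_factor u) *
          det (mat d d (\<lambda>(i, j). even_cfp j (real (enum_set (y ` {..<d}) i)))))"
      proof (rule sum_interlacing)
        show "?I j \<subseteq> {..<N - 1}" if "j < d" for j
          using enum_set_mem[OF fX, of j] X that by auto
        fix i j u v assume ij: "i < j" "j < d" and uv: "u \<in> ?I i" "v \<in> ?I j"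
        have "u \<le> ?x i" "Suc (?x (j - 1)) \<le> v" using uv ij by auto
        moreover have "?x i \<le> ?x (j - 1)" using ij by (intro xle) auto
        ultimately show "u < v" by simp
      qed simp
      also have "\<dots> = (\<Sum>y\<in>Pi\<^sub>E {..<d} ?I. (\<Prod>i<d. zigzag_factor (y i)) *
          det (mat d d (\<lambda>(i, j). even_cfp j (real (y i)))))"
      proof (rule sum.cong[OF refl])
        fix y assume y: "y \<in> Pi\<^sub>E {..<d} ?I"
        have mono: "y i < y j" if "i < j" "j < d" for i j
        proof -
          have "y i \<in> ?I i" "y j \<in> ?I j" using y that by (auto simp: PiE_def Pi_def)
          hence "y i \<le> ?x i" "Suc (?x (j - 1)) \<le> y j" using that by auto
          moreover have "?x i \<le> ?x (j - 1)" using that by (intro xle) auto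
          ultimately show ?thesis by simp
        qed
        have inj: "inj_on y {..<d}" by (rule linorder_inj_onI) (use mono in \<open>fastforce+\<close>)
        have "mat d d (\<lambda>(i, j). even_cfp j (real (enum_set (y ` {..<d}) i))) = mat d d (\<lambda>(i, j). even_cfp j (real (y i)))"
          by (rule eq_matI) (auto simp: enum_set_unique(2)[of d y, OF mono])
        thus "(\<Prod>u\<in>y ` {..<d}. zigzag_factor u) *
            det (mat d d (\<lambda>(i, j). even_cfp j (real (enum_set (y ` {..<d}) i)))) =
          (\<Prod>i<d. zigzag_factor (y i)) * det (mat d d (\<lambda>(i, j). even_cfp j (real (y i))))"
          by (simp add: prod.reindex[OF inj])
      qed
      also have "\<dots> = det (mat d d (\<lambda>(i, j). \<Sum>u\<in>?I i. zigzag_factor u * even_cfp j (real u)))"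
        by (rule det_sum_PiE) simp
      also have "mat d d (\<lambda>(i, j). \<Sum>u\<in>?I i. zigzag_factor u * even_cfp j (real u)) =
         mat d d (\<lambda>(i, j). odd_cfp j (real (?x i) + 1 / 2) - (if i = 0 then 0 else odd_cfp j (real (?x (i - 1)) + 1 / 2)))"
      proof (rule eq_matI)
        fix i j assume "i < dim_row (mat d d (\<lambda>(i, j). odd_cfp j (real (?x i) + 1 / 2) - (if i = 0 then 0 else odd_cfp j (real (?x (i - 1)) + 1 / 2))))"
          "j < dim_col (mat d d (\<lambda>(i, j). odd_cfp j (real (?x i) + 1 / 2) - (if i = 0 then 0 else odd_cfp j (real (?x (i - 1)) + 1 / 2))))"
        hence ij: "i < d" "j < d" by simp_all
        have "(\<Sum>u\<in>?I i. zigzag_factor u * even_cfp j (real u)) =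
          odd_cfp j (real (?x i) + 1 / 2) - (if i = 0 then 0 else odd_cfp j (real (?x (i - 1)) + 1 / 2))"
        proof (cases "i = 0")
          case True
          thus ?thesis using sum_even_cfp_atMost[of j "?x 0"] by (simp add: atMost_def atLeastAtMost_def)
        next
          case False
          hence "?x (i - 1) \<le> ?x i" using ij by (intro xle) auto
          from sum_even_cfp[OF this, of j] show ?thesis using False by simp
        qed
        thus "mat d d (\<lambda>(i, j). \<Sum>u\<in>?I i. zigzag_factor u * even_cfp j (real u)) $$ (i, j) =
          mat d d (\<lambda>(i, j). odd_cfp j (real (?x i) + 1 / 2) - (if i = 0 then 0 else odd_cfp j (real (?x (i - 1)) + 1 / 2))) $$ (i, j)"
          using ij by simp
      qed auto
      also have "det \<dots> = det (mat d d (\<lambda>(i, j). odd_cfp j (real (?x i) + 1 / 2)))"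
        by (rule det_row_differences)
      finally show ?thesis .
    qed
    \<comment> \<open>First strip: the sum over \<open>X\<close> produces the \<open>d\<close>
      differences of \<open>even_cfp (Suc j)\<close> at the \<open>d + 1\<close> dents. The missing
      column is the constant \<open>even_cfp 0 = 1\<close>.\<close>
    let ?J = "\<lambda>j. {?p j..<?p (Suc j)}"
    have "brick_sum (trapezoid N (Suc d) - base_dents P) =
      (\<Sum>X\<in>Pow {..<N - 1}. of_bool (card X = d \<and> (\<forall>j<d. enum_set X j \<in> ?J j)) *
        det (mat d d (\<lambda>(i, j). odd_cfp j (real (enum_set X i) + 1 / 2))))"
      unfolding brick_sum_first_strip[OF d Suc.prems(1) Nd Suc.prems(2)]
      by (intro sum.cong refl) (auto simp: inner)
    also have "\<dots> = (\<Sum>x\<in>Pi\<^sub>E {..<d} ?J.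
        det (mat d d (\<lambda>(i, j). odd_cfp j (real (enum_set (x ` {..<d}) i) + 1 / 2))))"
    proof (rule sum_interlacing)
      show "?J j \<subseteq> {..<N - 1}" if "j < d" for j
        using pN[of "Suc j"] that by auto
      fix i j u v assume ij: "i < j" "j < d" and uv: "u \<in> ?J i" "v \<in> ?J j"
      have "?p (Suc i) \<le> ?p j" using ij by (intro ple) auto
      thus "u < v" using uv by simp
    qed simp
    also have "\<dots> = (\<Sum>x\<in>Pi\<^sub>E {..<d} ?J. (\<Prod>i<d. 1) * det (mat d d (\<lambda>(i, j). odd_cfp j (real (x i) + 1 / 2))))"
    proof (rule sum.cong[OF refl])
      fix x assume x: "x \<in> Pi\<^sub>E {..<d} ?J"
      have mono: "x i < x j" if "i < j" "j < d" for i j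
      proof -
        have "x i \<in> ?J i" "x j \<in> ?J j" using x that by (auto simp: PiE_def Pi_def)
        moreover have "?p (Suc i) \<le> ?p j" using that by (intro ple) auto
        ultimately show ?thesis by simp
      qed
      have "mat d d (\<lambda>(i, j). odd_cfp j (real (enum_set (x ` {..<d}) i) + 1 / 2)) = mat d d (\<lambda>(i, j). odd_cfp j (real (x i) + 1 / 2))"
        by (rule eq_matI) (auto simp: enum_set_unique(2)[of d x, OF mono])
      thus "det (mat d d (\<lambda>(i, j). odd_cfp j (real (enum_set (x ` {..<d}) i) + 1 / 2))) =
        (\<Prod>i<d. 1) * det (mat d d (\<lambda>(i, j). odd_cfp j (real (x i) + 1 / 2)))" by simp
    qed
    also have "\<dots> = det (mat d d (\<lambda>(i, j). \<Sum>u\<in>?J i. 1 * odd_cfp j (real u + 1 / 2)))"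
      by (rule det_sum_PiE) simp
    also have "mat d d (\<lambda>(i, j). \<Sum>u\<in>?J i. 1 * odd_cfp j (real u + 1 / 2)) =
      mat d d (\<lambda>(i, j). even_cfp (Suc j) (real (?p (Suc i))) - even_cfp (Suc j) (real (?p i)))"
      by (rule eq_matI) (auto simp: sum_odd_cfp ple)
    also have "det \<dots> = det (mat (Suc d) (Suc d) (\<lambda>(i, j). if j = 0 then 1 else even_cfp (Suc (j - 1)) (real (?p i))))"
      by (rule det_bordered_ones[symmetric])
    also have "mat (Suc d) (Suc d) (\<lambda>(i, j). if j = 0 then 1 else even_cfp (Suc (j - 1)) (real (?p i))) =
       mat (Suc d) (Suc d) (\<lambda>(i, j). even_cfp j (real (?p i)))"
      by (rule eq_matI) (auto simp: even_cfp_def)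
    finally show ?thesis .
  qed
qed

section \<open>Evaluation as a Vandermonde product in the squares of the dents\<close>

lemma det_scale_rows_cols:
  fixes f :: "nat \<Rightarrow> nat \<Rightarrow> real"
  shows "det (mat n n (\<lambda>(i, j). r i * s j * f i j)) =
    (\<Prod>i<n. r i) * (\<Prod>j<n. s j) * det (mat n n (\<lambda>(i, j). f i j))"
proof -
  have D: "det (mat n n (\<lambda>(i, j). f i j)) = (\<Sum>\<sigma> | \<sigma> permutes {0..<n}. signof \<sigma> * (\<Prod>i<n. f i (\<sigma> i)))"
    for f :: "nat \<Rightarrow> nat \<Rightarrow> real"
    by (subst det_def'[of _ n])
       (auto intro!: sum.cong prod.cong simp: atLeast0LessThan dest: permutes_in_image)
  have "(\<Prod>i<n. s (\<sigma> i)) = (\<Prod>j<n. s j)" if "\<sigma> permutes {0..<n}" for \<sigma>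
    using prod.permute[OF that, of s] by (simp add: atLeast0LessThan o_def)
  thus ?thesis by (simp add: D sum_distrib_left prod.distrib mult_ac)
qed

lemma monic_linear_product:
  fixes c :: "nat \<Rightarrow> real"
  shows "degree (\<Prod>k<m. [:- c k, 1:]) = m" "coeff (\<Prod>k<m. [:- c k, 1:]) m = 1"
proof (induction m)
  case (Suc m)
  let ?q = "\<Prod>k<m. [:- c k, 1:]"
  have S: "(\<Prod>k<Suc m. [:- c k, 1:]) = ?q * [:- c m, 1:]" by (rule prod.lessThan_Suc)
  {
    case 1
    have "degree (?q * [:- c m, 1:]) = degree ?q + degree [:- c m, 1:]"
      by (rule degree_mult_eq) auto
    thus ?case unfolding S using Suc by (simp del: mult_pCons_right)
  next
    case 2
    have "coeff (?q * [:- c m, 1:]) (degree ?q + degree [:- c m, 1:]) = lead_coeff ?q * lead_coeff [:- c m, 1:]"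
      by (rule coeff_mult_degree_sum)
    thus ?case unfolding S using Suc by (simp del: mult_pCons_right)
  }
qed auto

lemma det_monomials_eq_det_newton:
  fixes X c :: "nat \<Rightarrow> real"
  shows "det (mat n n (\<lambda>(i, j). \<Prod>k<j. X i - c k)) = det (mat n n (\<lambda>(i, j). X i ^ j))"
proof -
  let ?q = "\<lambda>j. \<Prod>k<j. [:- c k, 1:]"
  let ?V = "mat n n (\<lambda>(i, j). X i ^ j)" and ?U = "mat n n (\<lambda>(l, j). coeff (?q j) l)"
  have "mat n n (\<lambda>(i, j). \<Prod>k<j. X i - c k) = ?V * ?U"
  proof (rule eq_matI)
    fix i j assume ij: "i < dim_row (?V * ?U)" "j < dim_col (?V * ?U)"
    have "(\<Prod>k<j. X i - c k) = poly (?q j) (X i)" by (simp add: poly_prod)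
    also have "\<dots> = (\<Sum>l\<le>j. coeff (?q j) l * X i ^ l)"
      using poly_altdef[of "?q j" "X i"] by (simp add: monic_linear_product)
    also have "\<dots> = (\<Sum>l<n. coeff (?q j) l * X i ^ l)"
    proof (rule sum.mono_neutral_left)
      show "{..j} \<subseteq> {..<n}" using ij by auto
      show "\<forall>l\<in>{..<n} - {..j}. coeff (?q j) l * X i ^ l = 0"
      proof
        fix l assume "l \<in> {..<n} - {..j}"
        hence "degree (?q j) < l" by (simp add: monic_linear_product)
        thus "coeff (?q j) l * X i ^ l = 0" by (simp add: coeff_eq_0)
      qed
    qed simp
    finally show "mat n n (\<lambda>(i, j). \<Prod>k<j. X i - c k) $$ (i, j) = (?V * ?U) $$ (i, j)"
      using ij by (simp add: scalar_prod_def atLeast0LessThan mult.commute)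
  qed auto
  moreover have "det ?U = 1"
  proof (subst det_upper_triangular[of _ n])
    show "upper_triangular ?U"
    proof
      fix i j assume "j < i" "i < dim_row ?U"
      thus "?U $$ (i, j) = 0" by (simp add: coeff_eq_0 monic_linear_product)
    qed
  qed (auto simp: prod_list_diag_mat monic_linear_product)
  ultimately show ?thesis by (simp add: det_mult[of _ n])
qed

text \<open>Newton bases with different nodes differ by unitriangular matrices, so the determinant
  is independent of \<open>c\<close>. With the choice \<open>c = X\<close> the matrix is triangular,
  because the entry \<open>(i, j)\<close> with \<open>j > i\<close> contains the factor
  \<open>X i - X i\<close>.\<close>

lemma det_newton_basis:
  fixes X c :: "nat \<Rightarrow> real"
  shows "det (mat n n (\<lambda>(i, j). \<Prod>k<j. X i - c k)) = (\<Prod>i<n. \<Prod>k<i. X i - X k)"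
proof -
  have "det (mat n n (\<lambda>(i, j). \<Prod>k<j. X i - c k)) = det (mat n n (\<lambda>(i, j). \<Prod>k<j. X i - X k))"
    by (simp only: det_monomials_eq_det_newton)
  also have "\<dots> = (\<Prod>i<n. \<Prod>k<i. X i - X k)"
    by (subst det_lower_triangular[of n]) (auto simp: prod_list_diag_mat)
  finally show ?thesis .
qed

definition sq_vandermonde :: "nat set \<Rightarrow> real" where
  "sq_vandermonde P = (\<Prod>(p, q) | p \<in> P \<and> q \<in> P \<and> p < q. (real q)\<^sup>2 - (real p)\<^sup>2)"

lemma sq_vandermonde_empty [simp]: "sq_vandermonde {} = 1"
  by (simp add: sq_vandermonde_def)

lemma sq_vandermonde_pos: "sq_vandermonde P > 0"
  unfolding sq_vandermonde_def by (rule prod_pos) (auto simp: power2_eq_square intro!: mult_strict_mono)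

lemma sq_vandermonde_enum:
  assumes "finite P" "card P = n"
  shows "sq_vandermonde P = (\<Prod>i<n. \<Prod>k<i. (real (enum_set P i))\<^sup>2 - (real (enum_set P k))\<^sup>2)"
proof -
  let ?p = "enum_set P"
  let ?f = "\<lambda>(i, k). (?p k, ?p i)" and ?h = "\<lambda>(p, q). (real q)\<^sup>2 - (real p)\<^sup>2"
  have inj: "inj_on ?p {..<n}" using inj_on_enum_set[of P] assms by simp
  have bij: "bij_betw ?f (Sigma {..<n} (\<lambda>i. {..<i})) {(p, q). p \<in> P \<and> q \<in> P \<and> p < q}"
    unfolding bij_betw_def
  proof (intro conjI equalityI subsetI)
    show "inj_on ?f (Sigma {..<n} (\<lambda>i. {..<i}))"
    proof (rule inj_onI)
      fix z z' assume z: "z \<in> Sigma {..<n} (\<lambda>i. {..<i})" "z' \<in> Sigma {..<n} (\<lambda>i. {..<i})" "?f z = ?f z'"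
      obtain i k i' k' where zz: "z = (i, k)" "z' = (i', k')" by (cases z, cases z')
      have "?p i = ?p i'" "?p k = ?p k'" "i < n" "i' < n" "k < n" "k' < n" using z by (auto simp: zz)
      thus "z = z'" unfolding zz using inj_onD[OF inj, of i i'] inj_onD[OF inj, of k k'] by simp
    qed
  next
    fix z assume "z \<in> ?f ` Sigma {..<n} (\<lambda>i. {..<i})"
    then obtain i k where "i < n" "k < i" "z = (?p k, ?p i)" by auto
    thus "z \<in> {(p, q). p \<in> P \<and> q \<in> P \<and> p < q}"
      using enum_set_mem[OF assms(1)] enum_set_less[of k i P] assms(2) by simp
  next
    fix z assume "z \<in> {(p, q). p \<in> P \<and> q \<in> P \<and> p < q}"
    then obtain p q where z: "z = (p, q)" "p \<in> P" "q \<in> P" "p < q" by auto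
    obtain k where k: "k < card P" "p = ?p k" by (rule enum_set_cases[OF assms(1) z(2)])
    obtain i where i: "i < card P" "q = ?p i" by (rule enum_set_cases[OF assms(1) z(3)])
    have "k < i"
    proof (rule ccontr)
      assume "\<not> k < i"
      hence "?p i \<le> ?p k" using k by (intro enum_set_le) auto
      thus False using k i z(4) by simp
    qed
    hence "(i, k) \<in> Sigma {..<n} (\<lambda>i. {..<i})" "z = ?f (i, k)"
      using i k z(1) assms(2) by auto
    thus "z \<in> ?f ` Sigma {..<n} (\<lambda>i. {..<i})" by (rule image_eqI[rotated])
  qed
  have "(\<Prod>i<n. \<Prod>k<i. (real (?p i))\<^sup>2 - (real (?p k))\<^sup>2) =
     (\<Prod>(i, k)\<in>Sigma {..<n} (\<lambda>i. {..<i}). (real (?p i))\<^sup>2 - (real (?p k))\<^sup>2)"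
    by (rule prod.Sigma) auto
  also have "\<dots> = (\<Prod>x\<in>Sigma {..<n} (\<lambda>i. {..<i}). ?h (?f x))"
    by (rule prod.cong) auto
  also have "\<dots> = sq_vandermonde P" unfolding sq_vandermonde_def by (rule prod.reindex_bij_betw[OF bij])
  finally show ?thesis ..
qed

lemma sq_vandermonde_insert:
  assumes "finite P" "s \<notin> P"
  shows "sq_vandermonde (insert s P) = sq_vandermonde P * (\<Prod>p\<in>P. \<bar>(real s)\<^sup>2 - (real p)\<^sup>2\<bar>)"
proof -
  let ?h = "\<lambda>(p, q). (real q)\<^sup>2 - (real p)\<^sup>2"
  let ?A = "{(p, q). p \<in> P \<and> q \<in> P \<and> p < q}"
  let ?L = "{p\<in>P. p < s}" and ?G = "{p\<in>P. s < p}"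
  have fA: "finite ?A" by (rule finite_subset[of _ "P \<times> P"]) (use assms in auto)
  have "{(p, q). p \<in> insert s P \<and> q \<in> insert s P \<and> p < q} = ?A \<union> ((\<lambda>p. (p, s)) ` ?L \<union> (\<lambda>p. (s, p)) ` ?G)"
    by auto
  hence "sq_vandermonde (insert s P) = prod ?h ?A * (prod ?h ((\<lambda>p. (p, s)) ` ?L) * prod ?h ((\<lambda>p. (s, p)) ` ?G))"
    unfolding sq_vandermonde_def
  proof (simp only:)
    have "prod ?h (?A \<union> ((\<lambda>p. (p, s)) ` ?L \<union> (\<lambda>p. (s, p)) ` ?G)) = prod ?h ?A * prod ?h ((\<lambda>p. (p, s)) ` ?L \<union> (\<lambda>p. (s, p)) ` ?G)"
      by (rule prod.union_disjoint) (use assms fA in auto)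
    also have "prod ?h ((\<lambda>p. (p, s)) ` ?L \<union> (\<lambda>p. (s, p)) ` ?G) = prod ?h ((\<lambda>p. (p, s)) ` ?L) * prod ?h ((\<lambda>p. (s, p)) ` ?G)"
      by (rule prod.union_disjoint) (use assms in auto)
    finally show "prod ?h (?A \<union> ((\<lambda>p. (p, s)) ` ?L \<union> (\<lambda>p. (s, p)) ` ?G)) =
        prod ?h ?A * (prod ?h ((\<lambda>p. (p, s)) ` ?L) * prod ?h ((\<lambda>p. (s, p)) ` ?G))" .
  qed
  also have "prod ?h ((\<lambda>p. (p, s)) ` ?L) = (\<Prod>p\<in>?L. \<bar>(real s)\<^sup>2 - (real p)\<^sup>2\<bar>)"
    by (subst prod.reindex) (auto simp: inj_on_def power_mono intro!: prod.cong)
  also have "prod ?h ((\<lambda>p. (s, p)) ` ?G) = (\<Prod>p\<in>?G. \<bar>(real s)\<^sup>2 - (real p)\<^sup>2\<bar>)"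
    by (subst prod.reindex) (auto simp: inj_on_def power_mono intro!: prod.cong)
  also have "(\<Prod>p\<in>?L. \<bar>(real s)\<^sup>2 - (real p)\<^sup>2\<bar>) * (\<Prod>p\<in>?G. \<bar>(real s)\<^sup>2 - (real p)\<^sup>2\<bar>) =
     (\<Prod>p\<in>?L \<union> ?G. \<bar>(real s)\<^sup>2 - (real p)\<^sup>2\<bar>)"
    by (subst prod.union_disjoint) (use assms in auto)
  also have "?L \<union> ?G = P"
  proof -
    have "p < s \<or> s < p" if "p \<in> P" for p using that assms(2) by (cases p s rule: linorder_cases) auto
    thus ?thesis by blast
  qed
  finally show ?thesis by (simp add: sq_vandermonde_def)
qed

text \<open>The absolute values are there because elements of \<open>S\<close> may lie on both sides
  of an element of \<open>P\<close>. The cross factor is multiplicative in \<open>P\<close>, which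
  is what later allows the dents of the two halves to be merged.\<close>

lemma sq_vandermonde_union:
  assumes "finite P" "finite S" "P \<inter> S = {}"
  shows "sq_vandermonde (P \<union> S) = sq_vandermonde P * sq_vandermonde S * (\<Prod>s\<in>S. \<Prod>p\<in>P. \<bar>(real s)\<^sup>2 - (real p)\<^sup>2\<bar>)"
  using assms(2,3)
proof (induction S)
  case (insert s S)
  have "sq_vandermonde (P \<union> insert s S) = sq_vandermonde (insert s (P \<union> S))" by simp
  also have "\<dots> = sq_vandermonde (P \<union> S) * (\<Prod>p\<in>P \<union> S. \<bar>(real s)\<^sup>2 - (real p)\<^sup>2\<bar>)"
    by (rule sq_vandermonde_insert) (use insert assms(1) in auto)
  also have "(\<Prod>p\<in>P \<union> S. \<bar>(real s)\<^sup>2 - (real p)\<^sup>2\<bar>) =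
     (\<Prod>p\<in>P. \<bar>(real s)\<^sup>2 - (real p)\<^sup>2\<bar>) * (\<Prod>p\<in>S. \<bar>(real s)\<^sup>2 - (real p)\<^sup>2\<bar>)"
    by (rule prod.union_disjoint) (use insert assms(1) in auto)
  finally show ?case using insert by (simp add: sq_vandermonde_insert)
qed simp

text \<open>The nodes are left free for three uses: the squares of \<open>k\<close> for the
  trapezoid, and in the Selberg sum the squares of the points counted from the left end and from the
  right end of the interval.\<close>

lemma det_sq_newton:
  assumes "finite S" "card S = n"
  shows "det (mat n n (\<lambda>(i, j). \<Prod>k<j. (real (enum_set S i))\<^sup>2 - c k)) = sq_vandermonde S"
  using det_newton_basis[of n "\<lambda>i. (real (enum_set S i))\<^sup>2" c] sq_vandermonde_enum[OF assms] by simp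

lemma hyperfac2_double: "hyperfac2 (2 * e) = (\<Prod>j<e. fact (2 * j))"
  unfolding hyperfac2_def
  by (rule prod.reindex_bij_witness[of _ "\<lambda>j. e - j" "\<lambda>i. e - i"]) (auto simp: diff_mult_distrib2)

text \<open>Up to the factor \<open>1 / fact (2 * j)\<close> of its column,
  \<open>even_cfp j\<close> is a Newton polynomial in the squared variable. The column factors
  together make \<open>hyperfac2 (2 * e)\<close>.\<close>

lemma brick_sum_dented_trapezoid':
  assumes "P \<subseteq> {..<N}" "card P = e"
  shows "brick_sum (trapezoid N e - base_dents P) = sq_vandermonde P / hyperfac2 (2 * e)"
proof -
  have fP: "finite P" using assms(1) finite_subset by blast
  have "brick_sum (trapezoid N e - base_dents P) =
    det (mat e e (\<lambda>(i, j). 1 * (1 / fact (2 * j)) * (\<Prod>k<j. (real (enum_set P i))\<^sup>2 - (real k)\<^sup>2)))"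
    unfolding brick_sum_dented_trapezoid[OF assms] even_cfp_def by (simp add: mult.commute)
  also have "\<dots> = (\<Prod>i<e. 1) * (\<Prod>j<e. 1 / fact (2 * j)) *
      det (mat e e (\<lambda>(i, j). \<Prod>k<j. (real (enum_set P i))\<^sup>2 - (real k)\<^sup>2))"
    by (rule det_scale_rows_cols)
  also have "\<dots> = sq_vandermonde P / hyperfac2 (2 * e)"
    unfolding det_sq_newton[OF fP assms(2)] hyperfac2_double by (simp add: prod_dividef)
  finally show ?thesis .
qed

section \<open>A discrete Selberg sum\<close>

lemma sum_maps_onto_eq_sum_permutations:
  fixes h :: "(nat \<Rightarrow> nat) \<Rightarrow> real"
  assumes "finite S" "card S = n"
    and "\<And>x y. (\<And>i. i < n \<Longrightarrow> x i = y i) \<Longrightarrow> h x = h y"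
  shows "(\<Sum>x | x \<in> {..<n} \<rightarrow>\<^sub>E S \<and> inj_on x {..<n}. h x) =
    (\<Sum>\<sigma> | \<sigma> permutes {0..<n}. h (\<lambda>i. enum_set S (\<sigma> i)))"
proof (rule sum.reindex_bij_witness[of _
    "\<lambda>\<sigma>. restrict (\<lambda>i. enum_set S (\<sigma> i)) {..<n}"
    "\<lambda>x i. if i < n then inv_into {..<n} (enum_set S) (x i) else i"])
  have inj: "inj_on (enum_set S) {..<n}" using inj_on_enum_set[of S] assms by simp
  have img: "enum_set S ` {..<n} = S" using enum_set_image[OF assms(1)] assms(2) by simp
  {
    fix x assume "x \<in> {x. x \<in> {..<n} \<rightarrow>\<^sub>E S \<and> inj_on x {..<n}}"
    hence x: "x \<in> {..<n} \<rightarrow>\<^sub>E S" "inj_on x {..<n}" by auto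
    let ?\<sigma> = "\<lambda>i. if i < n then inv_into {..<n} (enum_set S) (x i) else i"
    have xS: "x i \<in> S" if "i < n" for i using x(1) that by auto
    have E: "enum_set S (?\<sigma> i) = x i" if "i < n" for i
      using f_inv_into_f[of "x i" "enum_set S" "{..<n}"] xS[OF that] img that by simp
    show "restrict (\<lambda>i. enum_set S (?\<sigma> i)) {..<n} = x"
    proof
      fix i show "restrict (\<lambda>i. enum_set S (?\<sigma> i)) {..<n} i = x i"
        using E[of i] x(1) by (cases "i < n") (auto simp: PiE_def extensional_def)
    qed
    show "?\<sigma> \<in> {\<sigma>. \<sigma> permutes {0..<n}}"
    proof (rule CollectI, rule bij_imp_permutes)
      have "?\<sigma> i \<in> {..<n}" if "i < n" for i
        using inv_into_into[of "x i" "enum_set S" "{..<n}"] xS[OF that] img that by simp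
      hence sub: "?\<sigma> ` {0..<n} \<subseteq> {0..<n}" by force
      have "inj_on ?\<sigma> {0..<n}"
      proof (rule inj_onI)
        fix i j assume ij: "i \<in> {0..<n}" "j \<in> {0..<n}" "?\<sigma> i = ?\<sigma> j"
        hence "x i = x j" using E[of i] E[of j] by simp
        thus "i = j" using x(2) ij by (auto simp: inj_on_def)
      qed
      thus "bij_betw ?\<sigma> {0..<n} {0..<n}"
        unfolding bij_betw_def using endo_inj_surj[OF _ sub] by simp
      show "?\<sigma> i = i" if "i \<notin> {0..<n}" for i using that by simp
    qed
    show "h (\<lambda>i. enum_set S (?\<sigma> i)) = h x" by (rule assms(3)) (rule E)
  next
    fix \<sigma> assume "\<sigma> \<in> {\<sigma>. \<sigma> permutes {0..<n}}"
    hence p: "\<sigma> permutes {0..<n}" by simp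
    have pin: "\<sigma> i < n" if "i < n" for i using permutes_in_image[OF p, of i] that by simp
    show "(\<lambda>i. if i < n then inv_into {..<n} (enum_set S) (restrict (\<lambda>i. enum_set S (\<sigma> i)) {..<n} i) else i) = \<sigma>"
    proof
      fix i
      show "(if i < n then inv_into {..<n} (enum_set S) (restrict (\<lambda>i. enum_set S (\<sigma> i)) {..<n} i) else i) = \<sigma> i"
        using inv_into_f_f[OF inj, of "\<sigma> i"] pin[of i] permutes_not_in[OF p, of i] by simp
    qed
    have "inj_on (\<lambda>i. enum_set S (\<sigma> i)) {..<n}"
    proof (rule inj_onI)
      fix i j assume ij: "i \<in> {..<n}" "j \<in> {..<n}" "enum_set S (\<sigma> i) = enum_set S (\<sigma> j)"
      have "\<sigma> i = \<sigma> j" by (rule inj_onD[OF inj ij(3)]) (use ij pin in auto)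
      thus "i = j" by (rule injD[OF permutes_inj[OF p]])
    qed
    thus "restrict (\<lambda>i. enum_set S (\<sigma> i)) {..<n} \<in> {x. x \<in> {..<n} \<rightarrow>\<^sub>E S \<and> inj_on x {..<n}}"
      using pin enum_set_mem[OF assms(1)] assms(2) by (auto simp: inj_on_def)
  }
qed

text \<open>The determinant on the right is expanded over all maps from \<open>{..<n}\<close> to
  \<open>A\<close>. Maps that are not injective give two equal rows. The injective ones are grouped
  by their image \<open>S\<close>, and summing over the orderings of \<open>S\<close> assembles the
  determinant of \<open>f\<close>, while the sign comes from permuting the rows of the determinant
  of \<open>g\<close>.\<close>

lemma andreief:
  fixes A :: "nat set" and f g :: "nat \<Rightarrow> nat \<Rightarrow> real"
  assumes fin: "finite A"
  shows "(\<Sum>S | S \<subseteq> A \<and> card S = n. (\<Prod>s\<in>S. w s) *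
      (det (mat n n (\<lambda>(i, j). f j (enum_set S i))) * det (mat n n (\<lambda>(i, j). g j (enum_set S i))))) =
    det (mat n n (\<lambda>(i, j). \<Sum>u\<in>A. w u * (f i u * g j u)))"
proof -
  let ?h = "\<lambda>x. (\<Prod>i<n. w (x i)) * ((\<Prod>i<n. f i (x i)) * det (mat n n (\<lambda>(i, j). g j (x i))))"
  have h: "(\<Prod>i<n. w (x i)) * det (mat n n (\<lambda>(i, j). f i (x i) * g j (x i))) = ?h x" for x
    using det_scale_rows_cols[of n "\<lambda>i. f i (x i)" "\<lambda>_. 1" "\<lambda>i j. g j (x i)"] by simp
  have h0: "?h x = 0" if ninj: "\<not> inj_on x {..<n}" for x
  proof -
    obtain i j where "i \<in> {..<n}" "j \<in> {..<n}" "i \<noteq> j" "x i = x j" using ninj unfolding inj_on_def by blast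
    hence "det (mat n n (\<lambda>(i, j). g j (x i))) = 0"
      by (intro det_identical_rows[of _ n i j]) auto
    thus ?thesis by simp
  qed
  let ?X = "\<lambda>S. {x. x \<in> {..<n} \<rightarrow>\<^sub>E S \<and> inj_on x {..<n}}"
  have finX: "finite (?X A)" by (rule finite_subset[of _ "{..<n} \<rightarrow>\<^sub>E A"]) (auto intro!: finite_PiE fin)
  have "det (mat n n (\<lambda>(i, j). \<Sum>u\<in>A. w u * (f i u * g j u))) = (\<Sum>x\<in>{..<n} \<rightarrow>\<^sub>E A. ?h x)"
    by (subst det_sum_PiE[symmetric]) (simp_all add: fin h)
  also have "\<dots> = (\<Sum>x\<in>?X A. ?h x)"
    by (rule sum.mono_neutral_right) (use fin h0 in \<open>auto intro!: finite_PiE\<close>)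
  also have "\<dots> = (\<Sum>S | S \<subseteq> A \<and> card S = n. \<Sum>x | x \<in> ?X A \<and> x ` {..<n} = S. ?h x)"
  proof (rule sum.group[symmetric, OF finX])
    show "finite {S. S \<subseteq> A \<and> card S = n}" by (rule finite_subset[of _ "Pow A"]) (use fin in auto)
    show "(\<lambda>x. x ` {..<n}) ` ?X A \<subseteq> {S. S \<subseteq> A \<and> card S = n}"
    proof (rule image_subsetI)
      fix x assume "x \<in> ?X A"
      hence x: "x \<in> {..<n} \<rightarrow>\<^sub>E A" "inj_on x {..<n}" by simp_all
      have "x ` {..<n} \<subseteq> A" by (rule image_subsetI) (rule PiE_mem[OF x(1)])
      thus "x ` {..<n} \<in> {S. S \<subseteq> A \<and> card S = n}" by (simp add: card_image[OF x(2)])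
    qed
  qed
  also have "\<dots> = (\<Sum>S | S \<subseteq> A \<and> card S = n. (\<Prod>s\<in>S. w s) *
      (det (mat n n (\<lambda>(i, j). f j (enum_set S i))) * det (mat n n (\<lambda>(i, j). g j (enum_set S i)))))"
  proof (rule sum.cong[OF refl])
    fix S assume "S \<in> {S. S \<subseteq> A \<and> card S = n}"
    hence S: "S \<subseteq> A" "card S = n" by simp_all
    have fS: "finite S" by (rule finite_subset[OF S(1) fin])
    have "{x. x \<in> ?X A \<and> x ` {..<n} = S} = ?X S"
    proof (intro equalityI subsetI)
      fix x assume "x \<in> {x. x \<in> ?X A \<and> x ` {..<n} = S}"
      hence x: "x \<in> {..<n} \<rightarrow>\<^sub>E A" "inj_on x {..<n}" "x ` {..<n} = S" by simp_all
      have "x \<in> {..<n} \<rightarrow>\<^sub>E S"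
        by (rule PiE_I) (use x(3) PiE_arb[OF x(1)] in auto)
      with x(2) show "x \<in> ?X S" by simp
    next
      fix x assume "x \<in> ?X S"
      hence x: "x \<in> {..<n} \<rightarrow>\<^sub>E S" "inj_on x {..<n}" by simp_all
      have "x ` {..<n} \<subseteq> S" by (rule image_subsetI) (rule PiE_mem[OF x(1)])
      moreover have "card (x ` {..<n}) = card S" using S(2) by (simp add: card_image[OF x(2)])
      ultimately have "x ` {..<n} = S" by (rule card_subset_eq[OF fS])
      moreover have "x \<in> {..<n} \<rightarrow>\<^sub>E A"
        by (rule PiE_I) (use S(1) PiE_mem[OF x(1)] PiE_arb[OF x(1)] in auto)
      ultimately show "x \<in> {x. x \<in> ?X A \<and> x ` {..<n} = S}" using x(2) by simp
    qed
    hence "(\<Sum>x | x \<in> ?X A \<and> x ` {..<n} = S. ?h x) = (\<Sum>x\<in>?X S. ?h x)" by simp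
    also have "\<dots> = (\<Sum>\<sigma> | \<sigma> permutes {0..<n}. ?h (\<lambda>i. enum_set S (\<sigma> i)))"
    proof (rule sum_maps_onto_eq_sum_permutations[OF fS S(2)])
      fix x y :: "nat \<Rightarrow> nat" assume xy: "\<And>i. i < n \<Longrightarrow> x i = y i"
      have "mat n n (\<lambda>(i, j). g j (x i)) = mat n n (\<lambda>(i, j). g j (y i))"
        by (rule eq_matI) (auto simp: xy)
      thus "?h x = ?h y" using xy by simp
    qed
    also have "\<dots> = (\<Sum>\<sigma> | \<sigma> permutes {0..<n}. (\<Prod>s\<in>S. w s) *
        ((signof \<sigma> * (\<Prod>i<n. f i (enum_set S (\<sigma> i)))) * det (mat n n (\<lambda>(i, j). g j (enum_set S i)))))"
    proof (rule sum.cong[OF refl])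
      fix \<sigma> assume "\<sigma> \<in> {\<sigma>. \<sigma> permutes {0..<n}}"
      hence p: "\<sigma> permutes {0..<n}" by simp
      have pin: "\<sigma> i < n" if "i < n" for i using permutes_in_image[OF p, of i] that by simp
      have "(\<Prod>i<n. w (enum_set S (\<sigma> i))) = (\<Prod>i<n. w (enum_set S i))"
        using prod.permute[OF p, of "\<lambda>i. w (enum_set S i)"] by (simp add: atLeast0LessThan o_def)
      also have "\<dots> = (\<Prod>s\<in>S. w s)"
        using prod.reindex[OF inj_on_enum_set[of S], of w] enum_set_image[OF fS] S(2) by simp
      finally have 1: "(\<Prod>i<n. w (enum_set S (\<sigma> i))) = (\<Prod>s\<in>S. w s)" .
      have "mat n n (\<lambda>(i, j). g j (enum_set S (\<sigma> i))) =
         mat n n (\<lambda>(i, j). mat n n (\<lambda>(i, j). g j (enum_set S i)) $$ (\<sigma> i, j))"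
        by (rule eq_matI) (auto simp: pin)
      hence 2: "det (mat n n (\<lambda>(i, j). g j (enum_set S (\<sigma> i)))) =
          signof \<sigma> * det (mat n n (\<lambda>(i, j). g j (enum_set S i)))"
        by (simp only:) (rule det_permute_rows[OF _ p], simp)
      show "?h (\<lambda>i. enum_set S (\<sigma> i)) = (\<Prod>s\<in>S. w s) *
        ((signof \<sigma> * (\<Prod>i<n. f i (enum_set S (\<sigma> i)))) * det (mat n n (\<lambda>(i, j). g j (enum_set S i))))"
        by (simp add: 1 2)
    qed
    also have "\<dots> = (\<Prod>s\<in>S. w s) * ((\<Sum>\<sigma> | \<sigma> permutes {0..<n}. signof \<sigma> * (\<Prod>i<n. f i (enum_set S (\<sigma> i)))) *
        det (mat n n (\<lambda>(i, j). g j (enum_set S i))))"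
      by (simp only: sum_distrib_left sum_distrib_right)
    also have "(\<Sum>\<sigma> | \<sigma> permutes {0..<n}. signof \<sigma> * (\<Prod>i<n. f i (enum_set S (\<sigma> i)))) =
        det (mat n n (\<lambda>(i, j). f j (enum_set S i)))"
      by (subst det_col[of _ n])
         (auto intro!: sum.cong prod.cong simp: atLeast0LessThan dest: permutes_in_image)
    finally show "(\<Sum>x | x \<in> ?X A \<and> x ` {..<n} = S. ?h x) = (\<Prod>s\<in>S. w s) *
      (det (mat n n (\<lambda>(i, j). f j (enum_set S i))) * det (mat n n (\<lambda>(i, j). g j (enum_set S i))))" .
  qed
  finally show ?thesis ..
qed

section \<open>Alternating binomial sums: up to sign, iterated differences at 0\<close>

definition alt_binomial_sum :: "nat \<Rightarrow> (nat \<Rightarrow> real) \<Rightarrow> real" where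
  "alt_binomial_sum n f = (\<Sum>k\<le>n. (- 1) ^ k * real (n choose k) * f k)"

lemma alt_binomial_sum_add:
  "alt_binomial_sum n (\<lambda>k. f k + g k) = alt_binomial_sum n f + alt_binomial_sum n g"
  by (simp add: alt_binomial_sum_def distrib_left sum.distrib)

lemma alt_binomial_sum_mult:
  "alt_binomial_sum n (\<lambda>k. c * f k) = c * alt_binomial_sum n f"
  by (simp add: alt_binomial_sum_def sum_distrib_left mult_ac)

lemma alt_binomial_sum_Suc:
  "alt_binomial_sum (Suc n) f = alt_binomial_sum n f - alt_binomial_sum n (\<lambda>k. f (Suc k))"
proof -
  have "alt_binomial_sum (Suc n) f =
      f 0 + (\<Sum>k\<le>n. (- 1) ^ Suc k * real (Suc n choose Suc k) * f (Suc k))"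
    unfolding alt_binomial_sum_def by (subst sum.atMost_Suc_shift) simp
  also have "(\<Sum>k\<le>n. (- 1) ^ Suc k * real (Suc n choose Suc k) * f (Suc k)) =
      (\<Sum>k\<le>n. (- 1) ^ Suc k * real (n choose Suc k) * f (Suc k)) - alt_binomial_sum n (\<lambda>k. f (Suc k))"
    unfolding alt_binomial_sum_def sum_subtractf[symmetric]
    by (rule sum.cong) (auto simp: algebra_simps)
  also have "f 0 + ((\<Sum>k\<le>n. (- 1) ^ Suc k * real (n choose Suc k) * f (Suc k)) - alt_binomial_sum n (\<lambda>k. f (Suc k)))
    = (\<Sum>k\<le>Suc n. (- 1) ^ k * real (n choose k) * f k) - alt_binomial_sum n (\<lambda>k. f (Suc k))"
    by (subst sum.atMost_Suc_shift) simp
  also have "(\<Sum>k\<le>Suc n. (- 1) ^ k * real (n choose k) * f k) = alt_binomial_sum n f"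
    by (simp add: alt_binomial_sum_def)
  finally show ?thesis .
qed

lemma alt_binomial_sum_times:
  "alt_binomial_sum (Suc n) (\<lambda>k. real k * f k) = - real (Suc n) * alt_binomial_sum n (\<lambda>k. f (Suc k))"
proof -
  have "alt_binomial_sum (Suc n) (\<lambda>k. real k * f k) =
     (\<Sum>k\<le>n. (- 1) ^ Suc k * real (Suc n choose Suc k) * (real (Suc k) * f (Suc k)))"
    unfolding alt_binomial_sum_def by (subst sum.atMost_Suc_shift) simp
  also have "\<dots> = - real (Suc n) * alt_binomial_sum n (\<lambda>k. f (Suc k))"
    unfolding alt_binomial_sum_def sum_distrib_left
  proof (rule sum.cong[OF refl])
    fix k
    have "real (Suc n choose Suc k) * real (Suc k) = real (Suc n) * real (n choose k)"
      using Suc_times_binomial_eq[of n k] by (metis of_nat_mult)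
    thus "(- 1) ^ Suc k * real (Suc n choose Suc k) * (real (Suc k) * f (Suc k)) =
      - real (Suc n) * ((- 1) ^ k * real (n choose k) * f (Suc k))"
      by (simp only: power_Suc mult_minus_left mult_minus1 mult.assoc[symmetric])
         (simp only: mult.assoc, simp only: mult_ac)
  qed
  finally show ?thesis .
qed

text \<open>An \<open>n\<close>-th difference kills polynomials of degree less than
  \<open>n\<close>. The induction peels off one linear factor \<open>real k + c m\<close> and treats
  its two summands separately.\<close>

lemma alt_binomial_sum_prod_linear:
  "m < n \<Longrightarrow> alt_binomial_sum n (\<lambda>k. \<Prod>l<m. real k + c l) = 0"
proof (induction m arbitrary: n c)
  case 0
  thus ?case using choose_alternating_sum[of n, where 'a = real] by (simp add: alt_binomial_sum_def)
next
  case (Suc m)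
  then obtain n' where n: "n = Suc n'" "m < n'" by (cases n) auto
  have "alt_binomial_sum n (\<lambda>k. \<Prod>l<Suc m. real k + c l) =
     alt_binomial_sum n (\<lambda>k. real k * (\<Prod>l<m. real k + c l) + c m * (\<Prod>l<m. real k + c l))"
    by (simp add: algebra_simps)
  also have "\<dots> = - real n * alt_binomial_sum n' (\<lambda>k. \<Prod>l<m. real (Suc k) + c l) + c m * alt_binomial_sum n (\<lambda>k. \<Prod>l<m. real k + c l)"
    by (simp only: alt_binomial_sum_add alt_binomial_sum_mult n(1) alt_binomial_sum_times)
  also have "(\<lambda>k. \<Prod>l<m. real (Suc k) + c l) = (\<lambda>k. \<Prod>l<m. real k + (1 + c l))"
    by (simp add: algebra_simps)
  finally show ?case using Suc.IH[OF n(2), of "\<lambda>l. 1 + c l"] Suc.IH[of n c] Suc.prems by simp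
qed

lemma alt_binomial_sum_inverse:
  "z > 0 \<Longrightarrow> alt_binomial_sum n (\<lambda>k. 1 / (z + real k)) = fact n / pochhammer z (Suc n)"
proof (induction n arbitrary: z)
  case 0
  thus ?case by (simp add: alt_binomial_sum_def)
next
  case (Suc n)
  define P where "P = pochhammer (z + 1) n"
  have P: "P > 0" unfolding P_def using Suc.prems by (intro pochhammer_pos) simp
  have 1: "pochhammer z (Suc n) = z * P" by (simp add: pochhammer_rec P_def)
  have 2: "pochhammer (z + 1) (Suc n) = P * (z + 1 + real n)" by (simp add: pochhammer_Suc P_def)
  have 3: "pochhammer z (Suc (Suc n)) = z * (P * (z + 1 + real n))" by (simp add: pochhammer_rec[of z "Suc n"] 2)
  have "alt_binomial_sum (Suc n) (\<lambda>k. 1 / (z + real k)) =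
      alt_binomial_sum n (\<lambda>k. 1 / (z + real k)) - alt_binomial_sum n (\<lambda>k. 1 / (z + 1 + real k))"
    by (simp add: alt_binomial_sum_Suc add.assoc)
  also have "\<dots> = fact n / (z * P) - fact n / (P * (z + 1 + real n))"
    using Suc.IH[of z] Suc.IH[of "z + 1"] Suc.prems by (simp only: 1 2)
  also have "\<dots> = fact (Suc n) / (z * (P * (z + 1 + real n)))"
  proof -
    define y where "y = z + 1 + real n"
    have y: "y > 0" "y - z = real n + 1" using Suc.prems by (simp_all add: y_def)
    have "fact n / (z * P) - fact n / (P * y) = (y - z) * fact n / (z * (P * y))"
      using P Suc.prems y(1) by (simp add: field_simps)
    thus ?thesis unfolding y(2) y_def by (simp add: add.commute)
  qed
  finally show ?case by (simp only: 3)
qed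

text \<open>Division of the numerator, a polynomial of degree \<open>n\<close> in \<open>k\<close>,
  by \<open>z + real k\<close> leaves a polynomial of lower degree, which is killed, and the
  remainder \<open>pochhammer (\<alpha> - z) n\<close>, the value at \<open>k = - z\<close>. Only
  the sum of the reciprocals survives.\<close>

lemma alt_binomial_sum_pochhammer_quotient:
  assumes "z > 0"
  shows "alt_binomial_sum n (\<lambda>k. pochhammer (\<alpha> + real k) n / (z + real k)) =
    pochhammer (\<alpha> - z) n * fact n / pochhammer z (Suc n)"
proof -
  have "alt_binomial_sum n (\<lambda>k. (\<Prod>l<m. real k + (\<alpha> + real l)) / (z + real k)) =
      (\<Prod>l<m. \<alpha> - z + real l) * alt_binomial_sum n (\<lambda>k. 1 / (z + real k))" if "m \<le> n" for m
    using that
  proof (induction m)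
    case (Suc m)
    have "(\<lambda>k. (\<Prod>l<Suc m. real k + (\<alpha> + real l)) / (z + real k)) =
      (\<lambda>k. (\<Prod>l<m. real k + (\<alpha> + real l)) + (\<alpha> - z + real m) * ((\<Prod>l<m. real k + (\<alpha> + real l)) / (z + real k)))"
    proof
      fix k
      have "z + real k \<noteq> 0" using assms by (simp add: add_pos_nonneg less_imp_neq[symmetric])
      thus "(\<Prod>l<Suc m. real k + (\<alpha> + real l)) / (z + real k) =
        (\<Prod>l<m. real k + (\<alpha> + real l)) + (\<alpha> - z + real m) * ((\<Prod>l<m. real k + (\<alpha> + real l)) / (z + real k))"
        by (simp add: field_simps)
    qed
    thus ?case using Suc alt_binomial_sum_prod_linear[of m n "\<lambda>l. \<alpha> + real l"]
      by (simp only: alt_binomial_sum_add alt_binomial_sum_mult) simp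
  qed simp
  from this[of n] show ?thesis
    by (simp add: alt_binomial_sum_inverse[OF assms] pochhammer_prod atLeast0LessThan add_ac)
qed

text \<open>For \<open>0 < \<alpha> < \<beta>\<close> the entries are the moments of a beta
  distribution. The orthogonal polynomials are then Jacobi polynomials on the unit interval, and the
  factors of the product are their squared norms. The application has \<open>\<alpha> = - X\<close>,
  where no such positive measure is at hand, so the argument is purely algebraic.\<close>

lemma det_hankel_pochhammer:
  fixes \<alpha> \<beta> :: real
  assumes "\<beta> > 1"
  shows "det (mat n n (\<lambda>(i, j). pochhammer \<alpha> (i + j) / pochhammer \<beta> (i + j))) =
    (\<Prod>i<n. fact i * pochhammer \<alpha> i * pochhammer (\<beta> - \<alpha>) i / (pochhammer \<beta> (2 * i) * pochhammer (\<beta> + real i - 1) i))"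
proof -
  let ?l = "\<lambda>i k. (- 1) ^ (i + k) * real (i choose k) * (pochhammer (\<alpha> + real k) (i - k) / pochhammer (\<beta> + real i - 1 + real k) (i - k))"
  let ?m = "\<lambda>k. pochhammer \<alpha> k / pochhammer \<beta> k"
  let ?h = "\<lambda>i. fact i * pochhammer \<alpha> i * pochhammer (\<beta> - \<alpha>) i / (pochhammer \<beta> (2 * i) * pochhammer (\<beta> + real i - 1) i)"
  \<comment> \<open>\<open>?L\<close> holds the coefficients of the monic orthogonal polynomials, so \<open>?L * ?M\<close> is upper triangular.\<close>
  let ?L = "mat n n (\<lambda>(i, k). if k \<le> i then ?l i k else 0)" and ?M = "mat n n (\<lambda>(i, j). ?m (i + j))"
  have pos: "pochhammer (\<beta> + real u) v > 0" "pochhammer (\<beta> + real i - 1 + real u) v > 0" "pochhammer \<beta> v > 0" for u v i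
    using assms by (auto intro!: pochhammer_pos)
  have num: "pochhammer \<alpha> (k + j) * pochhammer (\<alpha> + real k) (i - k) = pochhammer \<alpha> i * pochhammer (\<alpha> + real k) j"
    if "k \<le> i" for i j k
    using pochhammer_product'[of \<alpha> k j] pochhammer_product'[of \<alpha> k "i - k"] that by simp
  have entry: "(?L * ?M) $$ (i, j) = (- 1) ^ i * alt_binomial_sum i (\<lambda>k.
      pochhammer \<alpha> i * pochhammer (\<alpha> + real k) j / (pochhammer \<beta> (k + j) * pochhammer (\<beta> + real i - 1 + real k) (i - k)))"
    if ij: "i < n" "j < n" for i j
  proof -
    have "(?L * ?M) $$ (i, j) = (\<Sum>k<n. (if k \<le> i then ?l i k else 0) * ?m (k + j))"
      using ij by (simp add: scalar_prod_def atLeast0LessThan)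
    also have "\<dots> = (\<Sum>k\<le>i. ?l i k * ?m (k + j))"
      by (rule sum.mono_neutral_cong_right) (use ij in auto)
    also have "\<dots> = (- 1) ^ i * alt_binomial_sum i (\<lambda>k.
      pochhammer \<alpha> i * pochhammer (\<alpha> + real k) j / (pochhammer \<beta> (k + j) * pochhammer (\<beta> + real i - 1 + real k) (i - k)))"
      unfolding alt_binomial_sum_def sum_distrib_left
    proof (rule sum.cong[OF refl])
      fix k assume "k \<in> {..i}"
      hence k: "k \<le> i" by simp
      show "?l i k * ?m (k + j) = (- 1) ^ i * ((- 1) ^ k * real (i choose k) *
        (pochhammer \<alpha> i * pochhammer (\<alpha> + real k) j / (pochhammer \<beta> (k + j) * pochhammer (\<beta> + real i - 1 + real k) (i - k))))"
        unfolding num[OF k, symmetric] by (simp add: power_add mult_ac)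
    qed
    finally show ?thesis .
  qed
  have cancel: "A * B / (C * D) = A / (C * D * F) * (B * F)" if "F \<noteq> 0" for A B C D F :: real
    using that by simp
  \<comment> \<open>The two denominators fill up \<open>pochhammer \<beta> (2 * i - 1)\<close>
    except for a gap of length \<open>i - 1 - j\<close>. Moved to the numerator, the gap makes the
    summand a polynomial in \<open>k\<close> of degree \<open>j + (i - 1 - j) = i - 1\<close>, which
    an \<open>i\<close>-th difference kills.\<close>
  have below: "(?L * ?M) $$ (i, j) = 0" if ij: "j < i" "i < n" for i j
  proof -
    let ?c = "\<lambda>l. if l < j then \<alpha> + real l else \<beta> + real l"
    have "pochhammer \<alpha> i * pochhammer (\<alpha> + real k) j / (pochhammer \<beta> (k + j) * pochhammer (\<beta> + real i - 1 + real k) (i - k))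
       = pochhammer \<alpha> i / pochhammer \<beta> (2 * i - 1) * (\<Prod>l<i - 1. real k + ?c l)" if k: "k \<le> i" for k
    proof -
      have 1: "pochhammer \<beta> (k + j) * pochhammer (\<beta> + real (k + j)) (i - 1 - j) = pochhammer \<beta> (k + i - 1)"
        using pochhammer_product'[of \<beta> "k + j" "i - 1 - j"] ij by (simp add: algebra_simps)
      have e: "\<beta> + real (k + i - 1) = \<beta> + real i - 1 + real k" using ij by (cases i) auto
      have 2: "pochhammer \<beta> (k + i - 1) * pochhammer (\<beta> + real i - 1 + real k) (i - k) = pochhammer \<beta> (2 * i - 1)"
        using pochhammer_product'[of \<beta> "k + i - 1" "i - k", unfolded e] ij k by (simp add: mult_2)
      have 3: "pochhammer (\<alpha> + real k) j * pochhammer (\<beta> + real (k + j)) (i - 1 - j) = (\<Prod>l<i - 1. real k + ?c l)"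
      proof -
        have "pochhammer (\<alpha> + real k) j = (\<Prod>l<j. real k + ?c l)"
          by (simp add: pochhammer_prod atLeast0LessThan add_ac)
        moreover have "pochhammer (\<beta> + real (k + j)) (i - 1 - j) = (\<Prod>l=j..<i - 1. real k + ?c l)"
          unfolding pochhammer_prod
          by (rule prod.reindex_bij_witness[of _ "\<lambda>l. l - j" "\<lambda>l. l + j"]) auto
        moreover have "{..<i - 1} = {..<j} \<union> {j..<i - 1}" using ij by auto
        ultimately show ?thesis by (simp only:) (rule prod.union_disjoint[symmetric]; force)
      qed
      have "pochhammer \<beta> (k + j) * pochhammer (\<beta> + real i - 1 + real k) (i - k) * pochhammer (\<beta> + real (k + j)) (i - 1 - j) = pochhammer \<beta> (2 * i - 1)"
        unfolding 2[symmetric] 1[symmetric] by (simp only: mult_ac)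
      moreover have "pochhammer (\<beta> + real (k + j)) (i - 1 - j) > 0" by (rule pos)
      ultimately show ?thesis unfolding 3[symmetric] by (metis cancel less_irrefl)
    qed
    hence "alt_binomial_sum i (\<lambda>k. pochhammer \<alpha> i * pochhammer (\<alpha> + real k) j / (pochhammer \<beta> (k + j) * pochhammer (\<beta> + real i - 1 + real k) (i - k)))
      = alt_binomial_sum i (\<lambda>k. pochhammer \<alpha> i / pochhammer \<beta> (2 * i - 1) * (\<Prod>l<i - 1. real k + ?c l))"
      unfolding alt_binomial_sum_def by (intro sum.cong refl) simp
    also have "\<dots> = 0"
      unfolding alt_binomial_sum_mult using ij by (subst alt_binomial_sum_prod_linear) auto
    finally show ?thesis using entry[of i j] ij by simp
  qed
  \<comment> \<open>For \<open>j = i\<close> there is an overlap instead of a gap: the factor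
    \<open>z + real k\<close> occurs twice, so once it stays in the denominator, and the summand is
    the quotient treated in \<open>alt_binomial_sum_pochhammer_quotient\<close>.\<close>
  have diag: "(?L * ?M) $$ (i, i) = ?h i" if i: "i < n" for i
  proof (cases i)
    case 0
    thus ?thesis using entry[of 0 0] i by (simp add: alt_binomial_sum_def)
  next
    case (Suc i')
    define z where "z = \<beta> + real i - 1"
    have z: "z > 0" using assms by (simp add: z_def)
    have "pochhammer \<alpha> i * pochhammer (\<alpha> + real k) i / (pochhammer \<beta> (k + i) * pochhammer (\<beta> + real i - 1 + real k) (i - k))
       = pochhammer \<alpha> i / pochhammer \<beta> (2 * i - 1) * (pochhammer (\<alpha> + real k) i / (z + real k))" if k: "k \<le> i" for k
    proof -
      have e: "\<beta> + real (k + i - 1) = z + real k" using Suc by (simp add: z_def)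
      have 2: "pochhammer \<beta> (k + i - 1) * pochhammer (z + real k) (i - k) = pochhammer \<beta> (2 * i - 1)"
        using pochhammer_product'[of \<beta> "k + i - 1" "i - k", unfolded e] Suc k by (simp add: mult_2)
      have 3: "pochhammer \<beta> (k + i) = pochhammer \<beta> (k + i - 1) * (z + real k)"
        using pochhammer_Suc[of \<beta> "k + i - 1"] Suc e by simp
      show ?thesis unfolding z_def[symmetric] 3 2[symmetric] by (simp add: mult_ac)
    qed
    hence "alt_binomial_sum i (\<lambda>k. pochhammer \<alpha> i * pochhammer (\<alpha> + real k) i / (pochhammer \<beta> (k + i) * pochhammer (\<beta> + real i - 1 + real k) (i - k)))
      = alt_binomial_sum i (\<lambda>k. pochhammer \<alpha> i / pochhammer \<beta> (2 * i - 1) * (pochhammer (\<alpha> + real k) i / (z + real k)))"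
      unfolding alt_binomial_sum_def by (intro sum.cong refl) simp
    also have "\<dots> = pochhammer \<alpha> i / pochhammer \<beta> (2 * i - 1) * (pochhammer (\<alpha> - z) i * fact i / pochhammer z (Suc i))"
      by (simp only: alt_binomial_sum_mult alt_binomial_sum_pochhammer_quotient[OF z])
    finally have "(?L * ?M) $$ (i, i) = (- 1) ^ i * (pochhammer \<alpha> i / pochhammer \<beta> (2 * i - 1) * (pochhammer (\<alpha> - z) i * fact i / pochhammer z (Suc i)))"
      using entry[OF i i] by simp
    moreover have "pochhammer (\<beta> - \<alpha>) i = (- 1) ^ i * pochhammer (\<alpha> - z) i"
    proof -
      have "pochhammer (\<alpha> - z) i = (- 1) ^ i * pochhammer (\<beta> - \<alpha>) i"
        using pochhammer_minus[of "z - \<alpha>" i] by (simp add: z_def algebra_simps)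
      thus ?thesis by (simp add: mult.assoc[symmetric] power_mult_distrib[symmetric])
    qed
    moreover have "pochhammer z (Suc i) = pochhammer z i * (\<beta> + real (2 * i - 1))"
    proof -
      have "z + real i = \<beta> + real (2 * i - 1)" using Suc by (simp add: z_def)
      thus ?thesis by (simp add: pochhammer_Suc)
    qed
    moreover have "pochhammer \<beta> (2 * i) = pochhammer \<beta> (2 * i - 1) * (\<beta> + real (2 * i - 1))"
      using pochhammer_Suc[of \<beta> "2 * i - 1"] Suc by simp
    ultimately show ?thesis unfolding z_def[symmetric] by (simp add: mult_ac)
  qed
  have "det ?L = 1"
    by (subst det_lower_triangular[of n]) (auto simp: prod_list_diag_mat mult_2[symmetric])
  hence "det ?M = det (?L * ?M)" by (simp add: det_mult[of _ n])
  also have "\<dots> = prod_list (diag_mat (?L * ?M))"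
    by (rule det_upper_triangular[of _ n]) (auto simp: below simp del: index_mult_mat(1))
  also have "diag_mat (?L * ?M) = diag_mat (mat n n (\<lambda>(i, j). ?h i))"
    unfolding diag_mat_def by (auto simp: diag simp del: index_mult_mat(1))
  also have "prod_list \<dots> = (\<Prod>i<n. ?h i)" by (simp add: prod_list_diag_mat)
  finally show ?thesis .
qed

text \<open>The weight of a crossing at \<open>s\<close> when the dents of both halves together fill
  \<open>{..<a}\<close> and \<open>{c..<c + B}\<close>. The differences are oriented so that all
  factors are positive for \<open>a \<le> s < c\<close>.\<close>

definition selberg_weight :: "nat \<Rightarrow> nat \<Rightarrow> nat \<Rightarrow> nat \<Rightarrow> real" where
  "selberg_weight a c B s = zigzag_factor s * (\<Prod>p<a. (real s)\<^sup>2 - (real p)\<^sup>2) * (\<Prod>p = c..<c + B. (real p)\<^sup>2 - (real s)\<^sup>2)"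

lemma selberg_weight_left:
  "selberg_weight (Suc a) c B s = selberg_weight a c B s * ((real s)\<^sup>2 - (real a)\<^sup>2)"
  by (simp add: selberg_weight_def)

lemma selberg_weight_right:
  "selberg_weight a c (Suc B) s = selberg_weight a (Suc c) B s * ((real c)\<^sup>2 - (real s)\<^sup>2)"
proof -
  have "{c..<c + Suc B} = insert c {Suc c..<Suc c + B}" by auto
  thus ?thesis by (simp add: selberg_weight_def)
qed

text \<open>For \<open>B = 0\<close> the product telescopes to a quotient of factorials. The point
  \<open>s = 0\<close> is set apart, as the factor 1/2 of the zigzag breaks the pattern
  there.\<close>

lemma selberg_weight_empty:
  assumes "a \<le> s" "s > 0"
  shows "fact (s - a) * selberg_weight a c 0 s = real s * fact (s + a - 1)"
  using assms
proof (induction a)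
  case 0
  thus ?case using fact_reduce[of s, where 'a = real] by (simp add: selberg_weight_def zigzag_factor_def)
next
  case (Suc a)
  have "fact (s - a) = real (s - a) * (fact (s - Suc a) :: real)"
    using Suc.prems fact_reduce[of "s - a", where 'a = real] by simp
  hence 1: "fact (s - Suc a) * real (s - a) = (fact (s - a) :: real)" by (simp only: mult.commute)
  have 2: "fact (s + a - 1) * real (s + a) = (fact (s + Suc a - 1) :: real)"
    using Suc.prems fact_reduce[of "s + a", where 'a = real] by (simp add: mult.commute)
  have sq: "(real s)\<^sup>2 - (real a)\<^sup>2 = real (s - a) * real (s + a)"
    using Suc.prems by (simp add: of_nat_diff power2_eq_square algebra_simps)
  have IH: "fact (s - a) * selberg_weight a c 0 s = real s * fact (s + a - 1)" using Suc by simp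
  have "fact (s - Suc a) * selberg_weight (Suc a) c 0 s =
      fact (s - Suc a) * real (s - a) * selberg_weight a c 0 s * real (s + a)"
    by (simp only: selberg_weight_left sq mult_ac)
  also have "\<dots> = real s * (fact (s + a - 1) * real (s + a))"
    by (simp only: 1 IH mult.assoc)
  finally show ?case by (simp only: 2)
qed

text \<open>The one-point sum; it is a very-well-poised series, evaluated here by induction on \<open>B\<close>.\<close>

lemma selberg_one:
  "(\<Sum>s\<in>{a..<a + 1 + x}. selberg_weight a (a + 1 + x) B s) =
    fact B * fact (2 * a + x + B) / (2 * fact x) *
    (pochhammer (real (a + x) + 1 / 2) (B + 1) / pochhammer (real a + 1 / 2) (B + 1))"
proof (induction B arbitrary: a x)
  case 0
  show ?case
  proof (induction x)
    case 0
    show ?case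
    \<comment> \<open>For \<open>a = 0\<close> the only point of the range is \<open>s = 0\<close>,
      whose weight is the 1/2 of the zigzag.\<close>
    proof (cases "a = 0")
      case True
      thus ?thesis by (simp add: selberg_weight_def zigzag_factor_def)
    next
      case False
      have w: "selberg_weight a (a + 1 + 0) 0 a = real a * fact (a + a - 1)"
        using selberg_weight_empty[of a a "a + 1"] False by simp
      have "fact (2 * a) = real (2 * a) * (fact (2 * a - 1) :: real)"
        using False by (intro fact_reduce) auto
      hence f: "fact (2 * a + 0 + 0) = 2 * (real a * (fact (a + a - 1) :: real))"
        by (simp only: mult_2 add_0_right) simp
      have i: "{a..<a + 1 + 0} = {a}" by auto
      have q: "pochhammer (real (a + 0) + 1 / 2) (0 + 1) / pochhammer (real a + 1 / 2) (0 + 1) = 1"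
      proof -
        have "real a + 1 / 2 \<noteq> 0" by linarith
        thus ?thesis by simp
      qed
      show ?thesis unfolding i f q by (simp only: sum.insert sum.empty finite.emptyI empty_iff not_False_eq_True w) simp
    qed
  next
    case (Suc x)
    have c: "selberg_weight a (a + 1 + Suc x) 0 = selberg_weight a (a + 1 + x) 0"
      by (rule ext) (simp add: selberg_weight_def)
    have i: "{a..<a + 1 + Suc x} = insert (a + 1 + x) {a..<a + 1 + x}" by auto
    have "(\<Sum>s\<in>{a..<a + 1 + Suc x}. selberg_weight a (a + 1 + Suc x) 0 s) =
      selberg_weight a (a + 1 + x) 0 (a + 1 + x) + (\<Sum>s\<in>{a..<a + 1 + x}. selberg_weight a (a + 1 + x) 0 s)"
      unfolding c i by (rule sum.insert) auto
    also have "selberg_weight a (a + 1 + x) 0 (a + 1 + x) = real (a + 1 + x) * fact (2 * a + x) / fact (Suc x)"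
    proof -
      have "fact (Suc x) * selberg_weight a (a + 1 + x) 0 (a + 1 + x) = real (a + 1 + x) * fact (2 * a + x)"
        using selberg_weight_empty[of a "a + 1 + x" "a + 1 + x"] by (simp add: mult_2 add_ac del: fact_Suc)
      moreover have "fact (Suc x) \<noteq> (0 :: real)" by (rule fact_nonzero)
      ultimately show ?thesis by (metis nonzero_mult_div_cancel_left)
    qed
    also note Suc.IH
    also have "real (a + 1 + x) * fact (2 * a + x) / fact (Suc x) + fact 0 * fact (2 * a + x + 0) / (2 * fact x) *
        (pochhammer (real (a + x) + 1 / 2) (0 + 1) / pochhammer (real a + 1 / 2) (0 + 1)) =
      fact 0 * fact (2 * a + Suc x + 0) / (2 * fact (Suc x)) *
        (pochhammer (real (a + Suc x) + 1 / 2) (0 + 1) / pochhammer (real a + 1 / 2) (0 + 1))"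
    proof -
      define g h where "g = real a + 1 / 2" and "h = real x + 1"
      define X A where "X = (fact x :: real)" and "A = (fact (2 * a + x) :: real)"
      have gh: "g > 0" "h > 0" by (simp_all add: g_def h_def)
      have X: "X > 0" by (simp add: X_def)
      have f: "fact (Suc x) = h * X" "fact (2 * a + Suc x + 0) = (2 * g + h - 1) * A"
        by (simp_all add: X_def A_def g_def h_def algebra_simps)
      have r: "real (a + 1 + x) = g + h - 1 / 2" "real (a + x) + 1 / 2 = g + h - 1" "real (a + Suc x) + 1 / 2 = g + h"
        by (simp_all add: g_def h_def)
      have core: "(g + h - 1 / 2) / h + (g + h - 1) / (2 * g) = (2 * g + h - 1) * (g + h) / (2 * g * h)"
        using gh by (simp add: divide_simps) (simp add: algebra_simps)
      have "(g + h - 1 / 2) * A / (h * X) + A / (2 * X) * ((g + h - 1) / g) =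
          A / X * ((g + h - 1 / 2) / h + (g + h - 1) / (2 * g))"
        by (simp add: distrib_left mult_ac)
      also have "\<dots> = (2 * g + h - 1) * A / (2 * (h * X)) * ((g + h) / g)"
        unfolding core by (simp add: mult_ac)
      finally show ?thesis unfolding f r g_def[symmetric]
        by (simp add: X_def[symmetric] A_def[symmetric])
    qed
    finally show ?case .
  qed
next
  case (Suc B)
  let ?c = "a + 1 + x"
  have "(\<Sum>s\<in>{a..<?c}. selberg_weight a ?c (Suc B) s) =
      (\<Sum>s\<in>{a..<a + 1 + Suc x}. selberg_weight a (a + 1 + Suc x) B s * ((real ?c)\<^sup>2 - (real s)\<^sup>2))"
    unfolding selberg_weight_right by simp
  \<comment> \<open>Writing \<open>c^2 - s^2\<close> as \<open>(c^2 - a^2) - (s^2 - a^2)\<close>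
    trades the additional node on the right for one on the left. The first part is the sum with
    \<open>B\<close>, \<open>a\<close> and \<open>Suc x\<close>, the second the sum with
    \<open>B\<close>, \<open>Suc a\<close> and \<open>x\<close>.\<close>
  also have "\<dots> = ((real ?c)\<^sup>2 - (real a)\<^sup>2) * (\<Sum>s\<in>{a..<a + 1 + Suc x}. selberg_weight a (a + 1 + Suc x) B s) -
      (\<Sum>s\<in>{a..<a + 1 + Suc x}. selberg_weight (Suc a) (a + 1 + Suc x) B s)"
    unfolding selberg_weight_left sum_distrib_left sum_subtractf[symmetric]
    by (rule sum.cong) (auto simp: algebra_simps)
  also have "(\<Sum>s\<in>{a..<a + 1 + Suc x}. selberg_weight (Suc a) (a + 1 + Suc x) B s) =
      (\<Sum>s\<in>{Suc a..<Suc a + 1 + x}. selberg_weight (Suc a) (Suc a + 1 + x) B s)"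
  proof -
    have "{a..<a + 1 + Suc x} = insert a {Suc a..<Suc a + 1 + x}" by auto
    moreover have "selberg_weight (Suc a) (a + 1 + Suc x) B a = 0" unfolding selberg_weight_left by simp
    ultimately show ?thesis by simp
  qed
  also note Suc.IH[of a "Suc x"]
  also note Suc.IH[of "Suc a" x]
  also have "((real ?c)\<^sup>2 - (real a)\<^sup>2) * (fact B * fact (2 * a + Suc x + B) / (2 * fact (Suc x)) *
      (pochhammer (real (a + Suc x) + 1 / 2) (B + 1) / pochhammer (real a + 1 / 2) (B + 1))) -
      fact B * fact (2 * Suc a + x + B) / (2 * fact x) *
      (pochhammer (real (Suc a + x) + 1 / 2) (B + 1) / pochhammer (real (Suc a) + 1 / 2) (B + 1)) =
     fact (Suc B) * fact (2 * a + x + Suc B) / (2 * fact x) *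
      (pochhammer (real (a + x) + 1 / 2) (Suc B + 1) / pochhammer (real a + 1 / 2) (Suc B + 1))"
  proof -
    define u where "u = real a + 1 / 2"
    define v where "v = real (a + x) + 1 / 2"
    define P Q X A F where "P = pochhammer (u + 1) B" and "Q = pochhammer (v + 1) (B + 1)"
      and "X = (fact x :: real)" and "A = (fact (2 * a + x + Suc B) :: real)" and "F = (fact B :: real)"
    have u: "u > 0" by (simp add: u_def)
    have P: "P > 0" unfolding P_def using u by (intro pochhammer_pos) simp
    have X: "X > 0" by (simp add: X_def)
    have v: "real (a + Suc x) + 1 / 2 = v + 1" "real (Suc a + x) + 1 / 2 = v + 1" by (simp_all add: v_def)
    have e1: "pochhammer u (B + 1) = u * P" by (simp add: P_def pochhammer_rec)
    have e2: "pochhammer (u + 1) (B + 1) = P * (u + 1 + real B)" by (simp add: P_def pochhammer_Suc)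
    have e3: "pochhammer u (Suc B + 1) = u * (P * (u + 1 + real B))"
      using e2 by (simp add: pochhammer_rec[of u "Suc B"])
    have e4: "pochhammer v (Suc B + 1) = v * Q" by (simp add: Q_def pochhammer_rec)
    have e5: "real (Suc a) + 1 / 2 = u + 1" by (simp add: u_def)
    have f1: "fact (2 * a + Suc x + B) = A" by (simp add: A_def)
    have f2: "fact (2 * Suc a + x + B) = (2 * real a + real x + real B + 2) * A" by (simp add: A_def algebra_simps)
    have f3: "fact (Suc x) = (real x + 1) * X" by (simp add: X_def)
    have f4: "fact (Suc B) = (real B + 1) * F" by (simp add: F_def)
    have sq: "(real ?c)\<^sup>2 - (real a)\<^sup>2 = (real x + 1) * (2 * real a + real x + 1)"
      by (simp add: power2_eq_square algebra_simps)
    define W where "W = F * A / (2 * X) * (Q / (u * (P * (u + 1 + real B))))"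
    have uB: "u + 1 + real B > 0" using u by simp
    have t1: "((real ?c)\<^sup>2 - (real a)\<^sup>2) * (F * A / (2 * ((real x + 1) * X)) * (Q / (u * P))) = W * ((2 * real a + real x + 1) * (u + 1 + real B))"
    proof -
      have "real x + 1 > 0" by simp
      thus ?thesis unfolding sq W_def using u P X uB by (simp add: divide_simps)
    qed
    have t2: "F * ((2 * real a + real x + real B + 2) * A) / (2 * X) * (Q / (P * (u + 1 + real B))) = W * ((2 * real a + real x + real B + 2) * u)"
      unfolding W_def using u P X uB by (simp add: divide_simps)
    have t3: "(real B + 1) * F * A / (2 * X) * (v * Q / (u * (P * (u + 1 + real B)))) = W * ((real B + 1) * v)"
      unfolding W_def using u P X uB by (simp add: divide_simps)
    \<comment> \<open>With the common factor \<open>W\<close> taken out, this polynomial identity is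
      all that remains of the induction step.\<close>
    have key: "(2 * real a + real x + 1) * (u + 1 + real B) - (2 * real a + real x + real B + 2) * u = (real B + 1) * v"
      unfolding u_def v_def by (simp add: field_simps)
    show ?thesis unfolding v f1 f2 f3 f4 e5 u_def[symmetric] v_def[symmetric] e1 e2 e3 e4
      Q_def[symmetric] X_def[symmetric] F_def[symmetric] A_def[symmetric] t1 t2 t3
      by (simp only: right_diff_distrib[symmetric] key)
  qed
  finally show ?case .
qed

text \<open>
  The Gram matrix is taken with a basis vanishing at the left end of the interval for the rows and
  one vanishing at the right end for the columns.  Both products are absorbed into the weight, so
  every entry is again a one-point sum.
\<close>

lemma selberg_weight_shift:
  assumes "j \<le> c"
  shows "selberg_weight (a + i) (c - j) (B + j) s = selberg_weight a c B s *
    ((\<Prod>k<i. (real s)\<^sup>2 - (real (a + k))\<^sup>2) * (\<Prod>k<j. (real (c - Suc k))\<^sup>2 - (real s)\<^sup>2))"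
proof -
  have 1: "selberg_weight a (c - j) (B + j) s = selberg_weight a c B s * (\<Prod>k<j. (real (c - Suc k))\<^sup>2 - (real s)\<^sup>2)"
    using assms
  proof (induction j)
    case (Suc j)
    have "Suc (c - Suc j) = c - j" using Suc.prems by simp
    thus ?case using Suc selberg_weight_right[of a "c - Suc j" "B + j" s] by simp
  qed simp
  have "selberg_weight (a + i) c' B' s = selberg_weight a c' B' s * (\<Prod>k<i. (real s)\<^sup>2 - (real (a + k))\<^sup>2)" for c' B'
    by (induction i) (simp_all add: selberg_weight_left)
  thus ?thesis by (simp add: 1 mult_ac)
qed

lemma selberg_gram:
  assumes c: "c = a + 1 + X" and j: "j \<le> c"
  shows "(\<Sum>s\<in>{a..<c}. selberg_weight a c B s *
      ((\<Prod>k<i. (real s)\<^sup>2 - (real (a + k))\<^sup>2) * (\<Prod>k<j. (real (c - Suc k))\<^sup>2 - (real s)\<^sup>2))) =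
    (if i + j \<le> X then fact (B + j) * fact (2 * a + B + X + i) / (2 * fact (X - (i + j))) *
      (pochhammer (real (a + X - j) + 1 / 2) (B + j + 1) / pochhammer (real (a + i) + 1 / 2) (B + j + 1)) else 0)"
proof -
  have "(\<Sum>s\<in>{a..<c}. selberg_weight a c B s *
      ((\<Prod>k<i. (real s)\<^sup>2 - (real (a + k))\<^sup>2) * (\<Prod>k<j. (real (c - Suc k))\<^sup>2 - (real s)\<^sup>2))) =
     (\<Sum>s\<in>{a + i..<c - j}. selberg_weight (a + i) (c - j) (B + j) s)"
  \<comment> \<open>The added products vanish at the first \<open>i\<close> and the last
    \<open>j\<close> points, so the sum shrinks to the interval to which \<open>selberg_one\<close>
    applies. That interval is empty when \<open>i + j > X\<close>, whence the case
    distinction.\<close>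
  proof (rule sum.mono_neutral_cong_right)
    show "\<forall>s\<in>{a..<c} - {a + i..<c - j}. selberg_weight a c B s *
      ((\<Prod>k<i. (real s)\<^sup>2 - (real (a + k))\<^sup>2) * (\<Prod>k<j. (real (c - Suc k))\<^sup>2 - (real s)\<^sup>2)) = 0"
    proof
      fix s assume s: "s \<in> {a..<c} - {a + i..<c - j}"
      show "selberg_weight a c B s *
      ((\<Prod>k<i. (real s)\<^sup>2 - (real (a + k))\<^sup>2) * (\<Prod>k<j. (real (c - Suc k))\<^sup>2 - (real s)\<^sup>2)) = 0"
      proof (cases "s < a + i")
        case True
        have "(\<Prod>k<i. (real s)\<^sup>2 - (real (a + k))\<^sup>2) = 0"
          by (rule prod_zero) (use s True in \<open>auto intro!: bexI[of _ "s - a"]\<close>)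
        thus ?thesis by simp
      next
        case False
        have "(\<Prod>k<j. (real (c - Suc k))\<^sup>2 - (real s)\<^sup>2) = 0"
          by (rule prod_zero) (use s False in \<open>auto intro!: bexI[of _ "c - Suc s"]\<close>)
        thus ?thesis by simp
      qed
    qed
  qed (auto simp: selberg_weight_shift[OF j])
  also have "\<dots> = (if i + j \<le> X then fact (B + j) * fact (2 * a + B + X + i) / (2 * fact (X - (i + j))) *
      (pochhammer (real (a + X - j) + 1 / 2) (B + j + 1) / pochhammer (real (a + i) + 1 / 2) (B + j + 1)) else 0)"
  proof (cases "i + j \<le> X")
    case True
    have cj: "c - j = a + i + 1 + (X - (i + j))" using True c by simp
    have e: "a + i + (X - (i + j)) = a + X - j" "2 * (a + i) + (X - (i + j)) + (B + j) = 2 * a + B + X + i"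
      using True by simp_all
    show ?thesis unfolding cj selberg_one e using True by simp
  next
    case False
    hence "{a + i..<c - j} = {}" using c by auto
    thus ?thesis using False by simp
  qed
  finally show ?thesis .
qed

text \<open>This puts the Gram matrix into Hankel form: the entry
  \<open>1 / fact (X - (i + j))\<close>, replaced by 0 when \<open>i + j > X\<close>, is up to sign
  and \<open>fact X\<close> the symbol \<open>pochhammer (- real X) (i + j)\<close>.\<close>

lemma pochhammer_neg_nat:
  "n \<le> X \<Longrightarrow> pochhammer (- real X) n = (- 1) ^ n * (fact X / fact (X - n))"
proof -
  assume n: "n \<le> X"
  have "pochhammer (- real X) n = (- 1) ^ n * pochhammer (real X - real n + 1) n"
    by (rule pochhammer_minus)
  moreover have "fact X = fact (X - n) * pochhammer (real X - real n + 1) n"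
    using pochhammer_product'[of "1::real" "X - n" n] n
    by (simp add: pochhammer_fact of_nat_diff add.commute)
  ultimately show ?thesis by simp
qed

text \<open>Both sides equal the product of \<open>pochhammer g (B + y + i)\<close> over
  \<open>i < y\<close>. It is used to turn the norms of the Hankel determinant into the value of
  \<open>V_prod\<close> at \<open>x = 0\<close>.\<close>

lemma prod_pochhammer_rearrange:
  fixes g :: real
  shows "(\<Prod>i<y. pochhammer g i) * (\<Prod>i<y. pochhammer (g + real (y - 1 - i)) (B + 1 + 2 * i)) =
    (\<Prod>i<y. pochhammer g (B + 1 + 2 * i)) * (\<Prod>i<y. pochhammer (g + real (B + i)) i)"
proof -
  have "(\<Prod>i<y. pochhammer (g + real (y - 1 - i)) (B + 1 + 2 * i)) =
      (\<Prod>i<y. pochhammer (g + real i) (B + 1 + 2 * (y - 1 - i)))"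
    by (rule prod.reindex_bij_witness[of _ "\<lambda>i. y - 1 - i" "\<lambda>i. y - 1 - i"]) auto
  hence "(\<Prod>i<y. pochhammer g i) * (\<Prod>i<y. pochhammer (g + real (y - 1 - i)) (B + 1 + 2 * i)) =
      (\<Prod>i<y. pochhammer g i * pochhammer (g + real i) (B + 1 + 2 * (y - 1 - i)))"
    by (simp add: prod.distrib)
  also have "\<dots> = (\<Prod>i<y. pochhammer g (B + y + i))"
  proof (rule prod.reindex_bij_witness[of _ "\<lambda>i. y - 1 - i" "\<lambda>i. y - 1 - i"])
    fix i assume "i \<in> {..<y}"
    hence "i + (B + 1 + 2 * (y - 1 - i)) = B + y + (y - 1 - i)" by auto
    thus "pochhammer g (B + y + (y - 1 - i)) = pochhammer g i * pochhammer (g + real i) (B + 1 + 2 * (y - 1 - i))"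
      by (metis pochhammer_product')
  qed auto
  also have "\<dots> = (\<Prod>i<y. pochhammer g (B + 1 + 2 * i)) * (\<Prod>i<y. pochhammer (g + real (B + i)) i)"
  proof (induction y)
    case (Suc y)
    have "pochhammer g (B + y) * (\<Prod>i<Suc y. pochhammer g (B + Suc y + i)) =
      (\<Prod>i<Suc (Suc y). pochhammer g (B + y + i))"
      by (subst (2) prod.lessThan_Suc_shift) simp
    also have "\<dots> = (\<Prod>i<y. pochhammer g (B + y + i)) * (pochhammer g (B + 2 * y) * pochhammer g (B + 1 + 2 * y))"
      by (simp add: mult_2 mult_2_right add_ac mult_ac)
    also have "pochhammer g (B + 2 * y) = pochhammer g (B + y) * pochhammer (g + real (B + y)) y"
      using pochhammer_product'[of g "B + y" y] by (simp add: mult_2 add_ac)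
    finally have eq: "pochhammer g (B + y) * (\<Prod>i<Suc y. pochhammer g (B + Suc y + i)) =
      pochhammer g (B + y) * ((\<Prod>i<Suc y. pochhammer g (B + 1 + 2 * i)) * (\<Prod>i<Suc y. pochhammer (g + real (B + i)) i))"
      using Suc.IH by (simp add: mult_ac)
    show ?case
    \<comment> \<open>The recursion above carries this factor on both sides. If it vanishes, so do
      all longer symbols with the same \<open>g\<close>, and each side has one of them among its
      factors.\<close>
    proof (cases "pochhammer g (B + y) = 0")
      case False
      thus ?thesis using eq by (simp only: mult_cancel_left) simp
    next
      case True
      have "pochhammer g (B + Suc y + 0) = 0" "pochhammer g (B + 1 + 2 * y) = 0"
        using pochhammer_eq_0_mono[OF True, of "B + Suc y + 0"] pochhammer_eq_0_mono[OF True, of "B + 1 + 2 * y"] by simp_all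
      thus ?thesis by (subst prod.lessThan_Suc_shift, subst (2) prod.lessThan_Suc) simp
    qed
  qed simp
  finally show ?thesis .
qed

section \<open>H, T and V in terms of factorials and Pochhammer symbols\<close>

lemma hyperfac_nat_add: "hyperfac (int m + int n) = hyperfac (int m) * (\<Prod>i<n. fact (m + i))"
proof (induction n)
  case (Suc n)
  have "nat (int m + int (Suc n)) = Suc (m + n)" "nat (int m + int n) = m + n" by auto
  thus ?case using Suc by (simp add: hyperfac_def)
qed simp

lemma hyperfac_pos: "hyperfac n > 0"
  by (simp add: hyperfac_def prod_pos)

lemma skip_pochhammer_double: "skip_pochhammer (2 * u) n = 2 ^ n * pochhammer u n"
  by (induction n) (simp_all add: skip_pochhammer_def pochhammer_Suc algebra_simps)

text \<open>Reversing the index to \<open>j = y - 1 - i\<close> makes the lengths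
  \<open>m + 2 * j\<close> and gives the factors the shape of those in \<open>selberg_det\<close>,
  where \<open>X = x + y - 1\<close>.\<close>

lemma T_prod_eq:
  assumes "y > 0"
  shows "T_prod (real x + 1) (int m + 2 * int y - 2) y =
    (\<Prod>j<y. fact (m + (x + y - 1) + j)) / (\<Prod>j<y. fact (x + y - 1 - j))"
proof -
  have "T_prod (real x + 1) (int m + 2 * int y - 2) y = (\<Prod>j<y. fact (m + (x + y - 1) + j) / fact (x + y - 1 - j))"
    unfolding T_prod_def
  proof (rule prod.reindex_bij_witness[of _ "\<lambda>j. y - 1 - j" "\<lambda>j. y - 1 - j"])
    fix i assume "i \<in> {..<y}"
    hence i: "i < y" by simp
    define j where "j = y - 1 - i"
    have n: "nat (int m + 2 * int y - 2 - 2 * int i) = m + 2 * j" using i by (simp add: j_def nat_eq_iff)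
    have z: "real x + 1 + real i = 1 + real (x + y - 1 - j)" using i by (simp add: j_def)
    have s: "m + (x + y - 1) + j = (x + y - 1 - j) + (m + 2 * j)" using i by (simp add: j_def)
    have "fact (m + (x + y - 1) + j) = fact (x + y - 1 - j) * pochhammer (1 + real (x + y - 1 - j)) (m + 2 * j)"
      unfolding s pochhammer_fact by (rule pochhammer_product')
    thus "fact (m + (x + y - 1) + (y - 1 - i)) / fact (x + y - 1 - (y - 1 - i)) =
        pochhammer (real x + 1 + real i) (nat (int m + 2 * int y - 2 - 2 * int i))"
      unfolding n z j_def[symmetric] by simp
  qed auto
  thus ?thesis by (simp add: prod_dividef)
qed

text \<open>Products of steps 2 are Pochhammer symbols at half the argument, here a half-integer,
  times a power of 2. The powers do not depend on \<open>x\<close> and cancel in the quotient of two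
  values of \<open>V_prod\<close>.\<close>

lemma V_prod_eq:
  assumes "y > 0"
  shows "V_prod (2 * real x + 2 * real a + 1) (int B + 2 * int y - 1) y =
    (\<Prod>j<y. 2 ^ (B + 1 + 2 * j)) * (\<Prod>j<y. pochhammer (real (a + (x + y - 1) - j) + 1 / 2) (B + 1 + 2 * j))"
proof -
  have "V_prod (2 * real x + 2 * real a + 1) (int B + 2 * int y - 1) y =
     (\<Prod>j<y. 2 ^ (B + 1 + 2 * j) * pochhammer (real (a + (x + y - 1) - j) + 1 / 2) (B + 1 + 2 * j))"
    unfolding V_prod_def
  proof (rule prod.reindex_bij_witness[of _ "\<lambda>j. y - 1 - j" "\<lambda>j. y - 1 - j"])
    fix i assume "i \<in> {..<y}"
    hence i: "i < y" by simp
    define j where "j = y - 1 - i"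
    have n: "nat (int B + 2 * int y - 1 - 2 * int i) = B + 1 + 2 * j" using i by (simp add: j_def nat_eq_iff)
    have z: "2 * real x + 2 * real a + 1 + 2 * real i = 2 * (real (a + (x + y - 1) - j) + 1 / 2)"
      using i by (simp add: j_def)
    show "2 ^ (B + 1 + 2 * (y - 1 - i)) * pochhammer (real (a + (x + y - 1) - (y - 1 - i)) + 1 / 2) (B + 1 + 2 * (y - 1 - i)) =
        skip_pochhammer (2 * real x + 2 * real a + 1 + 2 * real i) (nat (int B + 2 * int y - 1 - 2 * int i))"
      unfolding n z j_def[symmetric] by (simp only: skip_pochhammer_double)
  qed auto
  thus ?thesis by (simp add: prod.distrib)
qed

text \<open>The two Vandermonde factors are written in different Newton bases. By
  \<open>selberg_gram\<close> the entry \<open>(i, j)\<close> then depends on \<open>i + j\<close>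
  only, apart from factors belonging to the row or to the column.\<close>

lemma selberg_det:
  assumes c: "c = a + 1 + X" and y: "y \<le> Suc X"
  shows "(\<Sum>S | S \<subseteq> {a..<c} \<and> card S = y. (\<Prod>s\<in>S. selberg_weight a c B s) * (sq_vandermonde S * sq_vandermonde S)) =
    (\<Prod>i<y. 1 / 2 * fact (B + i) * fact i * (fact (2 * a + B + X + i) / fact (X - i)) *
      pochhammer (real (a + X - i) + 1 / 2) (B + 1 + 2 * i) *
      (pochhammer (real a + 1 / 2) i / (pochhammer (real a + 1 / 2) (B + 1 + 2 * i) * pochhammer (real a + 1 / 2 + real (B + i)) i)))"
proof -
  let ?w = "selberg_weight a c B"
  let ?f = "\<lambda>i s. \<Prod>k<i. (real s)\<^sup>2 - (real (a + k))\<^sup>2"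
  let ?g = "\<lambda>j s. \<Prod>k<j. (real s)\<^sup>2 - (real (c - Suc k))\<^sup>2"
  define \<gamma> where "\<gamma> = real a + 1 / 2"
  \<comment> \<open>Since \<open>\<beta> = \<gamma> + B + 1\<close>, a symbol
    \<open>pochhammer \<gamma> (B + 1 + n)\<close> splits into a constant and
    \<open>pochhammer \<beta> n\<close>.\<close>
  define \<beta> where "\<beta> = real a + real B + 3 / 2"
  \<comment> \<open>\<open>R\<close> and \<open>C\<close> collect the row and column factors. The
    sign in \<open>R\<close>, combined with that of \<open>pochhammer (- real X) (i + j)\<close>,
    leaves the \<open>(- 1) ^ j\<close> by which \<open>?g j\<close> differs from the product in
    \<open>selberg_gram\<close>.\<close>
  define R where "R = (\<lambda>i. fact (2 * a + B + X + i) / 2 * pochhammer \<gamma> i * (- 1) ^ i)"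
  define C where "C = (\<lambda>j. fact (B + j) * pochhammer (real (a + X - j) + 1 / 2) (B + j + 1) / (fact X * pochhammer \<gamma> (B + 1)))"
  let ?m = "\<lambda>n. pochhammer (- real X) n / pochhammer \<beta> n"
  have \<gamma>: "\<gamma> > 0" and \<beta>: "\<beta> > 1" by (simp_all add: \<gamma>_def \<beta>_def)
  have \<gamma>\<beta>: "pochhammer \<gamma> (B + 1 + n) = pochhammer \<gamma> (B + 1) * pochhammer \<beta> n" for n
    using pochhammer_product'[of \<gamma> "B + 1" n] by (simp add: \<gamma>_def \<beta>_def algebra_simps)
  have pos: "pochhammer \<gamma> n > 0" "pochhammer \<beta> n > 0" "pochhammer (\<gamma> + real k) n > 0" for n k
    using \<gamma> \<beta> by (auto intro!: pochhammer_pos)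
  have entry: "(\<Sum>u\<in>{a..<c}. ?w u * (?f i u * ?g j u)) = R i * C j * ?m (i + j)" if ij: "i < y" "j < y" for i j
  proof -
    have jc: "j \<le> c" using ij y c by simp
    have neg: "?g j u = (- 1) ^ j * (\<Prod>k<j. (real (c - Suc k))\<^sup>2 - (real u)\<^sup>2)" for u
    proof -
      have "?g j u = (\<Prod>k<j. (- 1) * ((real (c - Suc k))\<^sup>2 - (real u)\<^sup>2))" by simp
      thus ?thesis by (simp only: prod.distrib prod_constant card_lessThan)
    qed
    have "(\<Sum>u\<in>{a..<c}. ?w u * (?f i u * ?g j u)) =
      (- 1) ^ j * (\<Sum>u\<in>{a..<c}. ?w u * (?f i u * (\<Prod>k<j. (real (c - Suc k))\<^sup>2 - (real u)\<^sup>2)))"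
      unfolding neg sum_distrib_left by (simp only: mult_ac)
    also have "\<dots> = R i * C j * ?m (i + j)"
    proof (cases "i + j \<le> X")
      case False
      hence "pochhammer (- real X) (i + j) = 0" by (simp add: pochhammer_of_nat_eq_0_iff)
      thus ?thesis unfolding selberg_gram[OF c jc] using False by simp
    next
      case True
      define F1 F2 F3 P where "F1 = (fact (B + j) :: real)" and "F2 = (fact (2 * a + B + X + i) :: real)"
        and "F3 = (fact (X - (i + j)) :: real)" and "P = pochhammer (real (a + X - j) + 1 / 2) (B + j + 1)"
      have m: "pochhammer (- real X) (i + j) = (- 1) ^ (i + j) * (fact X / F3)"
        unfolding F3_def by (rule pochhammer_neg_nat[OF True])
      have q: "pochhammer \<gamma> i * pochhammer (real (a + i) + 1 / 2) (B + j + 1) = pochhammer \<gamma> (B + 1) * pochhammer \<beta> (i + j)"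
        using pochhammer_product'[of \<gamma> i "B + j + 1"] \<gamma>\<beta>[of "i + j"] by (simp add: \<gamma>_def add_ac)
      have Q: "pochhammer (real (a + i) + 1 / 2) (B + j + 1) = pochhammer \<gamma> (B + 1) * pochhammer \<beta> (i + j) / pochhammer \<gamma> i"
        using q pos(1)[of i] by (simp add: field_simps)
      have sgn: "(- 1) ^ i * (- 1) ^ (i + j) = (- 1 :: real) ^ j"
        by (simp add: power_add mult.assoc[symmetric] power_mult_distrib[symmetric])
      have "(- 1) ^ j * (F1 * F2 / (2 * F3) * (P / (pochhammer \<gamma> (B + 1) * pochhammer \<beta> (i + j) / pochhammer \<gamma> i))) =
        F2 / 2 * pochhammer \<gamma> i * ((- 1) ^ i * (- 1) ^ (i + j)) * (F1 * P / (fact X * pochhammer \<gamma> (B + 1))) * ((fact X / F3) / pochhammer \<beta> (i + j))"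
        unfolding sgn by (simp add: mult_ac)
      thus ?thesis unfolding selberg_gram[OF c jc] Q R_def C_def m F1_def[symmetric] F2_def[symmetric] F3_def[symmetric] P_def[symmetric]
        using True by (simp add: mult_ac)
    qed
    finally show ?thesis .
  qed
  have "(\<Sum>S | S \<subseteq> {a..<c} \<and> card S = y. (\<Prod>s\<in>S. ?w s) * (sq_vandermonde S * sq_vandermonde S)) =
    (\<Sum>S | S \<subseteq> {a..<c} \<and> card S = y. (\<Prod>s\<in>S. ?w s) *
      (det (mat y y (\<lambda>(i, j). ?f j (enum_set S i))) * det (mat y y (\<lambda>(i, j). ?g j (enum_set S i)))))"
  proof (rule sum.cong[OF refl])
    fix S assume "S \<in> {S. S \<subseteq> {a..<c} \<and> card S = y}"
    hence S: "finite S" "card S = y" using finite_subset by auto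
    show "(\<Prod>s\<in>S. ?w s) * (sq_vandermonde S * sq_vandermonde S) = (\<Prod>s\<in>S. ?w s) *
      (det (mat y y (\<lambda>(i, j). ?f j (enum_set S i))) * det (mat y y (\<lambda>(i, j). ?g j (enum_set S i))))"
      by (simp only: det_sq_newton[OF S, of "\<lambda>k. (real (a + k))\<^sup>2"] det_sq_newton[OF S, of "\<lambda>k. (real (c - Suc k))\<^sup>2"])
  qed
  also have "\<dots> = det (mat y y (\<lambda>(i, j). \<Sum>u\<in>{a..<c}. ?w u * (?f i u * ?g j u)))"
    by (rule andreief) simp
  also have "mat y y (\<lambda>(i, j). \<Sum>u\<in>{a..<c}. ?w u * (?f i u * ?g j u)) = mat y y (\<lambda>(i, j). R i * C j * ?m (i + j))"
    by (rule cong_mat[OF refl refl]) (simp only: prod.case entry)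
  also have "det \<dots> = (\<Prod>i<y. R i) * (\<Prod>i<y. C i) * det (mat y y (\<lambda>(i, j). ?m (i + j)))"
    by (rule det_scale_rows_cols)
  also have "\<dots> = (\<Prod>i<y. R i * C i * (fact i * pochhammer (- real X) i * pochhammer (\<beta> - (- real X)) i /
      (pochhammer \<beta> (2 * i) * pochhammer (\<beta> + real i - 1) i)))"
    unfolding det_hankel_pochhammer[OF \<beta>] by (simp only: prod.distrib)
  also have "\<dots> = (\<Prod>i<y. 1 / 2 * fact (B + i) * fact i * (fact (2 * a + B + X + i) / fact (X - i)) *
      pochhammer (real (a + X - i) + 1 / 2) (B + 1 + 2 * i) *
      (pochhammer \<gamma> i / (pochhammer \<gamma> (B + 1 + 2 * i) * pochhammer (\<gamma> + real (B + i)) i)))"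
  proof (rule prod.cong[OF refl])
    fix i assume "i \<in> {..<y}"
    hence i: "i \<le> X" using y by simp
    have 1: "pochhammer (- real X) i = (- 1) ^ i * (fact X / fact (X - i))"
      by (rule pochhammer_neg_nat[OF i])
    have "real (a + X - i) + 1 / 2 + real (B + i + 1) = \<beta> - (- real X)" using i by (simp add: \<beta>_def of_nat_diff)
    hence 2: "pochhammer (real (a + X - i) + 1 / 2) (B + 1 + 2 * i) =
        pochhammer (real (a + X - i) + 1 / 2) (B + i + 1) * pochhammer (\<beta> - (- real X)) i"
      using pochhammer_product'[of "real (a + X - i) + 1 / 2" "B + i + 1" i] by (simp add: mult_2 add_ac)
    have 3: "\<gamma> + real (B + i) = \<beta> + real i - 1" by (simp add: \<gamma>_def \<beta>_def)
    have sgn: "(- 1) ^ i * (- 1) ^ i = (1 :: real)" by (simp flip: power_mult_distrib)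
    have "F2 / 2 * g * s * (F1 * P / (FX * G)) * (fi * (s * (FX / F3)) * Z / (b * W)) =
       (s * s) * (1 / 2 * F1 * fi * (F2 / F3) * (P * Z) * (g / (G * b * W)))" if "FX \<noteq> 0"
      for F1 F2 F3 P FX G fi Z b W g s :: real using that by (simp add: mult_ac)
    from this[of "fact X" "fact (2 * a + B + X + i)" "pochhammer \<gamma> i" "(- 1) ^ i" "fact (B + i)"
      "pochhammer (real (a + X - i) + 1 / 2) (B + i + 1)" "pochhammer \<gamma> (B + 1)" "fact i" "fact (X - i)"
      "pochhammer (\<beta> - (- real X)) i" "pochhammer \<beta> (2 * i)" "pochhammer (\<beta> + real i - 1) i"]
    show "R i * C i * (fact i * pochhammer (- real X) i * pochhammer (\<beta> - (- real X)) i /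
        (pochhammer \<beta> (2 * i) * pochhammer (\<beta> + real i - 1) i)) =
      1 / 2 * fact (B + i) * fact i * (fact (2 * a + B + X + i) / fact (X - i)) *
      pochhammer (real (a + X - i) + 1 / 2) (B + 1 + 2 * i) *
      (pochhammer \<gamma> i / (pochhammer \<gamma> (B + 1 + 2 * i) * pochhammer (\<gamma> + real (B + i)) i))"
      unfolding R_def C_def 1 2 3 \<gamma>\<beta> sgn by simp
  qed
  finally show ?thesis by (simp only: \<gamma>_def)
qed

text \<open>The determinant is rewritten in terms of H, T and V. The hyperfactorials contribute
  \<open>TD * HB\<close>, of which \<open>TD\<close> cancels against the numerator of
  \<open>T_prod 1\<close>, and the powers of 2 in the two values of \<open>V_prod\<close> cancel.
  Each crossing retains the factor 1/2 of the one-point sum.\<close>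

theorem selberg_sum:
  assumes c: "c = a + x + y"
  shows "(\<Sum>S | S \<subseteq> {a..<c} \<and> card S = y. (\<Prod>s\<in>S. selberg_weight a c B s) * (sq_vandermonde S * sq_vandermonde S)) =
    (1 / 2) ^ y * ((hyperfac (2 * int a + int B + 2 * int y - 1) * hyperfac (int B + int y)) /
        (hyperfac (2 * int a + int B + int y - 1) * hyperfac (int B))) *
      ((T_prod (real x + 1) (2 * int a + int B + 2 * int y - 2) y * V_prod (2 * real x + 2 * real a + 1) (int B + 2 * int y - 1) y) /
       (T_prod 1 (2 * int a + int B + 2 * int y - 2) y * V_prod (2 * real a + 1) (int B + 2 * int y - 1) y))"
proof (cases "y = 0")
  case True
  have "{S. S \<subseteq> {a..<c} \<and> card S = 0} = {{}}" using finite_subset by (auto simp: card_eq_0_iff)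
  moreover have "hyperfac (2 * int a + int B - 1) \<noteq> 0" "hyperfac (int B) \<noteq> 0" using hyperfac_pos less_irrefl by metis+
  ultimately show ?thesis using True by (simp add: T_prod_def V_prod_def)
next
  case False
  define X where "X = x + y - 1"
  have X: "c = a + 1 + X" "y \<le> Suc X" using False c by (simp_all add: X_def)
  define g where "g = real a + 1 / 2"
  define HB FI TN TD VX V0 where "HB = (\<Prod>i<y. fact (B + i) :: real)" and "FI = (\<Prod>i<y. fact i :: real)"
    and "TN = (\<Prod>i<y. fact (2 * a + B + X + i) / fact (X - i) :: real)"
    and "TD = (\<Prod>i<y. fact (2 * a + B + (y - 1) + i) :: real)"
    and "VX = (\<Prod>i<y. pochhammer (real (a + X - i) + 1 / 2) (B + 1 + 2 * i))"
    and "V0 = (\<Prod>i<y. pochhammer (real (a + (y - 1) - i) + 1 / 2) (B + 1 + 2 * i))"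
  define E where "E = (\<Prod>j<y. 2 ^ (B + 1 + 2 * j) :: real)"
  have pos: "HB > 0" "FI > 0" "TD > 0" "V0 > 0" "E > 0"
    unfolding HB_def FI_def TD_def V0_def E_def by (auto intro!: prod_pos pochhammer_pos)
  \<comment> \<open>The denominators coming from the Hankel determinant make up \<open>V0\<close>,
    the part of \<open>V_prod\<close> at \<open>x = 0\<close> without powers of 2.\<close>
  have Q: "(\<Prod>i<y. pochhammer g i / (pochhammer g (B + 1 + 2 * i) * pochhammer (g + real (B + i)) i)) = 1 / V0"
  proof -
    have "V0 = (\<Prod>i<y. pochhammer (g + real (y - 1 - i)) (B + 1 + 2 * i))"
      unfolding V0_def by (rule prod.cong) (auto simp: g_def of_nat_diff)
    hence "(\<Prod>i<y. pochhammer g i) * V0 = (\<Prod>i<y. pochhammer g (B + 1 + 2 * i)) * (\<Prod>i<y. pochhammer (g + real (B + i)) i)"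
      by (simp only: prod_pochhammer_rearrange)
    moreover have "(\<Prod>i<y. pochhammer g i) > 0" by (auto intro!: prod_pos pochhammer_pos simp: g_def)
    ultimately show ?thesis using pos(4) by (simp add: prod_dividef prod.distrib)
      (metis div_by_1 div_self less_irrefl mult_divide_mult_cancel_left mult.right_neutral nonzero_mult_divide_mult_cancel_left)
  qed
  have L: "(\<Sum>S | S \<subseteq> {a..<c} \<and> card S = y. (\<Prod>s\<in>S. selberg_weight a c B s) * (sq_vandermonde S * sq_vandermonde S)) =
    (1 / 2) ^ y * HB * FI * TN * VX * (1 / V0)"
    unfolding selberg_det[OF X] Q[symmetric] HB_def FI_def TN_def VX_def g_def
    by (simp only: prod.distrib prod_constant card_lessThan)
  have t1: "T_prod (real x + 1) (2 * int a + int B + 2 * int y - 2) y = TN"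
    using T_prod_eq[of y x "2 * a + B"] False by (simp add: TN_def X_def prod_dividef)
  have t2: "T_prod 1 (2 * int a + int B + 2 * int y - 2) y = TD / FI"
  proof -
    have "(\<Prod>j<y. fact (0 + y - 1 - j)) = FI" unfolding FI_def
      by (rule prod.reindex_bij_witness[of _ "\<lambda>j. y - 1 - j" "\<lambda>j. y - 1 - j"]) auto
    thus ?thesis using T_prod_eq[of y 0 "2 * a + B"] False by (simp add: TD_def)
  qed
  have v1: "V_prod (2 * real x + 2 * real a + 1) (int B + 2 * int y - 1) y = E * VX"
    using V_prod_eq[of y x a B] False by (simp add: E_def VX_def X_def)
  have v2: "V_prod (2 * real a + 1) (int B + 2 * int y - 1) y = E * V0"
    using V_prod_eq[of y 0 a B] False by (simp add: E_def V0_def)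
  have h1: "hyperfac (2 * int a + int B + 2 * int y - 1) = hyperfac (2 * int a + int B + int y - 1) * TD"
  proof -
    have e: "2 * int a + int B + 2 * int y - 1 = int (2 * a + B + (y - 1)) + int y"
      "2 * int a + int B + int y - 1 = int (2 * a + B + (y - 1))" using False by auto
    show ?thesis unfolding e hyperfac_nat_add TD_def ..
  qed
  have h2: "hyperfac (int B + int y) = hyperfac (int B) * HB"
    unfolding hyperfac_nat_add HB_def ..
  have h3: "hyperfac (2 * int a + int B + int y - 1) > 0" "hyperfac (int B) > 0" by (rule hyperfac_pos)+
  show ?thesis unfolding L t1 t2 v1 v2 h1 h2 using pos h3 by (simp add: field_simps)
qed

section \<open>Filling triangular holes\<close>

text \<open>The cell \<open>(m, c)\<close> points down, so its neighbours are the two in its row,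
  which are missing, and the one above it.\<close>

lemma brick_sum_forced_row:
  fixes m :: int
  assumes fin: "finite R" and J: "\<And>c. c \<in> J \<Longrightarrow> even (c - m) \<and> (m, c) \<in> R \<and> (m + 1, c) \<in> R \<and> (m, c - 1) \<notin> R \<and> (m, c + 1) \<notin> R"
  shows "brick_sum R = (\<Prod>c\<in>J. if even (m + 1) \<and> c = 1 then 1 / 2 else 1) * brick_sum (R - {m, m + 1} \<times> J)"
proof -
  let ?f = "\<lambda>c. {(m + 1, c), (m, c)}"
  have inj: "inj_on ?f J" by (auto simp: inj_on_def doubleton_eq_iff)
  have "brick_sum R = (\<Prod>l\<in>?f ` J. brick_weight l) * brick_sum (R - \<Union>(?f ` J))"
    unfolding brick_sum_def
  proof (rule block_sum_forced[OF fin])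
    show "disjoint (?f ` J)" by (auto simp: disjoint_def)
    fix l assume "l \<in> ?f ` J"
    then obtain c where c: "c \<in> J" "l = ?f c" by blast
    have l: "l = {(m + 1, c), (m + 1 - 1, c)}" "odd (c - (m + 1))" using c J[OF c(1)] by auto
    show "brick l" unfolding brick_def using l by blast
    show "l \<subseteq> R" using J[OF c(1)] c(2) by simp
    show "\<exists>t\<in>l. \<forall>l'. brick l' \<longrightarrow> l' \<subseteq> R \<longrightarrow> t \<in> l' \<longrightarrow> l' = l"
    proof (intro bexI[of _ "(m, c)"] allI impI)
      show "(m, c) \<in> l" using c(2) by simp
      fix l' assume l': "brick l'" "l' \<subseteq> R" "(m, c) \<in> l'"
      from l'(1) obtain k d where "l' = {(k, d), (k, d + 1)} \<or> odd (d - k) \<and> l' = {(k, d), (k - 1, d)}"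
        unfolding brick_def by (elim exE) (rule that)
      thus "l' = l"
      proof (elim disjE conjE)
        assume h: "l' = {(k, d), (k, d + 1)}"
        with l'(3) have "k = m \<and> (d = c \<or> d = c - 1)" by auto
        with h l'(2) J[OF c(1)] show ?thesis by auto
      next
        assume v: "odd (d - k)" "l' = {(k, d), (k - 1, d)}"
        with l'(3) J[OF c(1)] have "d = c \<and> k = m + 1" by auto
        thus ?thesis using v(2) c(2) by simp
      qed
    qed
  qed
  also have "(\<Prod>l\<in>?f ` J. brick_weight l) = (\<Prod>c\<in>J. if even (m + 1) \<and> c = 1 then 1 / 2 else 1)"
    unfolding prod.reindex[OF inj] o_def
  proof (rule prod.cong[OF refl])
    fix c assume "c \<in> J"
    have "(\<exists>k. even k \<and> ?f c = {(k, 1), (k - 1, 1)}) \<longleftrightarrow> even (m + 1) \<and> c = 1"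
      by (auto simp: doubleton_eq_iff intro!: exI[of _ "m + 1"])
    thus "brick_weight (?f c) = (if even (m + 1) \<and> c = 1 then 1 / 2 else 1)"
      unfolding brick_weight_def by presburger
  qed
  also have "R - \<Union>(?f ` J) = R - {m, m + 1} \<times> J" by auto
  finally show ?thesis .
qed

text \<open>
  A triangular hole is equivalent to removing only the unit triangles along its base: row by row,
  the remaining triangles of the hole are covered by forced vertical lozenges.  The left boundary
  \<open>lo\<close> is either slanted (a full triangle) or the zigzag (a half triangle).
\<close>

lemma brick_sum_fill:
  fixes lo :: "int \<Rightarrow> int" and q :: nat and R :: "point set"
  assumes fin: "finite R"
    and lo1: "\<And>m. 0 \<le> m \<Longrightarrow> 1 \<le> lo m"
    and lo: "\<And>m c. 0 \<le> m \<Longrightarrow> even (c - m) \<Longrightarrow> lo (m + 1) \<le> c \<longleftrightarrow> lo m \<le> c"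
    and T: "T = {(k, c). 0 \<le> k \<and> lo k \<le> c \<and> c \<le> 2 * int q - k - 1}"
    and TR: "T \<subseteq> R"
    and left: "\<And>m c. 0 \<le> m \<Longrightarrow> even (c - m) \<Longrightarrow> lo m \<le> c \<Longrightarrow> c - 1 < lo m \<Longrightarrow> (m, c - 1) \<notin> R"
  shows "brick_sum (R - {t\<in>T. fst t = 0 \<and> odd (snd t)}) =
    (\<Prod>m<2 * q. if odd m \<and> lo (int m) = 1 \<and> m + 3 \<le> 2 * q then 1 / 2 else 1) * brick_sum (R - T)"
proof -
  \<comment> \<open>Stage \<open>m\<close>: removed are the cells of the hole in the rows below
    \<open>m\<close> and its up-pointing cells in row \<open>m\<close>. The down-pointing cells of
    the hole in row \<open>m\<close> have thus lost their horizontal neighbours, and the lozenges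
    forced on them remove the up-pointing cells of row \<open>m + 1\<close>.\<close>
  let ?P = "\<lambda>m::nat. {t\<in>T. fst t < int m \<or> fst t = int m \<and> odd (snd t - fst t)}"
  let ?W = "\<lambda>m::nat. if odd m \<and> lo (int m) = 1 \<and> m + 3 \<le> 2 * q then 1 / 2 else (1 :: real)"
  have step: "brick_sum (R - ?P m) = ?W m * brick_sum (R - ?P (Suc m))" for m
  proof -
    let ?m = "int m"
    let ?J = "{c. even (c - ?m) \<and> lo ?m \<le> c \<and> c \<le> 2 * int q - ?m - 2}"
    have "brick_sum (R - ?P m) = (\<Prod>c\<in>?J. if even (?m + 1) \<and> c = 1 then 1 / 2 else 1) * brick_sum (R - ?P m - {?m, ?m + 1} \<times> ?J)"
    proof (rule brick_sum_forced_row)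
      show "finite (R - ?P m)" using fin by simp
      fix c assume "c \<in> ?J"
      hence c: "even (c - ?m)" "lo ?m \<le> c" "c \<le> 2 * int q - ?m - 2" by auto
      have l: "lo (?m + 1) \<le> c" using lo[of ?m c] c by simp
      have 1: "(?m, c) \<in> T" "(?m + 1, c) \<in> T" "(?m, c + 1) \<in> T" using c l by (auto simp: T)
      have 2: "(?m, c - 1) \<notin> R - ?P m"
      proof (cases "c - 1 < lo ?m")
        case True
        thus ?thesis using left[of ?m c] c by simp
      next
        case False
        hence "(?m, c - 1) \<in> ?P m" using c by (auto simp: T)
        thus ?thesis by blast
      qed
      have 3: "(?m, c + 1) \<notin> R - ?P m" using 1(3) c(1) by auto
      show "even (c - ?m) \<and> (?m, c) \<in> R - ?P m \<and> (?m + 1, c) \<in> R - ?P m \<and> (?m, c - 1) \<notin> R - ?P m \<and> (?m, c + 1) \<notin> R - ?P m"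
        using 1 2 3 TR c(1) by auto
    qed
    also have "R - ?P m - {?m, ?m + 1} \<times> ?J = R - ?P (Suc m)"
    proof -
      have "?P m \<union> {?m, ?m + 1} \<times> ?J = ?P (Suc m)"
      proof (intro equalityI subsetI)
        fix t assume t: "t \<in> ?P m \<union> {?m, ?m + 1} \<times> ?J"
        obtain k c where kc: "t = (k, c)" by (cases t)
        show "t \<in> ?P (Suc m)"
        proof (cases "t \<in> ?P m")
          case True
          thus ?thesis by auto
        next
          case False
          with t kc have c: "k = ?m \<or> k = ?m + 1" "even (c - ?m)" "lo ?m \<le> c" "c \<le> 2 * int q - ?m - 2" by auto
          have "lo (?m + 1) \<le> c" using lo[of ?m c] c by simp
          thus ?thesis using c by (auto simp: T kc)
        qed
      next
        fix t assume t: "t \<in> ?P (Suc m)"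
        obtain k c where kc: "t = (k, c)" by (cases t)
        have tT: "0 \<le> k" "lo k \<le> c" "c \<le> 2 * int q - k - 1" using t by (auto simp: T kc)
        consider "k < ?m" | "k = ?m" "odd (c - ?m)" | "k = ?m" "even (c - ?m)" | "k = ?m + 1" "even (c - ?m)"
        proof -
          have "k < ?m + 1 \<or> k = ?m + 1 \<and> odd (c - (?m + 1))" using t by (auto simp: kc)
          hence "k < ?m \<or> k = ?m \<or> k = ?m + 1 \<and> even (c - ?m)" by (elim disjE) auto
          thus ?thesis using that by blast
        qed
        thus "t \<in> ?P m \<union> {?m, ?m + 1} \<times> ?J"
        proof cases
          case 3
          hence "c \<noteq> 2 * int q - ?m - 1" by presburger
          thus ?thesis using 3 tT by (auto simp: kc)
        next
          case 4
          hence "lo ?m \<le> c" using tT lo[of ?m c] by simp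
          thus ?thesis using 4 tT by (auto simp: kc)
        qed (use t in \<open>auto simp: kc\<close>)
      qed
      thus ?thesis by blast
    qed
    \<comment> \<open>A factor 1/2 arises when column 1 is among the forced columns and the height
      \<open>m + 1\<close> is even; the bound \<open>m + 3 \<le> 2 * q\<close> is
      \<open>c \<le> 2 * int q - m - 2\<close> at \<open>c = 1\<close>.\<close>
    also have "(\<Prod>c\<in>?J. if even (?m + 1) \<and> c = 1 then 1 / 2 else 1) = ?W m"
    proof -
      have fJ: "finite ?J" by (rule finite_subset[of _ "{lo ?m..2 * int q}"]) auto
      have m1: "1 \<in> ?J \<longleftrightarrow> odd m \<and> lo ?m = 1 \<and> m + 3 \<le> 2 * q" using lo1[of ?m] by auto
      have "(\<Prod>c\<in>?J. if even (?m + 1) \<and> c = 1 then 1 / 2 else 1) =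
          (\<Prod>c\<in>?J. if c = 1 then (if odd m then 1 / 2 else 1) else (1 :: real))"
        by (rule prod.cong) auto
      also have "\<dots> = (if 1 \<in> ?J then (if odd m then 1 / 2 else 1) else 1)"
        using fJ by (subst prod.delta) auto
      also have "\<dots> = ?W m" unfolding m1 by simp
      finally show ?thesis .
    qed
    finally show ?thesis .
  qed
  have A: "brick_sum (R - ?P 0) = (\<Prod>m<n. ?W m) * brick_sum (R - ?P n)" for n
  proof (induction n)
    case (Suc n)
    show ?case by (simp only: Suc.IH step[of n] prod.lessThan_Suc mult.assoc)
  qed simp
  have B: "?P (2 * q) = T"
  proof -
    have "fst t < int (2 * q)" if "t \<in> T" for t using that lo1[of "fst t"] by (auto simp: T)
    thus ?thesis by blast
  qed
  have C: "?P 0 = {t\<in>T. fst t = 0 \<and> odd (snd t)}" by (auto simp: T)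
  show ?thesis using A[of "2 * q"] unfolding B C .
qed

definition hole :: "nat \<Rightarrow> nat \<Rightarrow> point set" where
  "hole p q = {(k, c). 0 \<le> k \<and> 2 * int p + k + 1 \<le> c \<and> c \<le> 2 * int q - k - 1}"

definition half_hole :: "nat \<Rightarrow> point set" where
  "half_hole q = {(k, c). 0 \<le> k \<and> 1 \<le> c \<and> c \<le> 2 * int q - k - 1}"

lemma hole_row0: "{t\<in>hole p q. fst t = 0 \<and> odd (snd t)} = base_dents {p..<q}"
proof (intro equalityI subsetI)
  fix t assume t: "t \<in> {t\<in>hole p q. fst t = 0 \<and> odd (snd t)}"
  obtain k c where kc: "t = (k, c)" by (cases t)
  have c: "k = 0" "odd c" "2 * int p + 1 \<le> c" "c \<le> 2 * int q - 1" using t by (auto simp: hole_def kc)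
  hence "c = 2 * int (nat (c div 2)) + 1" "nat (c div 2) \<in> {p..<q}" by (auto elim!: oddE)
  thus "t \<in> base_dents {p..<q}" unfolding base_dents_def kc using c(1) by blast
qed (auto simp: hole_def base_dents_def)

lemma brick_sum_hole:
  assumes "finite R" "hole p q \<subseteq> R"
  shows "brick_sum (R - base_dents {p..<q}) = brick_sum (R - hole p q)"
proof -
  have "brick_sum (R - {t\<in>hole p q. fst t = 0 \<and> odd (snd t)}) =
    (\<Prod>m<2 * q. if odd m \<and> 2 * int p + int m + 1 = 1 \<and> m + 3 \<le> 2 * q then 1 / 2 else 1) * brick_sum (R - hole p q)"
  proof (rule brick_sum_fill[OF assms(1) _ _ hole_def assms(2)])
    fix m c :: int assume m: "0 \<le> m" and e: "even (c - m)"
    show "2 * int p + (m + 1) + 1 \<le> c \<longleftrightarrow> 2 * int p + m + 1 \<le> c" using e by presburger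
    assume "2 * int p + m + 1 \<le> c" "c - 1 < 2 * int p + m + 1"
    hence "c = 2 * int p + m + 1" by simp
    thus "(m, c - 1) \<notin> R" using e by simp
  qed simp
  also have "(\<Prod>m<2 * q. if odd m \<and> 2 * int p + int m + 1 = 1 \<and> m + 3 \<le> 2 * q then 1 / 2 else 1) = (1 :: real)"
  proof (intro prod.neutral ballI)
    fix m
    have "\<not> (odd m \<and> 2 * int p + int m + 1 = 1)" by presburger
    thus "(if odd m \<and> 2 * int p + int m + 1 = 1 \<and> m + 3 \<le> 2 * q then 1 / 2 else 1) = (1 :: real)"
      by (simp only: simp_thms if_False conj_assoc[symmetric])
  qed
  finally show ?thesis by (simp add: hole_row0)
qed

text \<open>The rows \<open>m = 1, 3, ..., 2 * q - 3\<close> each force one weighted lozenge on the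
  zigzag, which makes \<open>q - 1\<close>. For \<open>q = 0\<close> nothing is forced, in agreement
  with the truncated subtraction.\<close>

lemma brick_sum_half_hole:
  assumes "finite R" "half_hole q \<subseteq> R" "\<And>k c. (k, c) \<in> R \<Longrightarrow> 1 \<le> c"
  shows "brick_sum (R - base_dents {0..<q}) = (1 / 2) ^ (q - 1) * brick_sum (R - half_hole q)"
proof -
  have h: "half_hole q = {(k, c). 0 \<le> k \<and> (\<lambda>_. 1) k \<le> c \<and> c \<le> 2 * int q - k - 1}" by (simp add: half_hole_def)
  have "brick_sum (R - {t\<in>half_hole q. fst t = 0 \<and> odd (snd t)}) =
    (\<Prod>m<2 * q. if odd m \<and> (1::int) = 1 \<and> m + 3 \<le> 2 * q then 1 / 2 else 1) * brick_sum (R - half_hole q)"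
    by (rule brick_sum_fill[OF assms(1) _ _ h assms(2)]) (use assms(3) in force)+
  also have "{t\<in>half_hole q. fst t = 0 \<and> odd (snd t)} = {t\<in>hole 0 q. fst t = 0 \<and> odd (snd t)}"
    by (auto simp: half_hole_def hole_def)
  also have "(\<Prod>m<2 * q. if odd m \<and> (1::int) = 1 \<and> m + 3 \<le> 2 * q then 1 / 2 else 1) = (1 / 2 :: real) ^ (q - 1)"
  proof -
    have "(\<Prod>m<2 * n. if odd m \<and> m + 3 \<le> 2 * q then 1 / 2 else 1) = (1 / 2 :: real) ^ (min n (q - 1))" if "n \<le> q" for n
      using that
    proof (induction n)
      case (Suc n)
      have "2 * n + 1 + 3 \<le> 2 * q \<longleftrightarrow> n < q - 1" by auto
      thus ?case using Suc by (auto simp: min_def not_le)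
    qed simp
    moreover have "min q (q - 1) = q - 1" by simp
    ultimately show ?thesis by simp
  qed
  finally show ?thesis by (simp add: hole_row0)
qed

lemma base_dents_Un: "base_dents (P \<union> Q) = base_dents P \<union> base_dents Q"
  by (auto simp: base_dents_def)

lemma hole_disjoint: "q \<le> p' \<or> q' \<le> p \<Longrightarrow> hole p q \<inter> hole p' q' = {}"
  by (auto simp: hole_def)

lemma hole_disjoint_base_dents: "{p..<q} \<inter> S = {} \<Longrightarrow> hole p q \<inter> base_dents S = {}"
  by (fastforce simp: hole_def base_dents_def)

lemma brick_sum_holes:
  assumes "finite I" "finite R"
    and "\<And>i. i \<in> I \<Longrightarrow> hole (p i) (q i) \<subseteq> R"
    and "\<And>i j. i \<in> I \<Longrightarrow> j \<in> I \<Longrightarrow> i \<noteq> j \<Longrightarrow> q i \<le> p j \<or> q j \<le> p i"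
  shows "brick_sum (R - base_dents (\<Union>i\<in>I. {p i..<q i})) = brick_sum (R - (\<Union>i\<in>I. hole (p i) (q i)))"
  using assms
proof (induction I arbitrary: R)
  case empty
  thus ?case by (simp add: base_dents_def)
next
  case (insert j I)
  let ?D = "base_dents (\<Union>i\<in>I. {p i..<q i})"
  have d: "{p j..<q j} \<inter> (\<Union>i\<in>I. {p i..<q i}) = {}"
  proof -
    have "{p j..<q j} \<inter> {p i..<q i} = {}" if "i \<in> I" for i
    proof -
      have "i \<noteq> j" using that insert.hyps by blast
      thus ?thesis using insert.prems(3)[of i j] that by auto
    qed
    thus ?thesis by blast
  qed
  have hD: "hole (p j) (q j) \<subseteq> R - ?D"
    using insert.prems(2)[of j] hole_disjoint_base_dents[OF d] by blast
  have "R - base_dents (\<Union>i\<in>insert j I. {p i..<q i}) = (R - ?D) - base_dents {p j..<q j}"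
    by (auto simp: base_dents_Un)
  hence "brick_sum (R - base_dents (\<Union>i\<in>insert j I. {p i..<q i})) = brick_sum ((R - ?D) - hole (p j) (q j))"
    using brick_sum_hole[OF _ hD] insert.prems(1) by simp
  also have "(R - ?D) - hole (p j) (q j) = (R - hole (p j) (q j)) - ?D" by blast
  also have "brick_sum \<dots> = brick_sum ((R - hole (p j) (q j)) - (\<Union>i\<in>I. hole (p i) (q i)))"
  proof (rule insert.IH)
    show "finite (R - hole (p j) (q j))" using insert.prems(1) by simp
    fix i assume i: "i \<in> I"
    have "i \<noteq> j" using i insert.hyps by blast
    hence "hole (p i) (q i) \<inter> hole (p j) (q j) = {}" using insert.prems(3)[of i j] i by (intro hole_disjoint) auto
    thus "hole (p i) (q i) \<subseteq> R - hole (p j) (q j)" using insert.prems(2)[of i] i by blast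
  qed (use insert.prems(3) in blast)
  also have "(R - hole (p j) (q j)) - (\<Union>i\<in>I. hole (p i) (q i)) = R - (\<Union>i\<in>insert j I. hole (p i) (q i))" by blast
  finally show ?case .
qed

section \<open>Balance of up-pointing and down-pointing cells\<close>

lemma brick_sum_nonzero_balanced:
  assumes "finite R" "brick_sum R \<noteq> 0"
  shows "card {t\<in>R. odd (snd t - fst t)} = card {t\<in>R. even (snd t - fst t)}"
proof -
  have "block_tilings brick R \<noteq> {}" using assms(2) by (auto simp: brick_sum_def block_sum_def)
  then obtain T where T: "T \<in> block_tilings brick R" by blast
  note D = block_tilingsD[OF T]
  have fT: "finite T" by (rule finite_block_tiling[OF assms(1) T])
  have cnt: "card {t\<in>R. Q t} = card T" if Q: "\<And>l. brick l \<Longrightarrow> card {t\<in>l. Q t} = 1" for Q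
  proof -
    have "{t\<in>R. Q t} = (\<Union>l\<in>T. {t\<in>l. Q t})" using D(6) by blast
    also have "card \<dots> = (\<Sum>l\<in>T. card {t\<in>l. Q t})"
    proof (rule card_UN_disjoint[OF fT])
      show "\<forall>l\<in>T. finite {t\<in>l. Q t}" 
        by (intro ballI, rule finite_subset[OF _ assms(1)]) (use D(3) in blast)
      show "\<forall>l\<in>T. \<forall>l'\<in>T. l \<noteq> l' \<longrightarrow> {t\<in>l. Q t} \<inter> {t\<in>l'. Q t} = {}" using D(5) by blast
    qed
    also have "\<dots> = card T" using Q D(2) by simp
    finally show ?thesis .
  qed
  have brick1: "card {t\<in>l. odd (snd t - fst t)} = 1 \<and> card {t\<in>l. even (snd t - fst t)} = 1" if "brick l" for l
  proof -
    obtain k c where "l = {(k, c), (k, c + 1)} \<or> odd (c - k) \<and> l = {(k, c), (k - 1, c)}"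
      using \<open>brick l\<close> unfolding brick_def by (elim exE) (rule that)
    moreover have U: "card {t\<in>{u, v}. odd (snd t - fst t)} = 1 \<and> card {t\<in>{u, v}. even (snd t - fst t)} = 1"
      if "odd (snd u - fst u) \<noteq> odd (snd v - fst v)" for u v :: point
    proof (cases "odd (snd u - fst u)")
      case True
      hence "{t\<in>{u, v}. odd (snd t - fst t)} = {u}" "{t\<in>{u, v}. even (snd t - fst t)} = {v}" using that by auto
      thus ?thesis by simp
    next
      case False
      hence "{t\<in>{u, v}. odd (snd t - fst t)} = {v}" "{t\<in>{u, v}. even (snd t - fst t)} = {u}" using that by auto
      thus ?thesis by simp
    qed
    ultimately show ?thesis
    proof (elim disjE conjE)
      assume "l = {(k, c), (k, c + 1)}"
      thus ?thesis by (simp only:) (rule U, simp)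
    next
      assume "l = {(k, c), (k - 1, c)}"
      thus ?thesis by (simp only:) (rule U, simp)
    qed
  qed
  show ?thesis using cnt[of "\<lambda>t. odd (snd t - fst t)"] cnt[of "\<lambda>t. even (snd t - fst t)"] brick1 by simp
qed

text \<open>The excess of up-pointing cells is calibrated instead of counted: the dents
  \<open>{..<e}\<close> give a positive sum, so removing \<open>e\<close> dents balances the
  trapezoid, and any other number of dents leaves it unbalanced.\<close>

lemma brick_sum_dented_trapezoid_zero:
  assumes e: "0 < e" "e \<le> N" and P: "P \<subseteq> {..<N}" "card P \<noteq> e"
  shows "brick_sum (trapezoid N e - base_dents P) = 0"
proof (rule ccontr)
  assume nz: "brick_sum (trapezoid N e - base_dents P) \<noteq> 0"
  let ?U = "{t\<in>trapezoid N e. odd (snd t - fst t)}" and ?D = "{t\<in>trapezoid N e. even (snd t - fst t)}"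
  have bal: "card ?D + card Q = card ?U" if Q: "Q \<subseteq> {..<N}" and nz: "brick_sum (trapezoid N e - base_dents Q) \<noteq> 0" for Q
  proof -
    have fQ: "finite Q" using Q finite_subset by blast
    have sub: "base_dents Q \<subseteq> ?U" using Q e by (force simp: base_dents_def trapezoid_def)
    have "card {t\<in>trapezoid N e - base_dents Q. odd (snd t - fst t)} = card {t\<in>trapezoid N e - base_dents Q. even (snd t - fst t)}"
      by (rule brick_sum_nonzero_balanced[OF _ nz]) (simp add: finite_trapezoid)
    moreover have "{t\<in>trapezoid N e - base_dents Q. odd (snd t - fst t)} = ?U - base_dents Q" by blast
    moreover have "{t\<in>trapezoid N e - base_dents Q. even (snd t - fst t)} = ?D" using sub by blast
    ultimately have "card (?U - base_dents Q) = card ?D" by (simp only:)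
    moreover have "card (?U - base_dents Q) = card ?U - card (base_dents Q)"
      by (rule card_Diff_subset[OF _ sub]) (use fQ in \<open>simp add: base_dents_def\<close>)
    moreover have "card (base_dents Q) \<le> card ?U" by (rule card_mono[OF _ sub]) (simp add: finite_trapezoid)
    moreover have "card (base_dents Q) = card Q" by (simp add: base_dents_def card_cartesian_product card_image inj_on_def)
    ultimately show ?thesis by linarith
  qed
  have "hyperfac2 (2 * e) > 0" by (simp add: hyperfac2_double prod_pos)
  hence "brick_sum (trapezoid N e - base_dents {..<e}) \<noteq> 0"
    using brick_sum_dented_trapezoid'[of "{..<e}" N e] sq_vandermonde_pos[of "{..<e}"] e by auto
  hence "card ?D + e = card ?U" using bal[of "{..<e}"] e by auto
  moreover have "card ?D + card P = card ?U" by (rule bal[OF P(1) nz])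
  ultimately show False using P(2) by simp
qed

section \<open>The parts of the plane in brick coordinates\<close>

lemma triangles_in_node: "triangles_in P = node ` {t. node t \<subseteq> P}"
  unfolding triangles_in_def range_node[symmetric] by blast

lemma node_subset_Collect:
  "node (k, c) \<subseteq> {(w, j). \<Phi> w j} \<longleftrightarrow>
    (if odd (c - k) then \<Phi> (c - 1) k \<and> \<Phi> (c + 1) k \<and> \<Phi> c (k + 1)
     else \<Phi> (c - 1) (k + 1) \<and> \<Phi> (c + 1) (k + 1) \<and> \<Phi> c k)"
  by (simp add: node_def up_tri_def down_tri_def add.commute[of 1])

lemma mem_reflect_image: "(k, c) \<in> reflect ` S \<longleftrightarrow> (- 1 - k, c) \<in> S"
proof
  assume "(k, c) \<in> reflect ` S"
  thus "(- 1 - k, c) \<in> S" by (auto simp: reflect_def)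
next
  assume "(- 1 - k, c) \<in> S"
  moreover have "(k, c) = reflect (- 1 - k, c)" by (simp add: reflect_def)
  ultimately show "(k, c) \<in> reflect ` S" by blast
qed

lemma Collect_node_eqI:
  assumes "\<And>k c. node (k, c) \<subseteq> P \<longleftrightarrow> (k, c) \<in> S"
  shows "{t. node t \<subseteq> P} = S"
proof (rule Set.set_eqI)
  fix t show "t \<in> {t. node t \<subseteq> P} \<longleftrightarrow> t \<in> S"
    using assms[of "fst t" "snd t"] by (simp only: mem_Collect_eq prod.collapse)
qed

text \<open>In brick coordinates the zigzag is straight: a cell of either orientation is to the
  right of it iff its column is at least 1.\<close>

lemma zigzag_bounds:
  fixes c k :: int
  shows "odd (c - k) \<Longrightarrow> k mod 2 \<le> c - 1 \<and> (k + 1) mod 2 \<le> c \<longleftrightarrow> 1 \<le> c"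
    "even (c - k) \<Longrightarrow> (k + 1) mod 2 \<le> c - 1 \<and> k mod 2 \<le> c \<longleftrightarrow> 1 \<le> c"
  by presburger+

lemma even_bound:
  fixes c k :: int
  shows "even (c - k) \<Longrightarrow> c \<le> 2 * N - k - 2 \<longleftrightarrow> c \<le> 2 * N - k - 1"
    "odd (c - k) \<Longrightarrow> c + 1 \<le> 2 * N + k \<longleftrightarrow> c \<le> 2 * N + k"
  by presburger+

lemma node_subset_trapezoid:
  "{t. node t \<subseteq> {(w, k). 0 \<le> k \<and> k \<le> 2 * int e - 1 \<and> k mod 2 \<le> w \<and> w \<le> 2 * int N - k}} = trapezoid N e"
proof (rule Collect_node_eqI)
  fix k c
  let ?P = "{(w, k). 0 \<le> k \<and> k \<le> 2 * int e - 1 \<and> k mod 2 \<le> w \<and> w \<le> 2 * int N - k}"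
  have "node (k, c) \<subseteq> ?P \<longleftrightarrow> 0 \<le> k \<and> k < 2 * int e - 1 \<and> 1 \<le> c \<and> c \<le> 2 * int N - k - 1"
  proof (cases "odd (c - k)")
    case True
    have "node (k, c) \<subseteq> ?P \<longleftrightarrow> 0 \<le> k \<and> k < 2 * int e - 1 \<and> (k mod 2 \<le> c - 1 \<and> (k + 1) mod 2 \<le> c) \<and> c \<le> 2 * int N - k - 1"
      unfolding node_subset_Collect if_P[OF True] by linarith
    thus ?thesis unfolding zigzag_bounds(1)[OF True] .
  next
    case False
    hence e: "even (c - k)" by simp
    have "node (k, c) \<subseteq> ?P \<longleftrightarrow> 0 \<le> k \<and> k < 2 * int e - 1 \<and> ((k + 1) mod 2 \<le> c - 1 \<and> k mod 2 \<le> c) \<and> c \<le> 2 * int N - k - 2"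
      unfolding node_subset_Collect if_not_P[OF False] by linarith
    thus ?thesis unfolding zigzag_bounds(2)[OF e] even_bound(1)[OF e] .
  qed
  thus "node (k, c) \<subseteq> ?P \<longleftrightarrow> (k, c) \<in> trapezoid N e"
    by (simp only: trapezoid_def mem_Collect_eq prod.case)
qed

text \<open>The slanted indentation at the right end is treated as one more triangular hole, with
  base from \<open>L\<close> to \<open>L + z\<close>, in a trapezoid with a base longer by
  \<open>z\<close>. This is the reason for the last term \<open>z\<close> of
  \<open>t_minus\<close>.\<close>

lemma node_subset_lower:
  "{t. node t \<subseteq> {(w, k). - (2 * int e - 1) \<le> k \<and> k \<le> 0 \<and> k mod 2 \<le> w \<and>
      w \<le> 2 * int L - k \<and> w \<le> 2 * (int L + int z) + k}} =
    reflect ` (trapezoid (L + z) e - hole L (L + z))"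
proof (rule Collect_node_eqI)
  fix k c
  let ?P = "{(w, k). - (2 * int e - 1) \<le> k \<and> k \<le> 0 \<and> k mod 2 \<le> w \<and>
      w \<le> 2 * int L - k \<and> w \<le> 2 * (int L + int z) + k}"
  have "node (k, c) \<subseteq> ?P \<longleftrightarrow> - (2 * int e - 1) \<le> k \<and> k \<le> - 1 \<and> 1 \<le> c \<and>
      c \<le> 2 * int L - k - 1 \<and> c \<le> 2 * (int L + int z) + k"
  proof (cases "odd (c - k)")
    case True
    have "node (k, c) \<subseteq> ?P \<longleftrightarrow> - (2 * int e - 1) \<le> k \<and> k \<le> - 1 \<and> (k mod 2 \<le> c - 1 \<and> (k + 1) mod 2 \<le> c) \<and>
        c \<le> 2 * int L - k - 1 \<and> c + 1 \<le> 2 * (int L + int z) + k"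
      unfolding node_subset_Collect if_P[OF True] by linarith
    thus ?thesis unfolding zigzag_bounds(1)[OF True] even_bound(2)[OF True] .
  next
    case False
    hence e: "even (c - k)" by simp
    have "node (k, c) \<subseteq> ?P \<longleftrightarrow> - (2 * int e - 1) \<le> k \<and> k \<le> - 1 \<and> ((k + 1) mod 2 \<le> c - 1 \<and> k mod 2 \<le> c) \<and>
        c \<le> 2 * int L - k - 2 \<and> c \<le> 2 * (int L + int z) + k"
      unfolding node_subset_Collect if_not_P[OF False] by linarith
    thus ?thesis unfolding zigzag_bounds(2)[OF e] even_bound(1)[OF e] .
  qed
  also have "\<dots> \<longleftrightarrow> (k, c) \<in> reflect ` (trapezoid (L + z) e - hole L (L + z))"
    unfolding mem_reflect_image trapezoid_def hole_def Diff_iff mem_Collect_eq prod.case of_nat_add by linarith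
  finally show "node (k, c) \<subseteq> ?P \<longleftrightarrow> (k, c) \<in> reflect ` (trapezoid (L + z) e - hole L (L + z))" .
qed

lemma node_subset_up_hole: "{t. node t \<subseteq> up_hole (int p) (int q)} = hole p q"
proof -
  have "node (k, c) \<subseteq> {(w, k). 0 \<le> k \<and> 2 * int p + k \<le> w \<and> w \<le> 2 * int q - k} \<longleftrightarrow>
    0 \<le> k \<and> 2 * int p + k + 1 \<le> c \<and> c \<le> 2 * int q - k - 1" for k c
    unfolding node_subset_Collect by (cases "odd (c - k)") (simp_all only: if_True if_False simp_thms, presburger+)
  thus ?thesis unfolding up_hole_def by (intro Collect_node_eqI) (simp only: hole_def mem_Collect_eq prod.case)
qed

lemma node_subset_down_hole: "{t. node t \<subseteq> down_hole (int p) (int q)} = reflect ` hole p q"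
proof -
  have "node (k, c) \<subseteq> {(w, k). k \<le> 0 \<and> 2 * int p - k \<le> w \<and> w \<le> 2 * int q + k} \<longleftrightarrow>
    0 \<le> - 1 - k \<and> 2 * int p + (- 1 - k) + 1 \<le> c \<and> c \<le> 2 * int q - (- 1 - k) - 1" for k c
    unfolding node_subset_Collect by (cases "odd (c - k)") (simp_all only: if_True if_False simp_thms, presburger+)
  hence "node (k, c) \<subseteq> {(w, k). k \<le> 0 \<and> 2 * int p - k \<le> w \<and> w \<le> 2 * int q + k} \<longleftrightarrow>
    (k, c) \<in> reflect ` hole p q" for k c
    unfolding mem_reflect_image by (simp only: hole_def mem_Collect_eq prod.case)
  thus ?thesis unfolding down_hole_def by (rule Collect_node_eqI)
qed

section \<open>Ferns and their dents\<close>

definition left_half_plane :: "nat \<Rightarrow> point set" where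
  "left_half_plane q = {(k, c). 0 \<le> k \<and> c \<le> 2 * int q - k - 1}"

lemma node_subset_half_plane:
  "{t. node t \<subseteq> {(w, k). k \<le> 0 \<and> w \<le> 2 * int q + k}} = reflect ` left_half_plane q"
proof -
  have "node (k, c) \<subseteq> {(w, k). k \<le> 0 \<and> w \<le> 2 * int q + k} \<longleftrightarrow>
    0 \<le> - 1 - k \<and> c \<le> 2 * int q - (- 1 - k) - 1" for k c
    unfolding node_subset_Collect by (cases "odd (c - k)") (simp_all only: if_True if_False simp_thms, presburger+)
  hence "node (k, c) \<subseteq> {(w, k). k \<le> 0 \<and> w \<le> 2 * int q + k} \<longleftrightarrow>
    (k, c) \<in> reflect ` left_half_plane q" for k c
    unfolding mem_reflect_image by (simp only: left_half_plane_def mem_Collect_eq prod.case)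
  thus ?thesis by (rule Collect_node_eqI)
qed

section \<open>Partial sums, blocks and the dents of a sequence\<close>

lemma partial_sum_0 [simp]: "partial_sum s 0 = 0"
  by (simp add: partial_sum_def)

lemma partial_sum_Suc [simp]: "partial_sum s (Suc k) = partial_sum s k + term_at s (Suc k)"
  by (simp add: partial_sum_def)

lemma partial_sum_mono: "i \<le> j \<Longrightarrow> partial_sum s i \<le> partial_sum s j"
  unfolding partial_sum_def by (rule sum_mono2) auto

lemma partial_sum_length: "length s \<le> k \<Longrightarrow> partial_sum s k = sum_list s"
proof (induction k rule: dec_induct)
  case base
  have "(\<Sum>i = 1..length s. term_at s i) = (\<Sum>i<length s. s ! i)"
    by (rule sum.reindex_bij_witness[of _ Suc "\<lambda>i. i - 1"]) (auto simp: term_at_def)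
  thus ?case by (simp add: partial_sum_def sum_list_sum_nth atLeast0LessThan)
next
  case (step k)
  thus ?case by (simp add: term_at_def)
qed

lemma partial_sum_le: "partial_sum s k \<le> sum_list s"
  using partial_sum_mono[of k "max k (length s)" s] partial_sum_length[of s "max k (length s)"] by simp

lemma partial_sum_diff: "1 \<le> i \<Longrightarrow> partial_sum s i = partial_sum s (i - 1) + term_at s i"
  by (cases i) auto

lemma odd_sum_add_even_sum: "odd_sum s + even_sum s = sum_list s"
proof -
  have "odd_sum s + even_sum s = (\<Sum>i\<in>{i\<in>{1..length s}. odd i} \<union> {i\<in>{1..length s}. even i}. term_at s i)"
    unfolding odd_sum_def even_sum_def by (rule sum.union_disjoint[symmetric]) auto
  also have "{i\<in>{1..length s}. odd i} \<union> {i\<in>{1..length s}. even i} = {1..length s}" by auto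
  finally show ?thesis using partial_sum_length[of s "length s"] by (simp add: partial_sum_def)
qed

lemma card_UN_intervals:
  fixes p q :: "'i \<Rightarrow> nat"
  assumes "finite I" "\<And>i j. i \<in> I \<Longrightarrow> j \<in> I \<Longrightarrow> i \<noteq> j \<Longrightarrow> q i \<le> p j \<or> q j \<le> p i"
  shows "card (\<Union>i\<in>I. {p i..<q i}) = (\<Sum>i\<in>I. q i - p i)"
proof (subst card_UN_disjoint[OF assms(1)])
  show "\<forall>i\<in>I. \<forall>j\<in>I. i \<noteq> j \<longrightarrow> {p i..<q i} \<inter> {p j..<q j} = {}" using assms(2) by fastforce
qed auto

lemma blocks_ordered: "i \<noteq> j \<Longrightarrow> partial_sum s i \<le> partial_sum s (j - 1) \<or> partial_sum s j \<le> partial_sum s (i - 1)"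
proof -
  assume "i \<noteq> j"
  hence "i \<le> j - 1 \<or> j \<le> i - 1" by linarith
  thus ?thesis using partial_sum_mono by blast
qed

text \<open>The shape \<open>H\<close> placed on a block is a parameter, so that
  \<open>t_plus\<close> and \<open>t_minus\<close> are analysed once for both the dents
  (\<open>H\<close> an interval) and the removed triangles (\<open>H = hole\<close>).\<close>

definition even_blocks :: "(nat \<Rightarrow> nat \<Rightarrow> 'c set) \<Rightarrow> nat list \<Rightarrow> 'c set" where
  "even_blocks H t = (\<Union>i\<in>{1..length t div 2}. H (partial_sum t (2 * i - 1)) (partial_sum t (2 * i)))"

abbreviation dents :: "nat list \<Rightarrow> nat set" where
  "dents t \<equiv> even_blocks (\<lambda>p q. {p..<q}) t"

lemma even_blocks_ordered:
  "i \<noteq> j \<Longrightarrow> partial_sum t (2 * i) \<le> partial_sum t (2 * j - 1) \<or> partial_sum t (2 * j) \<le> partial_sum t (2 * i - 1)"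
  using blocks_ordered[of "2 * i" "2 * j" t] by simp

lemma card_dents:
  assumes "even (length t)"
  shows "card (dents t) = even_sum t"
proof -
  have "card (dents t) = (\<Sum>i\<in>{1..length t div 2}. partial_sum t (2 * i) - partial_sum t (2 * i - 1))"
    unfolding even_blocks_def by (rule card_UN_intervals) (use even_blocks_ordered in auto)
  also have "\<dots> = even_sum t" unfolding even_sum_def
    by (rule sum.reindex_bij_witness[of _ "\<lambda>i. i div 2" "\<lambda>i. 2 * i"]) (use assms in \<open>auto simp: partial_sum_diff[of "2 * _"] elim!: evenE\<close>)
  finally show ?thesis .
qed

lemma dents_subset: "dents t \<subseteq> {..<sum_list t}"
  unfolding even_blocks_def using partial_sum_le[of t] by (fastforce intro: less_le_trans)

lemma finite_dents: "finite (dents t)"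
  using dents_subset finite_subset by blast

lemma hole_subset_trapezoid:
  assumes "q \<le> N" "q \<le> p + e"
  shows "hole p q \<subseteq> trapezoid N e"
  using assms by (auto simp: hole_def trapezoid_def)

text \<open>A block is part of the dents, of which there are \<open>even_sum t\<close>. So every
  hole is low enough to fit into the trapezoid.\<close>

lemma even_block_length_le:
  assumes "even (length t)" "i \<in> {1..length t div 2}"
  shows "partial_sum t (2 * i) \<le> partial_sum t (2 * i - 1) + even_sum t"
proof -
  have "{partial_sum t (2 * i - 1)..<partial_sum t (2 * i)} \<subseteq> dents t"
    unfolding even_blocks_def using assms(2) by blast
  from card_mono[OF finite_dents this] show ?thesis using card_dents[OF assms(1)] by simp
qed

lemma brick_sum_even_blocks:
  assumes "finite R" "even_blocks hole t \<subseteq> R"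
  shows "brick_sum (R - base_dents (dents t)) = brick_sum (R - even_blocks hole t)"
  unfolding even_blocks_def
proof (rule brick_sum_holes)
  show "hole (partial_sum t (2 * i - 1)) (partial_sum t (2 * i)) \<subseteq> R" if "i \<in> {1..length t div 2}" for i
    using assms(2) that unfolding even_blocks_def by blast
qed (use assms(1) even_blocks_ordered in simp_all)

lemma K'_eq:
  assumes "even (length t)"
  shows "K' t = sq_vandermonde (dents t) / hyperfac2 (2 * even_sum t)"
\<comment> \<open>Without dents the product formula is an empty product, in agreement with the
  convention that \<open>K'\<close> is 1.\<close>
proof (cases "even_sum t = 0")
  case True
  hence "dents t = {}" using card_dents[OF assms] finite_dents[of t] by simp
  thus ?thesis using True by (simp add: K'_def hyperfac2_def)
next
  case False
  let ?e = "even_sum t" and ?N = "odd_sum t + even_sum t"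
  let ?H = "even_blocks hole t"
  have N: "?N = sum_list t" by (rule odd_sum_add_even_sum)
  have sub: "?H \<subseteq> trapezoid ?N ?e"
  proof -
    have "hole (partial_sum t (2 * i - 1)) (partial_sum t (2 * i)) \<subseteq> trapezoid ?N ?e" if "i \<in> {1..length t div 2}" for i
      using even_block_length_le[OF assms that] partial_sum_le[of t "2 * i"] N by (intro hole_subset_trapezoid) auto
    thus ?thesis unfolding even_blocks_def by blast
  qed
  have "quartered_hexagon t = node ` trapezoid ?N ?e - node ` ?H"
    unfolding quartered_hexagon_def triangles_in_node node_subset_trapezoid node_subset_up_hole even_blocks_def image_UN ..
  also have "\<dots> = node ` (trapezoid ?N ?e - ?H)" by (rule image_set_diff[OF inj_node, symmetric])
  finally have "K' t = tiling_sum (zigzag_weight (zigzag 0 (2 * int ?e - 1))) (node ` (trapezoid ?N ?e - ?H))"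
    using False by (simp add: K'_def)
  also have "\<dots> = brick_sum (trapezoid ?N ?e - ?H)"
    by (rule tiling_sum_node) (auto simp: zigzag_eq trapezoid_def)
  also have "\<dots> = brick_sum (trapezoid ?N ?e - base_dents (dents t))"
    by (rule brick_sum_even_blocks[symmetric, OF finite_trapezoid sub])
  also have "\<dots> = sq_vandermonde (dents t) / hyperfac2 (2 * ?e)"
    by (rule brick_sum_dented_trapezoid') (use dents_subset[of t] N card_dents[OF assms] in auto)
  finally show ?thesis .
qed

section \<open>The blocks of \<open>t_plus\<close> and \<open>t_minus\<close>\<close>

lemma term_at_append:
  "term_at (u @ v) i = (if i \<le> length u then term_at u i else term_at v (i - length u))"
  by (auto simp: term_at_def nth_append)

lemma term_at_Cons: "term_at (u # v) i = (if i = 0 then 0 else if i = 1 then u else term_at v (i - 1))"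
  by (auto simp: term_at_def nth_Cons')

lemma term_at_map: "1 \<le> i \<Longrightarrow> i \<le> length u \<Longrightarrow> term_at (map f u) i = f (u ! (i - 1))"
  by (simp add: term_at_def)

lemma term_at_eq_0: "length s < i \<Longrightarrow> term_at s i = 0"
  by (simp add: term_at_def)

text \<open>\<open>H p p = {}\<close> lets the blocks of length 0 beyond the end of a sequence be ignored.\<close>

lemma even_blocks_t_plus:
  fixes H :: "nat \<Rightarrow> nat \<Rightarrow> 'c set" and x y :: nat and a b :: "nat list"
  assumes H: "\<And>p. H p p = {}"
  defines "L \<equiv> x + y + sum_list a + sum_list b"
  shows "even_blocks H (t_plus x y a b) =
     (\<Union>i\<in>{i\<in>{1..length a}. even i}. H (partial_sum a (i - 1)) (partial_sum a i)) \<union>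
     (\<Union>j\<in>{j\<in>{1..length b}. odd j}. H (L - partial_sum b j) (L - partial_sum b (j - 1)))"
    and "even (length (t_plus x y a b))" and "sum_list (t_plus x y a b) = L"
proof -
  define m where "m = 2 * (length (nonempty_seq a) div 2)"
  define n where "n = 2 * ((length (nonempty_seq b) + 1) div 2) - 1"
  define t where "t = t_plus x y a b"
  \<comment> \<open>As \<open>m\<close> is even and \<open>n\<close> is odd, the middle term of
    \<open>t\<close> has the odd number \<open>m + 1\<close> and is a gap. The even-numbered blocks
    are the even terms of \<open>a\<close> to its left and, read backwards, the odd terms of
    \<open>b\<close> to its right.\<close>
  have m: "even m" "length a \<le> m + 1" "m \<le> length a"
    by (auto simp: m_def nonempty_seq_def)
  have n: "odd n" "length b \<le> n + 1" "\<And>j. odd j \<Longrightarrow> j \<le> length b \<Longrightarrow> j \<le> n"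
    by (auto simp: n_def nonempty_seq_def; presburger)+
  have nn: "2 * ((length (nonempty_seq b) + 1) div 2) = n + 1" using n(1) unfolding n_def by presburger
  have t: "t = map (term_at a) [1..<m + 1] @ [term_at a (m + 1) + x + y + term_at b (n + 1)] @ map (term_at b) (rev [1..<n + 1])"
    unfolding t_def t_plus_def Let_def m_def[symmetric] nn ..
  have len: "length t = m + 1 + n" by (simp add: t)
  have ta: "term_at t i = term_at a i" if "1 \<le> i" "i \<le> m" for i
    using that by (simp add: t term_at_append term_at_Cons term_at_map del: upt_Suc)
  have tm: "term_at t (m + 1) = term_at a (m + 1) + x + y + term_at b (n + 1)"
    by (simp add: t term_at_append term_at_Cons del: upt_Suc)
  have tb: "term_at t (m + 1 + r) = term_at b (n + 1 - r)" if "1 \<le> r" "r \<le> n" for r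
  proof -
    have "rev [1..<n + 1] ! (r - 1) = n + 1 - r" using that by (simp add: rev_nth del: upt_Suc)
    thus ?thesis using that by (simp add: t term_at_append term_at_Cons term_at_map del: upt_Suc)
  qed
  have pa: "partial_sum t i = partial_sum a i" if "i \<le> m" for i
    unfolding partial_sum_def by (rule sum.cong) (use that ta in auto)
  \<comment> \<open>To the right of the gap positions are measured from the right end
    \<open>L\<close>: after \<open>s\<close> terms of the tail, the first \<open>n - s\<close> terms
    of \<open>b\<close> are still to come.\<close>
  have pb: "partial_sum t (m + 1 + s) + partial_sum b (n - s) = L" if "s \<le> n" for s
    using that
  proof (induction s)
    case 0
    have "partial_sum t (m + 1) = partial_sum a (m + 1) + x + y + term_at b (n + 1)" using pa[of m] tm by simp
    moreover have "partial_sum a (m + 1) = sum_list a" by (rule partial_sum_length[OF m(2)])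
    moreover have "partial_sum b n + term_at b (n + 1) = sum_list b" using partial_sum_length[OF n(2)] by simp
    ultimately show ?case by (simp add: L_def)
  next
    case (Suc s)
    have "n - s = Suc (n - Suc s)" using Suc.prems by simp
    hence "partial_sum b (n - s) = partial_sum b (n - Suc s) + term_at b (n - s)" by (simp only: partial_sum_Suc)
    moreover have "partial_sum t (m + 1 + Suc s) = partial_sum t (m + 1 + s) + term_at b (n - s)"
      using tb[of "Suc s"] Suc.prems by simp
    ultimately show ?case using Suc by simp
  qed
  show "even (length (t_plus x y a b))" using len m(1) n(1) by (simp add: t_def)
  show "sum_list (t_plus x y a b) = L"
    using pb[of n] partial_sum_length[of t "m + 1 + n"] len by (simp add: t_def)
  let ?A = "\<lambda>i. H (partial_sum a (i - 1)) (partial_sum a i)"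
  let ?B = "\<lambda>j. H (L - partial_sum b j) (L - partial_sum b (j - 1))"
  have blockA: "H (partial_sum t (2 * i - 1)) (partial_sum t (2 * i)) = ?A (2 * i)" if "2 * i \<le> m" for i
    using pa[of "2 * i"] pa[of "2 * i - 1"] that by simp
  have blockB: "H (partial_sum t (2 * i - 1)) (partial_sum t (2 * i)) = ?B (n - s)"
    if "2 * i = m + 2 + s" "s < n" for i s
  proof -
    have "partial_sum t (2 * i) + partial_sum b (n - s - 1) = L" using pb[of "Suc s"] that by simp
    moreover have "partial_sum t (2 * i - 1) + partial_sum b (n - s) = L" using pb[of s] that by simp
    ultimately show ?thesis by (metis add_diff_cancel_right')
  qed
  show "even_blocks H (t_plus x y a b) = (\<Union>i\<in>{i\<in>{1..length a}. even i}. ?A i) \<union> (\<Union>j\<in>{j\<in>{1..length b}. odd j}. ?B j)"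
    (is "?l = ?r")
  proof (intro equalityI subsetI)
    fix u assume "u \<in> ?l"
    then obtain i where i: "1 \<le> i" "2 * i \<le> m + 1 + n" "u \<in> H (partial_sum t (2 * i - 1)) (partial_sum t (2 * i))"
      unfolding even_blocks_def t_def[symmetric] len by auto
    show "u \<in> ?r"
    proof (cases "2 * i \<le> m")
      case True
      hence "u \<in> ?A (2 * i)" "2 * i \<in> {i\<in>{1..length a}. even i}" using i m blockA[of i] by auto
      thus ?thesis by blast
    next
      case False
      define s where "s = 2 * i - m - 2"
      have i2: "m + 2 \<le> 2 * i" using False m(1) by presburger
      have "0 < n" using n(1) by presburger
      with i2 have s: "2 * i = m + 2 + s" "s < n" using i(2) by (auto simp: s_def)
      have "even s" using s(1) m(1) by presburger
      note s = s this
      hence u: "u \<in> ?B (n - s)" using i(3) blockB by simp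
      have "n - s \<le> length b"
      proof (rule ccontr)
        assume "\<not> n - s \<le> length b"
        hence "partial_sum b (n - s) = partial_sum b (n - s - 1)" using partial_sum_diff[of "n - s" b] s(2) by (simp add: term_at_eq_0)
        thus False using u H by simp
      qed
      moreover have "odd (n - s)" using n(1) s by simp
      ultimately show ?thesis using u s(2) by (intro UnI2 UN_I[of "n - s"]) auto
    qed
  next
    fix u assume "u \<in> ?r"
    thus "u \<in> ?l"
    proof
      assume "u \<in> (\<Union>i\<in>{i\<in>{1..length a}. even i}. ?A i)"
      then obtain i where i: "1 \<le> i" "i \<le> length a" "even i" "u \<in> ?A i" by auto
      then obtain k where k: "i = 2 * k" by blast
      have "i \<le> m" using i(2,3) m(1,2) by presburger
      hence "u \<in> H (partial_sum t (2 * k - 1)) (partial_sum t (2 * k))" using i(4) blockA[of k] k by simp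
      moreover have "k \<in> {1..length t div 2}" using k i \<open>i \<le> m\<close> len by auto
      ultimately show ?thesis unfolding even_blocks_def t_def[symmetric] by blast
    next
      assume "u \<in> (\<Union>j\<in>{j\<in>{1..length b}. odd j}. ?B j)"
      then obtain j where j: "1 \<le> j" "j \<le> length b" "odd j" "u \<in> ?B j" by auto
      have jn: "j \<le> n" using n(3) j by blast
      have "even (m + 2 + (n - j))" using m(1) n(1) j(3) jn by simp
      then obtain k where k: "m + 2 + (n - j) = 2 * k" by blast
      have "n - (n - j) = j" "n - j < n" using jn j(1) by auto
      hence "u \<in> H (partial_sum t (2 * k - 1)) (partial_sum t (2 * k))" using blockB[OF k[symmetric]] j(4) by (simp only:)
      moreover have "k \<in> {1..length t div 2}" using k j(1) jn len by auto
      ultimately show ?thesis unfolding even_blocks_def t_def[symmetric] by blast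
    qed
  qed
qed

text \<open>The leading 0 shifts the numbering of \<open>a\<close>, so that its odd terms become the
  even blocks. Here \<open>m\<close> is odd and \<open>n\<close> even; the middle term, numbered
  \<open>m + 2\<close>, is a gap again, and the last term \<open>z\<close> is the block from
  \<open>L\<close> to \<open>L + z\<close>. The first block, of length \<open>term_at a 1\<close>,
  will have to be exchanged for the half triangle.\<close>

lemma even_blocks_t_minus:
  fixes H :: "nat \<Rightarrow> nat \<Rightarrow> 'c set" and x y z :: nat and a b :: "nat list"
  assumes H: "\<And>p. H p p = {}"
  defines "L \<equiv> x + y + sum_list a + sum_list b"
  shows "even_blocks H (t_minus x y z a b) =
     (\<Union>i\<in>{i\<in>{1..length a}. odd i}. H (partial_sum a (i - 1)) (partial_sum a i)) \<union>
     (\<Union>j\<in>{j\<in>{1..length b}. even j}. H (L - partial_sum b j) (L - partial_sum b (j - 1))) \<union> H L (L + z)"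
    and "even (length (t_minus x y z a b))" and "sum_list (t_minus x y z a b) = L + z"
    and "2 \<le> length (t_minus x y z a b)"
    and "partial_sum (t_minus x y z a b) 1 = 0" and "partial_sum (t_minus x y z a b) 2 = term_at a 1"
proof -
  define m where "m = 2 * ((length (nonempty_seq a) + 1) div 2) - 1"
  define n where "n = 2 * (length (nonempty_seq b) div 2)"
  define t where "t = t_minus x y z a b"
  have n: "even n" "length b \<le> n + 1" "n \<le> length b"
    by (auto simp: n_def nonempty_seq_def)
  have m: "odd m" "length a \<le> m + 1" "\<And>j. odd j \<Longrightarrow> j \<le> length a \<Longrightarrow> j \<le> m"
    by (auto simp: m_def nonempty_seq_def; presburger)+
  have mm: "2 * ((length (nonempty_seq a) + 1) div 2) = m + 1" using m(1) unfolding m_def by presburger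
  have t: "t = [0] @ map (term_at a) [1..<m + 1] @ [term_at a (m + 1) + x + y + term_at b (n + 1)] @ map (term_at b) (rev [1..<n + 1]) @ [z]"
    unfolding t_def t_minus_def Let_def n_def[symmetric] mm ..
  have len: "length t = m + n + 3" by (simp add: t)
  have ta: "term_at t (Suc i) = term_at a i" if "1 \<le> i" "i \<le> m" for i
    using that by (simp add: t term_at_append term_at_Cons term_at_map del: upt_Suc)
  have t1: "term_at t 1 = 0" by (simp add: t term_at_def)
  have tm: "term_at t (m + 2) = term_at a (m + 1) + x + y + term_at b (n + 1)"
    by (simp add: t term_at_append term_at_Cons del: upt_Suc)
  have tb: "term_at t (m + 2 + r) = term_at b (n + 1 - r)" if "1 \<le> r" "r \<le> n" for r
  proof -
    have "rev [1..<n + 1] ! (r - 1) = n + 1 - r" using that by (simp add: rev_nth del: upt_Suc)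
    thus ?thesis using that by (simp add: t term_at_append term_at_Cons term_at_map del: upt_Suc)
  qed
  have tz: "term_at t (m + n + 3) = z"
    by (simp add: t term_at_append term_at_Cons del: upt_Suc)
  have pa: "partial_sum t (Suc i) = partial_sum a i" if "i \<le> m" for i
    using that by (induction i) (use t1 ta in simp_all)
  have pb: "partial_sum t (m + 2 + s) + partial_sum b (n - s) = L" if "s \<le> n" for s
    using that
  proof (induction s)
    case 0
    have "partial_sum t (m + 2) = partial_sum a (m + 1) + x + y + term_at b (n + 1)" using pa[of m] tm by simp
    moreover have "partial_sum a (m + 1) = sum_list a" by (rule partial_sum_length[OF m(2)])
    moreover have "partial_sum b n + term_at b (n + 1) = sum_list b" using partial_sum_length[OF n(2)] by simp
    ultimately show ?case by (simp add: L_def)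
  next
    case (Suc s)
    have "n - s = Suc (n - Suc s)" using Suc.prems by simp
    hence "partial_sum b (n - s) = partial_sum b (n - Suc s) + term_at b (n - s)" by (simp only: partial_sum_Suc)
    moreover have "partial_sum t (m + 2 + Suc s) = partial_sum t (m + 2 + s) + term_at b (n - s)"
      using tb[of "Suc s"] Suc.prems by simp
    ultimately show ?case using Suc by simp
  qed
  have pz: "partial_sum t (m + n + 2) = L" "partial_sum t (m + n + 3) = L + z"
    using pb[of n] tz by (simp_all add: numeral_3_eq_3 add.assoc add.commute[of n 2])
  show "even (length (t_minus x y z a b))" "2 \<le> length (t_minus x y z a b)" using len m(1) n(1) by (simp_all add: t_def)
  show "sum_list (t_minus x y z a b) = L + z"
    using pz partial_sum_length[of t "m + n + 3"] len by (simp add: t_def)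
  have m1: "1 \<le> m" using m(1) by presburger
  show "partial_sum (t_minus x y z a b) 1 = 0" "partial_sum (t_minus x y z a b) 2 = term_at a 1"
    using pa[of 0] pa[of 1] m1 by (simp_all add: t_def numeral_2_eq_2)
  let ?A = "\<lambda>i. H (partial_sum a (i - 1)) (partial_sum a i)"
  let ?B = "\<lambda>j. H (L - partial_sum b j) (L - partial_sum b (j - 1))"
  have blockA: "H (partial_sum t (2 * i - 1)) (partial_sum t (2 * i)) = ?A (2 * i - 1)" if "1 \<le> i" "2 * i - 1 \<le> m" for i
  proof -
    have "2 * i = Suc (2 * i - 1)" "2 * i - 1 = Suc (2 * i - 1 - 1)" using that(1) by auto
    thus ?thesis using pa[of "2 * i - 1"] pa[of "2 * i - 1 - 1"] that(2) by (metis diff_le_self le_trans)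
  qed
  have blockB: "H (partial_sum t (2 * i - 1)) (partial_sum t (2 * i)) = ?B (n - s)"
    if "2 * i = m + 3 + s" "s < n" for i s
  proof -
    have "partial_sum t (2 * i) + partial_sum b (n - s - 1) = L" using pb[of "Suc s"] that by (simp add: numeral_3_eq_3)
    moreover have "partial_sum t (2 * i - 1) + partial_sum b (n - s) = L" using pb[of s] that by simp
    ultimately show ?thesis by (metis add_diff_cancel_right')
  qed
  show "even_blocks H (t_minus x y z a b) = (\<Union>i\<in>{i\<in>{1..length a}. odd i}. ?A i) \<union> (\<Union>j\<in>{j\<in>{1..length b}. even j}. ?B j) \<union> H L (L + z)"
    (is "?l = ?r")
  proof (intro equalityI subsetI)
    fix u assume "u \<in> ?l"
    then obtain i where i: "1 \<le> i" "2 * i \<le> m + n + 3" "u \<in> H (partial_sum t (2 * i - 1)) (partial_sum t (2 * i))"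
      unfolding even_blocks_def t_def[symmetric] len by auto
    consider "2 * i - 1 \<le> m" | "m < 2 * i - 1" "2 * i < m + n + 3" | "2 * i = m + n + 3" using i(2) by linarith
    thus "u \<in> ?r"
    proof cases
      case 1
      hence u: "u \<in> ?A (2 * i - 1)" using i blockA[of i] by auto
      have "2 * i - 1 \<le> length a"
      proof (rule ccontr)
        assume "\<not> 2 * i - 1 \<le> length a"
        hence "partial_sum a (2 * i - 1) = partial_sum a (2 * i - 1 - 1)"
          using partial_sum_diff[of "2 * i - 1" a] i(1) by (simp add: term_at_eq_0)
        thus False using u H by simp
      qed
      moreover have "odd (2 * i - 1)" using i(1) by presburger
      ultimately show ?thesis using u i(1) by (intro UnI1 UN_I[of "2 * i - 1"]) auto
    next
      case 2
      define s where "s = 2 * i - m - 3"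
      have i2: "m + 3 \<le> 2 * i" using 2 m(1) by presburger
      hence s: "2 * i = m + 3 + s" "s < n" using 2 by (auto simp: s_def)
      have "even s" using s(1) m(1) by presburger
      note s = s this
      hence u: "u \<in> ?B (n - s)" using i(3) blockB by simp
      moreover have "n - s \<in> {j\<in>{1..length b}. even j}" using s n by auto
      ultimately show ?thesis by blast
    next
      case 3
      hence "2 * i - 1 = m + n + 2" by simp
      thus ?thesis using i(3) pz 3 by simp
    qed
  next
    fix u assume "u \<in> ?r"
    then consider "u \<in> (\<Union>i\<in>{i\<in>{1..length a}. odd i}. ?A i)" | "u \<in> (\<Union>j\<in>{j\<in>{1..length b}. even j}. ?B j)" | "u \<in> H L (L + z)"
      by blast
    thus "u \<in> ?l"
    proof cases
      case 1
      then obtain i where i: "1 \<le> i" "i \<le> length a" "odd i" "u \<in> ?A i" by auto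
      have im: "i \<le> m" using m(3) i by blast
      obtain k where k: "i + 1 = 2 * k" using i(3) by (metis even_plus_one_iff evenE)
      hence k1: "1 \<le> k" "2 * k - 1 = i" by auto
      hence "u \<in> H (partial_sum t (2 * k - 1)) (partial_sum t (2 * k))" using i(4) blockA[of k] im by simp
      moreover have "k \<in> {1..length t div 2}" using k im len k1 by auto
      ultimately show ?thesis unfolding even_blocks_def t_def[symmetric] by blast
    next
      case 2
      then obtain j where j: "1 \<le> j" "j \<le> length b" "even j" "u \<in> ?B j" by auto
      have jn: "j \<le> n" using j(2,3) n(1,2) by presburger
      have "even (m + 3 + (n - j))" using m(1) n(1) j(3) jn by simp
      then obtain k where k: "m + 3 + (n - j) = 2 * k" by blast
      have "n - (n - j) = j" "n - j < n" using jn j(1) by auto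
      hence "u \<in> H (partial_sum t (2 * k - 1)) (partial_sum t (2 * k))" using blockB[OF k[symmetric]] j(4) by (simp only:)
      moreover have "k \<in> {1..length t div 2}" using k j(1) jn len by auto
      ultimately show ?thesis unfolding even_blocks_def t_def[symmetric] by blast
    next
      case 3
      have "even (m + n + 3)" using m(1) n(1) by simp
      then obtain k where k: "m + n + 3 = 2 * k" by blast
      hence "2 * k - 1 = m + n + 2" by simp
      hence "u \<in> H (partial_sum t (2 * k - 1)) (partial_sum t (2 * k))" using 3 pz k by simp
      moreover have "k \<in> {1..length t div 2}" using k len by auto
      ultimately show ?thesis unfolding even_blocks_def t_def[symmetric] by blast
    qed
  qed
qed

lemma UN_blocks: "(\<Union>i\<in>{1..n}. {partial_sum s (i - 1)..<partial_sum s i}) = {..<partial_sum s n}"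
proof (induction n)
  case (Suc n)
  have "{1..Suc n} = insert (Suc n) {1..n}" by auto
  thus ?case using Suc by auto
qed simp

lemma UN_reversed_blocks:
  assumes "partial_sum s n \<le> L"
  shows "(\<Union>j\<in>{1..n}. {L - partial_sum s j..<L - partial_sum s (j - 1)}) = {L - partial_sum s n..<L}"
  using assms
proof (induction n)
  case (Suc n)
  have "{1..Suc n} = insert (Suc n) {1..n}" by auto
  thus ?case using Suc by auto
qed simp

lemma reversed_blocks_ordered:
  "i \<noteq> j \<Longrightarrow> L - partial_sum s (i - 1) \<le> L - partial_sum s j \<or> L - partial_sum s (j - 1) \<le> L - partial_sum s i"
  using blocks_ordered[of j i s] diff_le_mono2 by blast

text \<open>Every lobe of a fern points either up or down and so supplies dents to exactly one of
  the two sequences. Their union is the whole of both ferns, with \<open>z\<close> joined to the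
  right one, and no longer shows how the ferns are subdivided.\<close>

lemma dents_t_plus_t_minus:
  fixes x y z :: nat and a b :: "nat list"
  defines "L \<equiv> x + y + sum_list a + sum_list b"
  shows "dents (t_plus x y a b) \<inter> dents (t_minus x y z a b) = {}"
    and "dents (t_plus x y a b) \<union> dents (t_minus x y z a b) = {..<sum_list a} \<union> {sum_list a + x + y..<L + z}"
    and "even_sum (t_plus x y a b) = even_sum a + odd_sum b"
    and "even_sum (t_minus x y z a b) = odd_sum a + even_sum b + z"
proof -
  let ?A = "\<lambda>Q. \<Union>i\<in>{i\<in>{1..length a}. Q i}. {partial_sum a (i - 1)..<partial_sum a i}"
  let ?B = "\<lambda>Q. \<Union>j\<in>{j\<in>{1..length b}. Q j}. {L - partial_sum b j..<L - partial_sum b (j - 1)}"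
  note P = even_blocks_t_plus(1)[of "\<lambda>p q. {p..<q}" x y a b, folded L_def]
  note M = even_blocks_t_minus(1)[of "\<lambda>p q. {p..<q}" x y z a b, folded L_def]
  have P: "dents (t_plus x y a b) = ?A even \<union> ?B odd" using P by simp
  have M: "dents (t_minus x y z a b) = ?A odd \<union> ?B even \<union> {L..<L + z}" using M by simp
  have sb: "sum_list b \<le> L" "L - sum_list b = sum_list a + x + y" by (simp_all add: L_def)
  have pb: "partial_sum b j \<le> L" for j using partial_sum_le[of b j] sb by simp
  have A: "?A even \<union> ?A odd = {..<sum_list a}"
  proof -
    have "?A even \<union> ?A odd = (\<Union>i\<in>{1..length a}. {partial_sum a (i - 1)..<partial_sum a i})" by blast
    thus ?thesis by (simp only: UN_blocks partial_sum_length[OF order_refl])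
  qed
  have B: "?B odd \<union> ?B even = {sum_list a + x + y..<L}"
  proof -
    have "?B odd \<union> ?B even = (\<Union>j\<in>{1..length b}. {L - partial_sum b j..<L - partial_sum b (j - 1)})" by blast
    thus ?thesis by (simp only: UN_reversed_blocks[OF pb] partial_sum_length[OF order_refl] sb)
  qed
  have AA: "?A even \<inter> ?A odd = {}"
  proof -
    have "{partial_sum a (i - 1)..<partial_sum a i} \<inter> {partial_sum a (j - 1)..<partial_sum a j} = {}" if ij: "even i" "odd j" for i j
    proof -
      have "i \<noteq> j" using ij by auto
      from blocks_ordered[OF this, of a] show ?thesis by auto
    qed
    thus ?thesis by blast
  qed
  have BB: "?B odd \<inter> ?B even = {}"
  proof -
    have "{L - partial_sum b i..<L - partial_sum b (i - 1)} \<inter> {L - partial_sum b j..<L - partial_sum b (j - 1)} = {}"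
      if ij: "odd i" "even j" for i j
    proof -
      have "i \<noteq> j" using ij by auto
      from reversed_blocks_ordered[OF this, of L b] show ?thesis by auto
    qed
    thus ?thesis by blast
  qed
  have AB: "{..<sum_list a} \<inter> {sum_list a + x + y..<L} = {}" "{..<sum_list a} \<inter> {L..<L + z} = {}"
    "{sum_list a + x + y..<L} \<inter> {L..<L + z} = {}"
    by (auto simp: L_def)
  have sub: "?A even \<subseteq> {..<sum_list a}" "?A odd \<subseteq> {..<sum_list a}"
    "?B odd \<subseteq> {sum_list a + x + y..<L}" "?B even \<subseteq> {sum_list a + x + y..<L}"
    unfolding A[symmetric] B[symmetric] by (rule Un_upper1 Un_upper2)+
  have fin: "finite (?A Q)" "finite (?B Q)" for Q by simp_all
  \<comment> \<open>Stated for arbitrary sets, since the concrete unions are too large for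
    automation.\<close>
  have disj: "(EA \<union> OB) \<inter> (OA \<union> EB \<union> Z) = {} \<and> EA \<inter> OB = {} \<and> OA \<inter> EB = {} \<and> (OA \<union> EB) \<inter> Z = {}"
    if "EA \<inter> OA = {}" "OB \<inter> EB = {}" "EA \<subseteq> X" "OA \<subseteq> X" "OB \<subseteq> Y" "EB \<subseteq> Y" "X \<inter> Y = {}" "X \<inter> Z = {}" "Y \<inter> Z = {}"
    for EA OA EB OB X Y Z :: "nat set" using that by blast
  note dis = disj[OF AA BB sub AB]
  show "dents (t_plus x y a b) \<inter> dents (t_minus x y z a b) = {}"
    unfolding P M using dis by (simp only:)
  have W: "{sum_list a + x + y..<L} \<union> {L..<L + z} = {sum_list a + x + y..<L + z}" by (auto simp: L_def)
  have union: "(EA \<union> OB) \<union> (OA \<union> EB \<union> Z) = X \<union> W"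
    if "EA \<union> OA = X" "OB \<union> EB = Y" "Y \<union> Z = W" for EA OA EB OB X Y Z W :: "nat set" using that by blast
  show "dents (t_plus x y a b) \<union> dents (t_minus x y z a b) = {..<sum_list a} \<union> {sum_list a + x + y..<L + z}"
    unfolding P M by (rule union[OF A B W])
  have cA: "card (?A Q) = (\<Sum>i\<in>{i\<in>{1..length a}. Q i}. term_at a i)" for Q
  proof -
    have "card (?A Q) = (\<Sum>i\<in>{i\<in>{1..length a}. Q i}. partial_sum a i - partial_sum a (i - 1))"
      by (rule card_UN_intervals) (use blocks_ordered in auto)
    also have "\<dots> = (\<Sum>i\<in>{i\<in>{1..length a}. Q i}. term_at a i)"
      by (rule sum.cong) (auto simp: partial_sum_diff)
    finally show ?thesis .
  qed
  have cB: "card (?B Q) = (\<Sum>j\<in>{j\<in>{1..length b}. Q j}. term_at b j)" for Q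
  proof -
    have "card (?B Q) = (\<Sum>j\<in>{j\<in>{1..length b}. Q j}. (L - partial_sum b (j - 1)) - (L - partial_sum b j))"
      by (rule card_UN_intervals) (use reversed_blocks_ordered in auto)
    also have "\<dots> = (\<Sum>j\<in>{j\<in>{1..length b}. Q j}. term_at b j)"
    proof (rule sum.cong[OF refl])
      fix j assume "j \<in> {j\<in>{1..length b}. Q j}"
      hence "partial_sum b j = partial_sum b (j - 1) + term_at b j" by (intro partial_sum_diff) simp
      thus "(L - partial_sum b (j - 1)) - (L - partial_sum b j) = term_at b j" using pb[of j] by simp
    qed
    finally show ?thesis .
  qed
  have "even_sum (t_plus x y a b) = card (?A even \<union> ?B odd)"
    using card_dents[OF even_blocks_t_plus(2)[of "\<lambda>p q. {p..<q}" x y a b]] P by simp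
  also have "\<dots> = card (?A even) + card (?B odd)"
    by (rule card_Un_disjoint[OF fin]) (use dis in \<open>simp only:\<close>)
  finally show "even_sum (t_plus x y a b) = even_sum a + odd_sum b"
    by (simp only: cA cB even_sum_def odd_sum_def)
  have "even_sum (t_minus x y z a b) = card (?A odd \<union> ?B even \<union> {L..<L + z})"
    using card_dents[OF even_blocks_t_minus(2)[of "\<lambda>p q. {p..<q}" x y z a b]] M by simp
  also have "\<dots> = card (?A odd \<union> ?B even) + card {L..<L + z}"
    by (rule card_Un_disjoint[OF finite_UnI[OF fin] finite_atLeastLessThan]) (use dis in \<open>simp only:\<close>)
  also have "card (?A odd \<union> ?B even) = card (?A odd) + card (?B even)"
    by (rule card_Un_disjoint[OF fin]) (use dis in \<open>simp only:\<close>)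
  finally show "even_sum (t_minus x y z a b) = odd_sum a + even_sum b + z"
    by (simp only: cA cB even_sum_def odd_sum_def card_atLeastLessThan diff_add_inverse)
qed

text \<open>The lower half is given by its mirror image, so that both halves are trapezoids standing
  on their base. It differs from the pattern of \<open>t_minus\<close> only at the zigzag, where the
  first triangle is widened to a half triangle.\<close>

lemma RW_region_node:
  fixes x y z :: nat and a b :: "nat list"
  defines "L \<equiv> x + y + sum_list a + sum_list b"
  shows "RW_region x y z a b = node `
    ((trapezoid L (y + even_sum a + odd_sum b) - even_blocks hole (t_plus x y a b)) \<union>
     reflect ` (trapezoid (L + z) (y + z + odd_sum a + even_sum b) - even_blocks hole (t_minus x y z a b) - half_hole (term_at a 1)))"
proof -
  let ?T1 = "trapezoid L (y + even_sum a + odd_sum b)" and ?T2 = "trapezoid (L + z) (y + z + odd_sum a + even_sum b)"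
  let ?ha = "\<lambda>i. hole (partial_sum a (i - 1)) (partial_sum a i)"
  let ?hb = "\<lambda>j. hole (L - partial_sum b j) (L - partial_sum b (j - 1))"
  let ?Up = "(\<Union>i\<in>{i\<in>{1..length a}. even i}. ?ha i) \<union> (\<Union>j\<in>{j\<in>{1..length b}. odd j}. ?hb j)"
  let ?Dn = "(\<Union>i\<in>{i\<in>{2..length a}. odd i}. ?ha i) \<union> (\<Union>j\<in>{j\<in>{1..length b}. even j}. ?hb j)"
  let ?lhp = "left_half_plane (term_at a 1)"
  have iL: "RW_L x y a b - int (partial_sum b j) = int (L - partial_sum b j)" for j
    using partial_sum_le[of b j] by (simp add: RW_L_def L_def)
  have L: "RW_L x y a b = int L" by (simp add: RW_L_def L_def)
  have up: "triangles_in (RW_upper x y a b) = node ` ?T1"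
    unfolding RW_upper_def RW_A_def L triangles_in_node node_subset_trapezoid[symmetric] by simp
  have lo: "triangles_in (RW_lower x y z a b) = node ` reflect ` (?T2 - hole L (L + z))"
    unfolding RW_lower_def RW_B_def L triangles_in_node node_subset_lower[symmetric] by simp
  have half: "triangles_in {(w, k). k \<le> 0 \<and> w \<le> 2 * int (term_at a 1) + k} = node ` reflect ` ?lhp"
    unfolding triangles_in_node node_subset_half_plane ..
  have h: "triangles_in (up_hole (int p) (int q)) = node ` hole p q"
    "triangles_in (down_hole (int p) (int q)) = node ` reflect ` hole p q" for p q
    by (simp_all only: triangles_in_node node_subset_up_hole node_subset_down_hole)
  have hi: "triangles_in ((if Q then up_hole else down_hole) (int p) (int q)) =
      node ` (if Q then hole p q else reflect ` hole p q)" for Q p q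
    by (simp add: h)
  have "RW_removed x y a b = node ` (reflect ` ?lhp \<union>
      (\<Union>i\<in>{2..length a}. if even i then ?ha i else reflect ` ?ha i) \<union>
      (\<Union>j\<in>{1..length b}. if odd j then ?hb j else reflect ` ?hb j))"
    unfolding RW_removed_def iL half hi by (simp only: image_Un image_UN)
  also have "reflect ` ?lhp \<union> (\<Union>i\<in>{2..length a}. if even i then ?ha i else reflect ` ?ha i) \<union>
      (\<Union>j\<in>{1..length b}. if odd j then ?hb j else reflect ` ?hb j) = reflect ` ?lhp \<union> ?Up \<union> reflect ` ?Dn"
  proof -
    have ev: "{i\<in>{1..length a}. even i} = {i\<in>{2..length a}. even i}"
    proof (rule Collect_cong)
      fix i show "i \<in> {1..length a} \<and> even i \<longleftrightarrow> i \<in> {2..length a} \<and> even i"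
        by (cases "i = 1") auto
    qed
    have split: "(\<Union>i\<in>I. if Q i then F i else reflect ` F i) = (\<Union>i\<in>{i\<in>I. Q i}. F i) \<union> reflect ` (\<Union>i\<in>{i\<in>I. \<not> Q i}. F i)"
      for I :: "nat set" and Q and F :: "nat \<Rightarrow> point set" by (auto simp: image_UN split: if_splits)
    show ?thesis unfolding split ev by (simp only: not_not image_Un Un_ac)
  qed
  finally have rem: "RW_removed x y a b = node ` (reflect ` ?lhp \<union> ?Up \<union> reflect ` ?Dn)" .
  have "RW_region x y z a b = node ` ((?T1 \<union> reflect ` (?T2 - hole L (L + z))) - (reflect ` ?lhp \<union> ?Up \<union> reflect ` ?Dn))"
    unfolding RW_region_def up lo rem image_Un[symmetric] by (rule image_set_diff[OF inj_node, symmetric])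
  also have "(?T1 \<union> reflect ` (?T2 - hole L (L + z))) - (reflect ` ?lhp \<union> ?Up \<union> reflect ` ?Dn) =
      (?T1 - ?Up) \<union> reflect ` (?T2 - hole L (L + z) - ?lhp - ?Dn)"
  proof -
    have neg: "reflect ` S \<inter> S' = {}" if "\<And>t. t \<in> S \<Longrightarrow> 0 \<le> fst t" "\<And>t. t \<in> S' \<Longrightarrow> 0 \<le> fst t" for S S'
    proof (rule equals0I)
      fix t assume t: "t \<in> reflect ` S \<inter> S'"
      then obtain s where "s \<in> S" "t = reflect s" by blast
      thus False using that(1)[of s] that(2)[of t] t by (simp add: reflect_def)
    qed
    have p: "0 \<le> fst t" if "t \<in> ?T1 \<or> t \<in> ?T2 - hole L (L + z) \<or> t \<in> ?lhp \<or> t \<in> ?Up \<or> t \<in> ?Dn" for t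
      using that by (auto simp: trapezoid_def left_half_plane_def hole_def)
    have sets: "(T \<union> R) - (A \<union> B \<union> C) = (T - B) \<union> (R - A - C)"
      if "A \<inter> T = {}" "C \<inter> T = {}" "R \<inter> B = {}" for T R A B C :: "point set" using that by blast
    have "reflect ` ?lhp \<inter> ?T1 = {}" "reflect ` ?Dn \<inter> ?T1 = {}" "reflect ` (?T2 - hole L (L + z)) \<inter> ?Up = {}"
      by (rule neg; use p in blast)+
    moreover have "reflect ` (?T2 - hole L (L + z) - ?lhp - ?Dn) = reflect ` (?T2 - hole L (L + z)) - reflect ` ?lhp - reflect ` ?Dn"
      by (simp only: image_set_diff[OF inj_reflect])
    ultimately show ?thesis by (simp only: sets)
  qed
  also have "?Up = even_blocks hole (t_plus x y a b)"
    using even_blocks_t_plus(1)[of hole x y a b, folded L_def] by (simp add: hole_def)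
  also have "?T2 - hole L (L + z) - ?lhp - ?Dn = ?T2 - even_blocks hole (t_minus x y z a b) - half_hole (term_at a 1)"
  proof -
    have M: "even_blocks hole (t_minus x y z a b) =
      (\<Union>i\<in>{i\<in>{1..length a}. odd i}. ?ha i) \<union> (\<Union>j\<in>{j\<in>{1..length b}. even j}. ?hb j) \<union> hole L (L + z)"
      using even_blocks_t_minus(1)[of hole x y z a b, folded L_def] by (simp add: hole_def)
    \<comment> \<open>The first term of \<open>a\<close> is a block of \<open>t_minus\<close> but
      contributes no full triangle to \<open>RW_removed\<close>. Its hole lies inside the half
      triangle, so removing it as well changes nothing.\<close>
    have h1: "?ha 1 \<subseteq> half_hole (term_at a 1)" by (auto simp: hole_def half_hole_def)
    have sets: "T - Z - P - (A' \<union> B) = T - (A \<union> B \<union> Z) - Q"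
      if "A \<union> Q = A' \<union> Q" "T \<inter> P = T \<inter> Q" for T Z P Q A A' B :: "point set" using that by blast
    have i12: "{i\<in>{1..length a}. odd i} \<subseteq> insert 1 {i\<in>{2..length a}. odd i}"
      "{i\<in>{2..length a}. odd i} \<subseteq> {i\<in>{1..length a}. odd i}" by auto
    have "(\<Union>i\<in>{i\<in>{1..length a}. odd i}. ?ha i) \<union> half_hole (term_at a 1) =
        (\<Union>i\<in>{i\<in>{2..length a}. odd i}. ?ha i) \<union> half_hole (term_at a 1)"
      using h1 i12 by blast
    moreover have "?T2 \<inter> ?lhp = ?T2 \<inter> half_hole (term_at a 1)"
      by (auto simp: trapezoid_def left_half_plane_def half_hole_def)
    ultimately show ?thesis unfolding M by (rule sets)
  qed
  finally show ?thesis .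
qed

lemma M_RW_eq_brick_sum:
  fixes x y z :: nat and a b :: "nat list"
  defines "L \<equiv> x + y + sum_list a + sum_list b"
  shows "M_RW x y z a b = brick_sum
    ((trapezoid L (y + even_sum a + odd_sum b) - even_blocks hole (t_plus x y a b)) \<union>
     reflect ` (trapezoid (L + z) (y + z + odd_sum a + even_sum b) - even_blocks hole (t_minus x y z a b) - half_hole (term_at a 1)))"
  unfolding M_RW_def RW_region_node[of x y z a b, folded L_def]
proof (rule tiling_sum_node)
  show "zigzag 0 (RW_A y a b) \<union> zigzag (- RW_B y z a b) 0 \<subseteq> range zigzag_edge" by (auto simp: zigzag_eq)
  fix p assume "p \<in> (trapezoid L (y + even_sum a + odd_sum b) - even_blocks hole (t_plus x y a b)) \<union>
     reflect ` (trapezoid (L + z) (y + z + odd_sum a + even_sum b) - even_blocks hole (t_minus x y z a b) - half_hole (term_at a 1))"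
  hence "fst p \<in> {0..<RW_A y a b} \<or> fst p \<in> {- RW_B y z a b..<0}"
    by (auto simp: trapezoid_def reflect_def RW_A_def RW_B_def)
  thus "zigzag_edge (fst p) \<in> zigzag 0 (RW_A y a b) \<union> zigzag (- RW_B y z a b) 0"
    unfolding zigzag_eq by blast
qed

lemma even_blocks_hole_subset:
  assumes "even (length t)" "sum_list t \<le> N" "even_sum t \<le> e" "S \<inter> dents t = {}"
  shows "even_blocks hole t \<subseteq> trapezoid N e - base_dents S"
proof -
  have "hole (partial_sum t (2 * i - 1)) (partial_sum t (2 * i)) \<subseteq> trapezoid N e - base_dents S"
    if i: "i \<in> {1..length t div 2}" for i
  proof -
    have "hole (partial_sum t (2 * i - 1)) (partial_sum t (2 * i)) \<subseteq> trapezoid N e"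
      using even_block_length_le[OF assms(1) i] partial_sum_le[of t "2 * i"] assms(2,3) by (intro hole_subset_trapezoid) auto
    moreover have "{partial_sum t (2 * i - 1)..<partial_sum t (2 * i)} \<inter> S = {}"
      using assms(4) i unfolding even_blocks_def by blast
    ultimately show ?thesis using hole_disjoint_base_dents by blast
  qed
  thus ?thesis unfolding even_blocks_def by blast
qed

lemma brick_sum_upper:
  assumes "even (length t)" "sum_list t \<le> N" "even_sum t \<le> e" "S \<inter> dents t = {}"
  shows "brick_sum (trapezoid N e - even_blocks hole t - base_dents S) = brick_sum (trapezoid N e - base_dents (dents t \<union> S))"
proof -
  have "brick_sum (trapezoid N e - base_dents S - base_dents (dents t)) = brick_sum (trapezoid N e - base_dents S - even_blocks hole t)"
    by (rule brick_sum_even_blocks) (use even_blocks_hole_subset[OF assms] finite_trapezoid in auto)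
  moreover have "trapezoid N e - base_dents S - base_dents (dents t) = trapezoid N e - base_dents (dents t \<union> S)"
    by (auto simp: base_dents_Un)
  moreover have "trapezoid N e - base_dents S - even_blocks hole t = trapezoid N e - even_blocks hole t - base_dents S" by blast
  ultimately show ?thesis by simp
qed

text \<open>The first block of \<open>t\<close> touches the zigzag; replacing it by a half triangle costs the forced weights.\<close>

lemma brick_sum_lower:
  assumes t: "even (length t)" "2 \<le> length t" "partial_sum t 1 = 0" "partial_sum t 2 = q"
    and N: "sum_list t \<le> N" "even_sum t \<le> e" "S \<inter> dents t = {}"
  shows "brick_sum (trapezoid N e - base_dents (dents t \<union> S)) =
    (1 / 2) ^ (q - 1) * brick_sum (trapezoid N e - even_blocks hole t - half_hole q - base_dents S)"
proof -
  let ?p = "\<lambda>i. partial_sum t (2 * i - 1)" and ?q = "\<lambda>i. partial_sum t (2 * i)"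
  let ?I = "{2..length t div 2}"
  let ?D = "\<Union>i\<in>?I. {?p i..<?q i}" and ?H = "\<Union>i\<in>?I. hole (?p i) (?q i)"
  have I: "{1..length t div 2} = insert 1 ?I" using t(2) by auto
  have d: "dents t = {0..<q} \<union> ?D" and hh: "even_blocks hole t = hole 0 q \<union> ?H"
    unfolding even_blocks_def I using t(3,4) by simp_all
  have qp: "q \<le> ?p i" if "i \<in> ?I" for i
  proof -
    have "2 \<le> 2 * i - 1" using that by auto
    from partial_sum_mono[OF this, of t] show ?thesis using t(4) by simp
  qed
  have Sq: "S \<inter> {0..<q} = {}" using N(3) unfolding d by blast
  have qe: "q \<le> N" "q \<le> e"
    using even_block_length_le[OF t(1), of 1] partial_sum_le[of t 2] t N by auto
  have hsub: "even_blocks hole t \<subseteq> trapezoid N e - base_dents S" by (rule even_blocks_hole_subset[OF t(1) N])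
  have half_dis: "half_hole q \<inter> hole (?p i) (?q i) = {}" if "i \<in> ?I" for i
    using qp[OF that] by (auto simp: half_hole_def hole_def)
  have half_S: "half_hole q \<inter> base_dents S = {}"
  proof -
    have "q \<le> s" if "s \<in> S" for s using Sq that by (metis atLeastLessThan_iff disjoint_iff le0 not_le)
    thus ?thesis by (fastforce simp: half_hole_def base_dents_def)
  qed
  have "brick_sum (trapezoid N e - base_dents (dents t \<union> S)) =
      brick_sum ((trapezoid N e - base_dents S - base_dents {0..<q}) - base_dents ?D)"
    unfolding d by (rule arg_cong[of _ _ brick_sum]) (auto simp: base_dents_Un)
  also have "\<dots> = brick_sum ((trapezoid N e - base_dents S - base_dents {0..<q}) - ?H)"
  proof (rule brick_sum_holes)
    fix i assume i: "i \<in> ?I"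
    have "{?p i..<?q i} \<inter> {0..<q} = {}" using qp[OF i] by auto
    hence "hole (?p i) (?q i) \<inter> base_dents {0..<q} = {}" by (rule hole_disjoint_base_dents)
    thus "hole (?p i) (?q i) \<subseteq> trapezoid N e - base_dents S - base_dents {0..<q}"
      using hsub i unfolding hh by blast
  qed (use even_blocks_ordered finite_trapezoid in auto)
  also have "(trapezoid N e - base_dents S - base_dents {0..<q}) - ?H = (trapezoid N e - base_dents S - ?H) - base_dents {0..<q}"
    by blast
  also have "brick_sum \<dots> = (1 / 2) ^ (q - 1) * brick_sum ((trapezoid N e - base_dents S - ?H) - half_hole q)"
  proof (rule brick_sum_half_hole)
    have "half_hole q \<subseteq> trapezoid N e" using qe by (auto simp: half_hole_def trapezoid_def)
    thus "half_hole q \<subseteq> trapezoid N e - base_dents S - ?H" using half_S half_dis by blast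
    show "finite (trapezoid N e - base_dents S - ?H)" by (simp add: finite_trapezoid)
  qed (simp add: trapezoid_def)
  also have "(trapezoid N e - base_dents S - ?H) - half_hole q = trapezoid N e - even_blocks hole t - half_hole q - base_dents S"
  proof -
    have "hole 0 q \<subseteq> half_hole q" by (auto simp: hole_def half_hole_def)
    thus ?thesis unfolding hh by blast
  qed
  finally show ?thesis .
qed

lemma base_mem_trapezoid: "(0, 2 * int u + 1) \<in> trapezoid N e \<longleftrightarrow> 0 < e \<and> u < N"
  by (auto simp: trapezoid_def)

lemma base_mem_even_blocks: "(0, 2 * int u + 1) \<in> even_blocks hole t \<longleftrightarrow> u \<in> dents t"
proof -
  have "(0, 2 * int u + 1) \<in> hole p q \<longleftrightarrow> u \<in> {p..<q}" for p q by (auto simp: hole_def)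
  thus ?thesis unfolding even_blocks_def by simp
qed

section \<open>Cutting the region along the base line\<close>

text \<open>\<open>S\<close> consists of the positions of the vertical lozenges across the base
  line, which can stand only on the free stretch between the ferns. The power of 2 undoes the
  weights 1/2 that a full first triangle would force but the half triangle does not.\<close>

lemma M_RW_eq_sum:
  fixes x y z :: nat and a b :: "nat list"
  defines "L \<equiv> x + y + sum_list a + sum_list b" and "tp \<equiv> t_plus x y a b" and "tm \<equiv> t_minus x y z a b"
    and "c \<equiv> sum_list a + x + y"
    and "ep \<equiv> y + even_sum a + odd_sum b" and "em \<equiv> y + z + odd_sum a + even_sum b"
  shows "M_RW x y z a b = (\<Sum>S | S \<subseteq> {sum_list a..<c} \<and> card S = y. (\<Prod>s\<in>S. zigzag_factor s) *
    (2 ^ (term_at a 1 - 1) * (sq_vandermonde (dents tm \<union> S) / hyperfac2 (2 * em)) *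
      (sq_vandermonde (dents tp \<union> S) / hyperfac2 (2 * ep))))"
proof -
  let ?q = "term_at a 1"
  define U where "U = trapezoid L ep - even_blocks hole tp"
  define D where "D = trapezoid (L + z) em - even_blocks hole tm - half_hole ?q"
  let ?R = "U \<union> reflect ` D"
  let ?f = "\<lambda>u. 2 * int u + 1"
  let ?G = "{sum_list a..<c}"
  note tpf = even_blocks_t_plus(2,3)[of "\<lambda>p q. {p..<q}" x y a b, folded tp_def, folded L_def]
  note tmf = even_blocks_t_minus(2-6)[of "\<lambda>p q. {p..<q}" x y z a b, folded tm_def, folded L_def]
  note df = dents_t_plus_t_minus(1,2)[of x y a b z, folded tp_def tm_def, folded L_def c_def]
    dents_t_plus_t_minus(3)[of x y a b, folded tp_def] dents_t_plus_t_minus(4)[of x y z a b, folded tm_def]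
  have tpl: "even (length tp)" "sum_list tp = L" using tpf by auto
  have tml: "even (length tm)" "sum_list tm = L + z" "2 \<le> length tm" "partial_sum tm 1 = 0" "partial_sum tm 2 = ?q"
    using tmf by auto
  have es: "even_sum tp \<le> ep" "even_sum tm \<le> em" "ep = even_sum tp + y" "em = even_sum tm + y"
    using df(3,4) by (simp_all add: ep_def em_def)
  have cL: "c \<le> L" by (simp add: c_def L_def)
  have Gd: "?G \<inter> (dents tp \<union> dents tm) = {}" unfolding df(2) by (auto simp: c_def)
  have Gp: "S \<inter> dents tp = {}" and Gm: "S \<inter> dents tm = {}" if "S \<subseteq> ?G" for S using that Gd by blast+
  have q: "{..<?q} \<subseteq> dents tm"
  proof -
    have "1 \<in> {1..length tm div 2}" using tml(3) by simp
    hence "{partial_sum tm (2 * 1 - 1)..<partial_sum tm (2 * 1)} \<subseteq> dents tm" unfolding even_blocks_def by blast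
    thus ?thesis using tml(4,5) by (simp add: lessThan_atLeast0)
  qed
  \<comment> \<open>If one half has no rows, nothing can cross the line even where the ferns leave
    it free.\<close>
  define A where "A = (if ep = 0 \<or> em = 0 then {} else ?G)"
  have Ueq: "(0, ?f u) \<in> U \<longleftrightarrow> 0 < ep \<and> u < L \<and> u \<notin> dents tp" for u
    unfolding U_def Diff_iff base_mem_trapezoid base_mem_even_blocks by blast
  have Deq: "(0, ?f u) \<in> D \<longleftrightarrow> 0 < em \<and> u < L + z \<and> u \<notin> dents tm" for u
  proof -
    have "(0, ?f u) \<in> half_hole ?q \<longleftrightarrow> u < ?q" by (auto simp: half_hole_def)
    thus ?thesis unfolding D_def Diff_iff base_mem_trapezoid base_mem_even_blocks using q by blast
  qed
  have posU: "0 \<le> fst t" if "t \<in> U" for t using that by (auto simp: U_def trapezoid_def)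
  have negD: "fst t < 0" if "t \<in> reflect ` D" for t using that by (auto simp: D_def trapezoid_def reflect_def)
  have J: "{v. odd (v - 0) \<and> (0, v) \<in> ?R \<and> (0 - 1, v) \<in> ?R} = ?f ` A"
  proof -
    have 1: "(0, v) \<in> ?R \<longleftrightarrow> (0, v) \<in> U" for v using negD[of "(0, v)"] by auto
    have 2: "(0 - 1, v) \<in> ?R \<longleftrightarrow> (0, v) \<in> D" for v using posU[of "(- 1, v)"] by (auto simp: mem_reflect_image)
    have iff: "(0, ?f u) \<in> U \<and> (0, ?f u) \<in> D \<longleftrightarrow> u \<in> A" for u
    proof -
      have "u < L \<and> u \<notin> dents tp \<and> u \<notin> dents tm \<longleftrightarrow> u \<in> ?G"
      proof -
        have "u \<in> dents tp \<union> dents tm \<longleftrightarrow> u < sum_list a \<or> c \<le> u \<and> u < L + z" unfolding df(2) by auto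
        thus ?thesis using cL by auto
      qed
      thus ?thesis unfolding Ueq Deq A_def by auto
    qed
    show ?thesis
    proof (intro equalityI subsetI)
      fix v assume v: "v \<in> {v. odd (v - 0) \<and> (0, v) \<in> ?R \<and> (0 - 1, v) \<in> ?R}"
      hence vUD: "odd v" "(0, v) \<in> U" "(0, v) \<in> D" using 1 2 by auto
      hence "1 \<le> v" by (auto simp: U_def trapezoid_def)
      with vUD(1) have "v = ?f (nat (v div 2))" by (auto elim!: oddE)
      with vUD iff[of "nat (v div 2)"] show "v \<in> ?f ` A" by (metis imageI)
    next
      fix v assume "v \<in> ?f ` A"
      then obtain u where u: "u \<in> A" "v = ?f u" by blast
      thus "v \<in> {v. odd (v - 0) \<and> (0, v) \<in> ?R \<and> (0 - 1, v) \<in> ?R}" using iff[of u] 1 2 by simp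
    qed
  qed
  have finU: "finite U" and finD: "finite D" by (simp_all add: U_def D_def finite_trapezoid)
  have R1: "{p\<in>?R. fst p < 0} - {0 - 1} \<times> ?f ` S = reflect ` (D - base_dents S)" for S
  proof -
    have "\<not> fst p < 0" if "p \<in> U" for p using posU[OF that] by simp
    hence "{p\<in>?R. fst p < 0} = reflect ` D" using negD by blast
    moreover have "{0 - 1} \<times> ?f ` S = reflect ` base_dents S"
    proof (rule Set.set_eqI)
      fix t :: point
      obtain k v where t: "t = (k, v)" by (cases t)
      show "t \<in> {0 - 1} \<times> ?f ` S \<longleftrightarrow> t \<in> reflect ` base_dents S"
        unfolding t mem_reflect_image base_dents_def by auto
    qed
    ultimately show ?thesis by (simp only: image_set_diff[OF inj_reflect])
  qed
  have R2: "{p\<in>?R. 0 \<le> fst p} - {0} \<times> ?f ` S = U - base_dents S" for S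
  proof -
    have "\<not> 0 \<le> fst p" if "p \<in> reflect ` D" for p using negD[OF that] by simp
    hence "{p\<in>?R. 0 \<le> fst p} = U" using posU by blast
    thus ?thesis by (simp only: base_dents_def)
  qed
  let ?term = "\<lambda>S. (\<Prod>s\<in>S. zigzag_factor s) * (brick_sum (D - base_dents S) * brick_sum (U - base_dents S))"
  have "M_RW x y z a b = brick_sum ?R"
    using M_RW_eq_brick_sum[of x y z a b] by (simp add: U_def D_def L_def tp_def tm_def ep_def em_def)
  also have "\<dots> = (\<Sum>S\<in>Pow A. (\<Prod>u\<in>S. if even (0::int) \<and> ?f u = 1 then 1 / 2 else 1) *
      (brick_sum ({p\<in>?R. fst p < 0} - {0 - 1} \<times> ?f ` S) * brick_sum ({p\<in>?R. 0 \<le> fst p} - {0} \<times> ?f ` S)))"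
    by (rule brick_sum_split_line_image[OF _ _ J]) (auto simp: finU finD inj_def)
  also have "\<dots> = (\<Sum>S\<in>Pow A. ?term S)"
    unfolding R1 R2 brick_sum_reflect by (simp add: zigzag_factor_def)
  also have "\<dots> = (\<Sum>S | S \<subseteq> ?G \<and> card S = y. ?term S)"
  \<comment> \<open>Both \<open>ep\<close> and \<open>em\<close> include \<open>y\<close>, so an
    empty half means \<open>y = 0\<close>, and on either side \<open>S = {}\<close> is the only
    possibility.\<close>
  proof (cases "ep = 0 \<or> em = 0")
    case True
    hence y: "y = 0" by (auto simp: ep_def em_def)
    have "{S. S \<subseteq> ?G \<and> card S = y} = {{}}" using y finite_subset[of _ ?G] by auto
    thus ?thesis using True by (simp add: A_def)
  next
    case False
    hence AG: "A = ?G" by (simp add: A_def)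
    have "(\<Sum>S\<in>Pow ?G. ?term S) = (\<Sum>S | S \<subseteq> ?G \<and> card S = y. ?term S)"
    \<comment> \<open>With a number of crossings other than \<open>y\<close> the upper half has the
      wrong number of dents and is unbalanced.\<close>
    proof (rule sum.mono_neutral_right)
      show "\<forall>S\<in>Pow ?G - {S. S \<subseteq> ?G \<and> card S = y}. ?term S = 0"
      proof
        fix S assume "S \<in> Pow ?G - {S. S \<subseteq> ?G \<and> card S = y}"
        hence S: "S \<subseteq> ?G" "card S \<noteq> y" by auto
        have fS: "finite S" by (rule finite_subset[OF S(1)]) simp
        have "card (dents tp \<union> S) = even_sum tp + card S"
          using card_Un_disjoint[OF finite_dents fS, of tp] Gp[OF S(1)] card_dents[OF tpl(1)] by (simp add: Int_commute)
        hence ne: "card (dents tp \<union> S) \<noteq> ep" using S(2) es(3) by simp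
        have sub: "dents tp \<union> S \<subseteq> {..<L}" using dents_subset[of tp] tpl(2) S(1) cL by auto
        have "ep \<le> L"
          using odd_sum_add_even_sum[of a] odd_sum_add_even_sum[of b] by (simp add: ep_def L_def)
        hence "brick_sum (trapezoid L ep - base_dents (dents tp \<union> S)) = 0"
          using brick_sum_dented_trapezoid_zero[OF _ _ sub ne] False by simp
        thus "?term S = 0"
          using brick_sum_upper[OF tpl(1) _ es(1) Gp[OF S(1)], of L] tpl(2) by (simp add: U_def)
      qed
    qed auto
    thus ?thesis by (simp add: AG)
  qed
  also have "\<dots> = (\<Sum>S | S \<subseteq> ?G \<and> card S = y. (\<Prod>s\<in>S. zigzag_factor s) *
    (2 ^ (?q - 1) * (sq_vandermonde (dents tm \<union> S) / hyperfac2 (2 * em)) * (sq_vandermonde (dents tp \<union> S) / hyperfac2 (2 * ep))))"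
  proof (rule sum.cong[OF refl])
    fix S assume "S \<in> {S. S \<subseteq> ?G \<and> card S = y}"
    hence S: "S \<subseteq> ?G" "card S = y" by auto
    have fS: "finite S" by (rule finite_subset[OF S(1)]) simp
    have cp: "card (dents tp \<union> S) = ep"
      using card_Un_disjoint[OF finite_dents fS, of tp] Gp[OF S(1)] card_dents[OF tpl(1)] S(2) es(3) by (simp add: Int_commute)
    have cm: "card (dents tm \<union> S) = em"
      using card_Un_disjoint[OF finite_dents fS, of tm] Gm[OF S(1)] card_dents[OF tml(1)] S(2) es(4) by (simp add: Int_commute)
    have sp: "dents tp \<union> S \<subseteq> {..<L}" using dents_subset[of tp] tpl(2) S(1) cL by auto
    have sm: "dents tm \<union> S \<subseteq> {..<L + z}" using dents_subset[of tm] tml(2) S(1) cL by auto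
    have u: "brick_sum (U - base_dents S) = sq_vandermonde (dents tp \<union> S) / hyperfac2 (2 * ep)"
      unfolding U_def using brick_sum_upper[OF tpl(1) _ es(1) Gp[OF S(1)], of L] tpl(2)
        brick_sum_dented_trapezoid'[OF sp cp] by simp
    have "sq_vandermonde (dents tm \<union> S) / hyperfac2 (2 * em) = (1 / 2) ^ (?q - 1) * brick_sum (D - base_dents S)"
      unfolding D_def using brick_sum_lower[OF tml(1,3,4,5) _ es(2) Gm[OF S(1)], of "L + z"] tml(2)
        brick_sum_dented_trapezoid'[OF sm cm] by simp
    hence "2 ^ (?q - 1) * (sq_vandermonde (dents tm \<union> S) / hyperfac2 (2 * em)) = brick_sum (D - base_dents S)"
      by (simp add: power_one_over)
    thus "?term S = (\<Prod>s\<in>S. zigzag_factor s) *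
    (2 ^ (?q - 1) * (sq_vandermonde (dents tm \<union> S) / hyperfac2 (2 * em)) * (sq_vandermonde (dents tp \<union> S) / hyperfac2 (2 * ep)))"
      by (simp only: u)
  qed
  finally show ?thesis .
qed

text \<open>The truncated \<open>q - 1\<close> is 0 at \<open>q = 0\<close>; this is the source of
  the separate exponent for \<open>a_1 = 0\<close>.\<close>

lemma two_powi_eq:
  fixes q y :: nat
  shows "2 ^ (q - 1) * (1 / 2) ^ y = (2::real) powi (if q = 0 then - int y else int q - int y - 1)"
proof (cases q)
  case 0
  thus ?thesis by (simp add: power_int_minus power_inverse inverse_eq_divide power_divide)
next
  case (Suc n)
  have "(2::real) powi (int n - int y) = 2 ^ n / 2 ^ y"
    by (simp add: power_int_diff)
  thus ?thesis using Suc by (simp add: power_divide)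
qed

lemma M_RW_eq_K':
  fixes x y z :: nat and a b :: "nat list"
  shows "M_RW x y z a b =
      2 powi (if term_at a 1 = 0 then - int y else int (term_at a 1) - int y - 1) *
      K' (t_plus x y a b) * K' (t_minus x y z a b) *
      ((hyperfac2 (2 * even_sum a + 2 * odd_sum b) *
        hyperfac2 (2 * odd_sum a + 2 * even_sum b + 2 * z)) /
       (hyperfac2 (2 * even_sum a + 2 * odd_sum b + 2 * y) *
        hyperfac2 (2 * odd_sum a + 2 * even_sum b + 2 * y + 2 * z))) *
      ((hyperfac (2 * int (sum_list a) + int (sum_list b) + 2 * int y + int z - 1) *
        hyperfac (int (sum_list b) + int y + int z)) /
       (hyperfac (2 * int (sum_list a) + int (sum_list b) + int y + int z - 1) *
        hyperfac (int (sum_list b) + int z))) *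
      ((T_prod (real x + 1) (2 * int (sum_list a) + int (sum_list b) + 2 * int y + int z - 2) y *
        V_prod (2 * real x + 2 * real (sum_list a) + 1)
          (int (sum_list b) + 2 * int y + int z - 1) y) /
       (T_prod 1 (2 * int (sum_list a) + int (sum_list b) + 2 * int y + int z - 2) y *
        V_prod (2 * real (sum_list a) + 1) (int (sum_list b) + 2 * int y + int z - 1) y))"
proof -
  define P where "P = dents (t_plus x y a b)"
  define M where "M = dents (t_minus x y z a b)"
  define A where "A = sum_list a"
  \<comment> \<open>The indentation of length \<open>z\<close> continues the right fern, so the
    right interval of occupied positions has length \<open>sum_list b + z\<close>.\<close>
  define B where "B = sum_list b + z"
  define c where "c = A + x + y"
  define ep where "ep = y + even_sum a + odd_sum b"
  define em where "em = y + z + odd_sum a + even_sum b"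
  define Z where "Z = (T_prod (real x + 1) (2 * int A + int B + 2 * int y - 2) y *
      V_prod (2 * real x + 2 * real A + 1) (int B + 2 * int y - 1) y) /
     (T_prod 1 (2 * int A + int B + 2 * int y - 2) y * V_prod (2 * real A + 1) (int B + 2 * int y - 1) y)"
  define Y where "Y = (hyperfac (2 * int A + int B + 2 * int y - 1) * hyperfac (int B + int y)) /
      (hyperfac (2 * int A + int B + int y - 1) * hyperfac (int B))"
  \<comment> \<open>The factor that is free of \<open>S\<close>.\<close>
  define C where "C = 2 ^ (term_at a 1 - 1) * (sq_vandermonde M / hyperfac2 (2 * em)) * (sq_vandermonde P / hyperfac2 (2 * ep))"
  have PM: "P \<inter> M = {}" "P \<union> M = {..<A} \<union> {c..<c + B}"
    using dents_t_plus_t_minus(1,2)[of x y a b z]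
    by (simp_all add: P_def M_def A_def B_def c_def add_ac)
  have fin: "finite P" "finite M" by (simp_all add: P_def M_def finite_dents)
  have "M_RW x y z a b = (\<Sum>S | S \<subseteq> {A..<c} \<and> card S = y. (\<Prod>s\<in>S. zigzag_factor s) *
    (2 ^ (term_at a 1 - 1) * (sq_vandermonde (M \<union> S) / hyperfac2 (2 * em)) *
      (sq_vandermonde (P \<union> S) / hyperfac2 (2 * ep))))"
    unfolding M_RW_eq_sum P_def M_def A_def c_def ep_def em_def ..
  also have "\<dots> = (\<Sum>S | S \<subseteq> {A..<c} \<and> card S = y.
      C * ((\<Prod>s\<in>S. selberg_weight A c B s) * (sq_vandermonde S * sq_vandermonde S)))"
  proof (rule sum.cong[OF refl])
    fix S assume "S \<in> {S. S \<subseteq> {A..<c} \<and> card S = y}"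
    hence S: "S \<subseteq> {A..<c}" by simp
    have fS: "finite S" by (rule finite_subset[OF S]) simp
    have dis: "P \<inter> S = {}" "M \<inter> S = {}"
    proof -
      have "(P \<union> M) \<inter> {A..<c} = {}" unfolding PM(2) by auto
      thus "P \<inter> S = {}" "M \<inter> S = {}" using S by blast+
    qed
    \<comment> \<open>The cross factors with \<open>P\<close> and \<open>M\<close> merge into one
      product over two intervals. As \<open>s\<close> lies between the intervals, the signs inside
      the absolute values are known.\<close>
    have w: "selberg_weight A c B s =
        zigzag_factor s * (\<Prod>p\<in>P. \<bar>(real s)\<^sup>2 - (real p)\<^sup>2\<bar>) * (\<Prod>p\<in>M. \<bar>(real s)\<^sup>2 - (real p)\<^sup>2\<bar>)" if s: "s \<in> S" for s
    proof -
      have As: "A \<le> s" "s < c" using S s by auto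
      have "(\<Prod>p\<in>P. \<bar>(real s)\<^sup>2 - (real p)\<^sup>2\<bar>) * (\<Prod>p\<in>M. \<bar>(real s)\<^sup>2 - (real p)\<^sup>2\<bar>) =
          (\<Prod>p\<in>{..<A} \<union> {c..<c + B}. \<bar>(real s)\<^sup>2 - (real p)\<^sup>2\<bar>)"
        unfolding PM(2)[symmetric] by (rule prod.union_disjoint[OF fin PM(1), symmetric])
      also have "\<dots> = (\<Prod>p<A. \<bar>(real s)\<^sup>2 - (real p)\<^sup>2\<bar>) * (\<Prod>p = c..<c + B. \<bar>(real s)\<^sup>2 - (real p)\<^sup>2\<bar>)"
        by (rule prod.union_disjoint) (auto simp: c_def)
      also have "(\<Prod>p<A. \<bar>(real s)\<^sup>2 - (real p)\<^sup>2\<bar>) = (\<Prod>p<A. (real s)\<^sup>2 - (real p)\<^sup>2)"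
        by (rule prod.cong) (use As in \<open>auto intro!: power_mono\<close>)
      also have "(\<Prod>p = c..<c + B. \<bar>(real s)\<^sup>2 - (real p)\<^sup>2\<bar>) = (\<Prod>p = c..<c + B. (real p)\<^sup>2 - (real s)\<^sup>2)"
      proof (rule prod.cong[OF refl])
        fix p assume "p \<in> {c..<c + B}"
        hence "(real s)\<^sup>2 \<le> (real p)\<^sup>2" using As by (intro power_mono) auto
        thus "\<bar>(real s)\<^sup>2 - (real p)\<^sup>2\<bar> = (real p)\<^sup>2 - (real s)\<^sup>2" by simp
      qed
      finally show ?thesis by (simp add: selberg_weight_def mult.assoc)
    qed
    have "(\<Prod>s\<in>S. selberg_weight A c B s) = (\<Prod>s\<in>S. zigzag_factor s) *
        (\<Prod>s\<in>S. \<Prod>p\<in>P. \<bar>(real s)\<^sup>2 - (real p)\<^sup>2\<bar>) * (\<Prod>s\<in>S. \<Prod>p\<in>M. \<bar>(real s)\<^sup>2 - (real p)\<^sup>2\<bar>)"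
      by (simp add: w prod.distrib)
    thus "(\<Prod>s\<in>S. zigzag_factor s) *
        (2 ^ (term_at a 1 - 1) * (sq_vandermonde (M \<union> S) / hyperfac2 (2 * em)) * (sq_vandermonde (P \<union> S) / hyperfac2 (2 * ep))) =
      C * ((\<Prod>s\<in>S. selberg_weight A c B s) * (sq_vandermonde S * sq_vandermonde S))"
      unfolding sq_vandermonde_union[OF fin(1) fS dis(1)] sq_vandermonde_union[OF fin(2) fS dis(2)] C_def
      by (simp only: times_divide_eq_left times_divide_eq_right mult_ac)
  qed
  also have "\<dots> = C * (\<Sum>S | S \<subseteq> {A..<c} \<and> card S = y.
      (\<Prod>s\<in>S. selberg_weight A c B s) * (sq_vandermonde S * sq_vandermonde S))"
    by (simp only: sum_distrib_left)
  also have "\<dots> = C * ((1 / 2) ^ y * Y * Z)"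
    unfolding selberg_sum[OF c_def] Y_def Z_def ..
  also have "\<dots> = (2 ^ (term_at a 1 - 1) * (1 / 2) ^ y) * K' (t_plus x y a b) * K' (t_minus x y z a b) *
      ((hyperfac2 (2 * (even_sum a + odd_sum b)) * hyperfac2 (2 * (odd_sum a + even_sum b + z))) /
       (hyperfac2 (2 * ep) * hyperfac2 (2 * em))) * Y * Z"
  proof -
    have "hyperfac2 (2 * e) > 0" for e by (simp add: hyperfac2_double prod_pos)
    hence nz: "hyperfac2 (2 * e) \<noteq> 0" for e by (metis less_irrefl)
    \<comment> \<open>\<open>K'\<close> divides by \<open>hyperfac2\<close> at twice the number of
      fern dents, each half of the region at twice that number plus \<open>y\<close>. The quotient
      of the four values of \<open>hyperfac2\<close> compensates for this.\<close>
    have Kp: "K' (t_plus x y a b) = sq_vandermonde P / hyperfac2 (2 * (even_sum a + odd_sum b))"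
      using K'_eq[OF even_blocks_t_plus(2)[of "\<lambda>p q. {p..<q}" x y a b]] by (simp add: dents_t_plus_t_minus(3) P_def)
    have Km: "K' (t_minus x y z a b) = sq_vandermonde M / hyperfac2 (2 * (odd_sum a + even_sum b + z))"
      using K'_eq[OF even_blocks_t_minus(2)[of "\<lambda>p q. {p..<q}" x y z a b]] by (simp add: dents_t_plus_t_minus(4) M_def)
    define h1 h2 where "h1 = hyperfac2 (2 * (even_sum a + odd_sum b))" and "h2 = hyperfac2 (2 * (odd_sum a + even_sum b + z))"
    have "h1 \<noteq> 0" "h2 \<noteq> 0" unfolding h1_def h2_def by (rule nz)+
    thus ?thesis unfolding Kp Km C_def h1_def[symmetric] h2_def[symmetric] by (simp add: mult_ac)
  qed
  finally have main: "M_RW x y z a b = (2 ^ (term_at a 1 - 1) * (1 / 2) ^ y) * K' (t_plus x y a b) * K' (t_minus x y z a b) *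
      ((hyperfac2 (2 * (even_sum a + odd_sum b)) * hyperfac2 (2 * (odd_sum a + even_sum b + z))) /
       (hyperfac2 (2 * ep) * hyperfac2 (2 * em))) * Y * Z" .
  have e1: "2 * int A + int B + 2 * int y - 1 = 2 * int A + int (sum_list b) + 2 * int y + int z - 1" by (simp add: B_def)
  have e2: "2 * int A + int B + int y - 1 = 2 * int A + int (sum_list b) + int y + int z - 1" by (simp add: B_def)
  have e3: "2 * int A + int B + 2 * int y - 2 = 2 * int A + int (sum_list b) + 2 * int y + int z - 2" by (simp add: B_def)
  have e4: "int B + 2 * int y - 1 = int (sum_list b) + 2 * int y + int z - 1" by (simp add: B_def)
  have e5: "int B + int y = int (sum_list b) + int y + int z" by (simp add: B_def)
  have e6: "int B = int (sum_list b) + int z" by (simp add: B_def)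
  have e7: "2 * (even_sum a + odd_sum b) = 2 * even_sum a + 2 * odd_sum b" by (rule distrib_left)
  have e8: "2 * (odd_sum a + even_sum b + z) = 2 * odd_sum a + 2 * even_sum b + 2 * z" by (simp only: distrib_left)
  have e9: "2 * ep = 2 * even_sum a + 2 * odd_sum b + 2 * y" by (simp add: ep_def)
  have e10: "2 * em = 2 * odd_sum a + 2 * even_sum b + 2 * y + 2 * z" by (simp add: em_def)
  show ?thesis
    by (rule main[unfolded two_powi_eq Y_def Z_def, unfolded e1 e2 e3 e4 e5, unfolded e6 e7 e8 e9 e10, unfolded A_def])
qed

section \<open>Positivity and the first identity\<close>

lemma K'_pos:
  assumes "even (length t)"
  shows "K' t > 0"
proof -
  have "hyperfac2 (2 * even_sum t) > 0" by (simp add: hyperfac2_double prod_pos)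
  thus ?thesis unfolding K'_eq[OF assms] using sq_vandermonde_pos[of "dents t"] by simp
qed

lemma hyperfac2_pos: "hyperfac2 n > 0"
  by (simp add: hyperfac2_def prod_pos)

lemma T_prod_pos: "x > 0 \<Longrightarrow> T_prod x n m > 0"
  by (auto simp: T_prod_def intro!: prod_pos pochhammer_pos)

lemma V_prod_pos: "x > 0 \<Longrightarrow> V_prod x n m > 0"
  by (auto simp: V_prod_def skip_pochhammer_def intro!: prod_pos add_pos_nonneg)

lemma t_plus_add: "t_plus x y a b = t_plus (x + y) 0 a b"
  by (simp add: t_plus_def add.assoc)

lemma t_minus_add: "t_minus x y z a b = t_minus (x + y) 0 z a b"
  by (simp add: t_minus_def add.assoc)

theorem theorem2p11:
  fixes x y z :: nat and a b :: "nat list"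
  shows "(M_RW x y z a b =
      M_RW (x + y) 0 z a b * M_RW 0 y z a b / M_RW y 0 z a b *
      ((T_prod (real x + 1) (2 * int (sum_list a) + int (sum_list b) + 2 * int y + int z - 2) y *
        V_prod (2 * real x + 2 * real (sum_list a) + 1)
          (int (sum_list b) + 2 * int y + int z - 1) y) /
       (T_prod 1 (2 * int (sum_list a) + int (sum_list b) + 2 * int y + int z - 2) y *
        V_prod (2 * real (sum_list a) + 1) (int (sum_list b) + 2 * int y + int z - 1) y))) \<and>
    (M_RW x y z a b =
      2 powi (if term_at a 1 = 0 then - int y else int (term_at a 1) - int y - 1) *
      K' (t_plus x y a b) * K' (t_minus x y z a b) *
      ((hyperfac2 (2 * even_sum a + 2 * odd_sum b) *
        hyperfac2 (2 * odd_sum a + 2 * even_sum b + 2 * z)) /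
       (hyperfac2 (2 * even_sum a + 2 * odd_sum b + 2 * y) *
        hyperfac2 (2 * odd_sum a + 2 * even_sum b + 2 * y + 2 * z))) *
      ((hyperfac (2 * int (sum_list a) + int (sum_list b) + 2 * int y + int z - 1) *
        hyperfac (int (sum_list b) + int y + int z)) /
       (hyperfac (2 * int (sum_list a) + int (sum_list b) + int y + int z - 1) *
        hyperfac (int (sum_list b) + int z))) *
      ((T_prod (real x + 1) (2 * int (sum_list a) + int (sum_list b) + 2 * int y + int z - 2) y *
        V_prod (2 * real x + 2 * real (sum_list a) + 1)
          (int (sum_list b) + 2 * int y + int z - 1) y) /
       (T_prod 1 (2 * int (sum_list a) + int (sum_list b) + 2 * int y + int z - 2) y *
        V_prod (2 * real (sum_list a) + 1) (int (sum_list b) + 2 * int y + int z - 1) y)))"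
  (is "?first \<and> ?second")
proof (rule conjI)
  show ?second by (rule M_RW_eq_K')
  let ?A = "sum_list a" and ?B = "sum_list b"
  define E where "E = (\<lambda>y. (2 powi (if term_at a 1 = 0 then - int y else int (term_at a 1) - int y - 1) :: real))"
  define H where "H = (\<lambda>y. (hyperfac2 (2 * even_sum a + 2 * odd_sum b) *
        hyperfac2 (2 * odd_sum a + 2 * even_sum b + 2 * z)) /
       (hyperfac2 (2 * even_sum a + 2 * odd_sum b + 2 * y) *
        hyperfac2 (2 * odd_sum a + 2 * even_sum b + 2 * y + 2 * z)))"
  define G where "G = (\<lambda>y. (hyperfac (2 * int ?A + int ?B + 2 * int y + int z - 1) *
        hyperfac (int ?B + int y + int z)) /
       (hyperfac (2 * int ?A + int ?B + int y + int z - 1) * hyperfac (int ?B + int z)))"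
  define N where "N = (\<lambda>x y. T_prod (real x + 1) (2 * int ?A + int ?B + 2 * int y + int z - 2) y *
        V_prod (2 * real x + 2 * real ?A + 1) (int ?B + 2 * int y + int z - 1) y)"
  define D where "D = (\<lambda>y. T_prod 1 (2 * int ?A + int ?B + 2 * int y + int z - 2) y *
        V_prod (2 * real ?A + 1) (int ?B + 2 * int y + int z - 1) y)"
  \<comment> \<open>In both sequences \<open>x\<close> and \<open>y\<close> occur only as the sum
    \<open>x + y\<close> in the middle term, so the product of the two quartered hexagons is a
    function of \<open>x + y\<close>.\<close>
  define K where "K = (\<lambda>n. K' (t_plus n 0 a b) * K' (t_minus n 0 z a b))"
  have M: "M_RW x y z a b = E y * H y * G y * K (x + y) * (N x y / D y)" for x y
    unfolding M_RW_eq_K'[of x y z a b] t_plus_add[of x y] t_minus_add[of x y] E_def H_def G_def N_def D_def K_def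
    by (simp only: mult_ac)
  \<comment> \<open>All factors are positive, so the division by \<open>M_RW y 0 z a b\<close> is
    legitimate and the common factors cancel.\<close>
  have pos: "E y > 0" "H y > 0" "G y > 0" "K n > 0" "D y > 0" for y n
    unfolding E_def H_def G_def K_def D_def
    using even_blocks_t_plus(2)[of "\<lambda>p q. {p..<q}" n 0 a b] even_blocks_t_minus(2)[of "\<lambda>p q. {p..<q}" n 0 z a b]
    by (auto intro!: mult_pos_pos divide_pos_pos hyperfac2_pos hyperfac_pos K'_pos T_prod_pos V_prod_pos)
  \<comment> \<open>For \<open>y = 0\<close> the products are empty, and for \<open>x = 0\<close>
    numerator and denominator coincide. So the last quotient is 1 in each of the three counts on the
    right.\<close>
  have N0: "N x 0 = D 0" "N 0 y = D y" for x by (simp_all add: N_def D_def T_prod_def V_prod_def)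
  have "M_RW x y z a b = M_RW (x + y) 0 z a b * M_RW 0 y z a b / M_RW y 0 z a b * (N x y / D y)"
    unfolding M N0 using pos[of 0] pos[of y] pos(4)[of "x + y"] pos(4)[of y]
    by (simp add: field_simps)
  thus ?first by (simp only: N_def D_def)
qed

end
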